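(* Let $\mathcal D$ be a right co-$H$-category, let $\mathcal{M},\mathcal{N}\in {_{\mathcal{D}}}{\mathscr{M}}^H$ and suppose that $\mathcal{M}$ is finitely generated as an object in $\mathcal{D}\text{-}Mod$. Then $Hom_{\mathcal{D}\text{-}Mod}(\mathcal{M},\mathcal{N})$ is a right $H$-comodule (that is, with the left $H^*$-module structure described in the context it is a rational $H^*$-module). In particular, $$HOM_{\mathcal{D}\text{-}Mod}(\mathcal{M},\mathcal{N})= Hom_{\mathcal{D}\text{-}Mod}(\mathcal{M},\mathcal{N}).$$
   Context: $K$ is a field and $H$ is a Hopf algebra over $K$ with bijective antipode $S$; $H^*$ is its linear dual, an algebra under convolution $(h^*g^* )(h)=\sum h^*(h_1)g^*(h_2)$. $Comod\text{-}H$ is the category of right $H$-comodules; coactions are written $\rho(m)=\sum m_0\otimes m_1$. For right $H$-comodules $M,N$, $M\otimes N$ has coaction $m\otimes n\mapsto\sum m_0\otimes n_0\otimes m_1n_1$. A left $H^*$-module $M$ is rational if the map $M\to Hom_K(H^*,M)$, $m\mapsto(h^*\mapsto h^*m)$, has image in $M\otimes H$, where $m\otimes h\in M\otimes H$ is viewed as the map $h^*\mapsto h^*(h)m$. A right $H$-comodule is a left $H^*$-module via $h^*m=\sum h^*(m_1)m_0$, and this identifies $Comod\text{-}H$ with the full subcategory of rational left $H^*$-modules. A right co-$H$-category $\mathcal D$ is a small $K$-linear category such that every $Hom_{\mathcal D}(X,Y)$ is a right $H$-comodule with coaction $\rho_{XY}(f)=\sum f_0\otimes f_1$, $\rho_{XX}(\mathrm{id}_X)=\mathrm{id}_X\otimes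 1_H$, and $\rho_{XZ}(fg)=\sum f_0g_0\otimes f_1g_1$ for composable $g:X\to Y$, $f:Y\to Z$. $\mathcal D\text{-}Mod$ is the category of left $\mathcal D$-modules, i.e. $K$-linear functors $\mathcal D\to Vect_K$. A left $\mathcal D$-module $\mathcal M$ is finitely generated if there are finitely many $m_i\in\mathcal M(X_i)$ such that every $y\in\mathcal M(Y)$ has the form $\sum_i\mathcal M(f_i)(m_i)$ with $f_i\in Hom_{\mathcal D}(X_i,Y)$. A relative $(\mathcal D,H)$-Hopf module is a left $\mathcal D$-module $\mathcal M$ with a right $H$-comodule structure on each $\mathcal M(X)$ such that $\rho_{\mathcal M(Y)}(\mathcal M(f)(m))=\sum\mathcal M(f_0)(m_0)\otimes f_1m_1$ for all $f\in Hom_{\mathcal D}(X,Y)$, $m\in\mathcal M(X)$. The category of these, with morphisms the $\mathcal D$-module morphisms $\eta$ such that every $\eta(X)$ is $H$-colinear, is ${_{\mathcal{D}}}{\mathscr{M}}^H$. For $\mathcal M,\mathcal N\in{_{\mathcal{D}}}{\mathscr{M}}^H$, $Hom_{\mathcal D\text{-}Mod}(\mathcal M,\mathcal N)$ is a left $H^*$-module via $$(h^*\eta)(X)(m)=\sum h^*\big(S^{-1}(m_1)(\eta(X)(m_0))_1\big)(\eta(X)(m_0))_0 .$$ For $\mathcal N\in{_{\mathcal{D}}}{\mathscr{M}}^H$ and $M\in Comod\text{-}H$, $\mathcal N\otimes M\in{_{\mathcal{D}}}{\mathscr{M}}^H$ is given by $(\mathcal N\otimes M)(X)=\mathcal N(X)\otimes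 M$ (tensor product of comodules) and $(\mathcal N\otimes M)(f)(n\otimes m)=\mathcal N(f)(n)\otimes m$. The functor $\mathcal N\otimes(-):Comod\text{-}H\to{_{\mathcal{D}}}{\mathscr{M}}^H$ has a right adjoint $\mathscr R_{\mathcal N}$, and $HOM_{\mathcal D\text{-}Mod}(\mathcal N,\mathcal P):=\mathscr R_{\mathcal N}(\mathcal P)$. Since this is determined up to canonical isomorphism by the adjunction, "$=$" in the claim means canonical isomorphism in $Comod\text{-}H$. *)

theory Defs
  imports HOL.Vector_Spaces "HOL-Library.Function_Algebras"
begin

text \<open>
  A \<open>K\<close>-vector space is a subspace \<open>carrier\<close> of a type \<open>'v\<close> that is itself a vector space over
  the field \<open>'k\<close>.  The members of a family (such as the \<open>Hom\<close>-spaces of a category) may then share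
  one type, which loses no generality, since any family embeds into its direct sum.
\<close>

record ('k, 'v) vspace =
  carrier :: "'v set"
  scale :: "'k \<Rightarrow> 'v \<Rightarrow> 'v"

definition vspace :: "('k::field, 'v::ab_group_add, 'x) vspace_scheme \<Rightarrow> bool" where
  "vspace V \<longleftrightarrow> vector_space (scale V) \<and> module.subspace (scale V) (carrier V)"

definition lin :: "('k::field, 'v::ab_group_add, 'x) vspace_scheme
    \<Rightarrow> ('k, 'w::ab_group_add, 'y) vspace_scheme \<Rightarrow> ('v \<Rightarrow> 'w) \<Rightarrow> bool" where
  "lin V W f \<longleftrightarrow>
     (\<forall>x\<in>carrier V. f x \<in> carrier W) \<and>
     (\<forall>x\<in>carrier V. \<forall>y\<in>carrier V. f (x + y) = f x + f y) \<and>
     (\<forall>c. \<forall>x\<in>carrier V. f (scale V c x) = scale W c (f x))"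

definition bilin :: "('k::field, 'v::ab_group_add, 'x) vspace_scheme
    \<Rightarrow> ('k, 'w::ab_group_add, 'y) vspace_scheme \<Rightarrow> ('k, 'u::ab_group_add, 'z) vspace_scheme
    \<Rightarrow> ('v \<Rightarrow> 'w \<Rightarrow> 'u) \<Rightarrow> bool" where
  "bilin V W U B \<longleftrightarrow>
     (\<forall>x\<in>carrier V. lin W U (B x)) \<and> (\<forall>y\<in>carrier W. lin V U (\<lambda>x. B x y))"


section \<open>Tensor products\<close>

text \<open>
  Over a field, \<open>V \<otimes> W\<close> embeds into the dual of the space of bilinear forms on \<open>V \<times> W\<close>,
  with \<open>v \<otimes> w\<close> acting as evaluation at \<open>(v, w)\<close>; we take the span of these evaluations as
  the tensor product.  The facts \<open>tens_bilinear\<close>, \<open>tprod_list\<close>, \<open>tsum_list\<close> and \<open>tsum_bilin\<close> below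
  are its universal property.
\<close>

type_synonym ('k, 'v, 'w) tensor = "('v \<Rightarrow> 'w \<Rightarrow> 'k) \<Rightarrow> 'k"

definition bilinear_form :: "('k::field, 'v::ab_group_add, 'x) vspace_scheme
    \<Rightarrow> ('k, 'w::ab_group_add, 'y) vspace_scheme \<Rightarrow> ('v \<Rightarrow> 'w \<Rightarrow> 'k) \<Rightarrow> bool" where
  "bilinear_form V W b \<longleftrightarrow>
     (\<forall>v. Vector_Spaces.linear (scale W) (*) (b v)) \<and>
     (\<forall>w. Vector_Spaces.linear (scale V) (*) (\<lambda>v. b v w))"

definition tens :: "('k::field, 'v::ab_group_add, 'x) vspace_scheme
    \<Rightarrow> ('k, 'w::ab_group_add, 'y) vspace_scheme \<Rightarrow> 'v \<Rightarrow> 'w \<Rightarrow> ('k, 'v, 'w) tensor" where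
  "tens V W v w = (\<lambda>b. if bilinear_form V W b then b v w else 0)"

definition tscale :: "'k::field \<Rightarrow> ('k, 'v, 'w) tensor \<Rightarrow> ('k, 'v, 'w) tensor" where
  "tscale c t = (\<lambda>b. c * t b)"

definition tprod :: "('k::field, 'v::ab_group_add, 'x) vspace_scheme
    \<Rightarrow> ('k, 'w::ab_group_add, 'y) vspace_scheme \<Rightarrow> ('k, ('k, 'v, 'w) tensor) vspace" where
  "tprod V W =
     \<lparr>carrier = module.span tscale {tens V W v w |v w. v \<in> carrier V \<and> w \<in> carrier W},
      scale = tscale\<rparr>"

text \<open>
  \<open>tsum V W t B\<close> is the Sweedler sum \<open>\<Sum> B(t\<^sub>0, t\<^sub>1)\<close> of \<open>t = \<Sum> t\<^sub>0 \<otimes> t\<^sub>1 \<in> V \<otimes> W\<close>, that is, the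
  value at \<open>t\<close> of the linear map induced by \<open>B\<close>.  It does not depend on the
  representation of \<open>t\<close> if \<open>B\<close> is bilinear on the carriers, which is the case in all uses below.
\<close>

definition tsum :: "('k::field, 'v::ab_group_add, 'x) vspace_scheme
    \<Rightarrow> ('k, 'w::ab_group_add, 'y) vspace_scheme \<Rightarrow> ('k, 'v, 'w) tensor
    \<Rightarrow> ('v \<Rightarrow> 'w \<Rightarrow> 'u::ab_group_add) \<Rightarrow> 'u" where
  "tsum V W t B = (THE u. \<exists>xs. set xs \<subseteq> carrier V \<times> carrier W \<and>
      t = (\<Sum>(v, w)\<leftarrow>xs. tens V W v w) \<and> u = (\<Sum>(v, w)\<leftarrow>xs. B v w))"

lemma vector_space_tscale: "vector_space tscale"
  by unfold_locales (auto simp: tscale_def fun_eq_iff algebra_simps)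

lemma vspace_tprod:
  fixes V :: "('k::field, 'v::ab_group_add, 'x) vspace_scheme"
    and W :: "('k, 'w::ab_group_add, 'y) vspace_scheme"
  shows "vspace (tprod V W)"
proof -
  interpret vector_space "tscale :: 'k \<Rightarrow> ('k, 'v, 'w) tensor \<Rightarrow> _" by (rule vector_space_tscale)
  show ?thesis
    by (simp add: vspace_def tprod_def vector_space_tscale)
qed

lemma tens_in_tprod:
  fixes V :: "('k::field, 'v::ab_group_add, 'x) vspace_scheme"
    and W :: "('k, 'w::ab_group_add, 'y) vspace_scheme"
  assumes "v \<in> carrier V" and "w \<in> carrier W"
  shows "tens V W v w \<in> carrier (tprod V W)"
proof -
  interpret vector_space "tscale :: 'k \<Rightarrow> ('k, 'v, 'w) tensor \<Rightarrow> _" by (rule vector_space_tscale)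
  from assms show ?thesis
    by (auto simp: tprod_def intro!: span_base)
qed

lemma tens_bilinear:
  fixes V :: "('k::field, 'v::ab_group_add, 'x) vspace_scheme"
    and W :: "('k, 'w::ab_group_add, 'y) vspace_scheme"
  shows "tens V W (v + v') w = tens V W v w + tens V W v' w"
    and "tens V W v (w + w') = tens V W v w + tens V W v w'"
    and "tens V W (scale V c v) w = tscale c (tens V W v w)"
    and "tens V W v (scale W c w) = tscale c (tens V W v w)"
proof -
  have *: "b (v + v') w = b v w + b v' w" "b v (w + w') = b v w + b v w'"
    "b (scale V c v) w = c * b v w" "b v (scale W c w) = c * b v w"
    if "bilinear_form V W b" for b
  proof -
    interpret l1: Vector_Spaces.linear "scale W" "(*)" "b v"
      using that by (auto simp: bilinear_form_def)
    interpret l2: Vector_Spaces.linear "scale V" "(*)" "\<lambda>v. b v w"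
      using that by (auto simp: bilinear_form_def)
    show "b (v + v') w = b v w + b v' w" "b v (w + w') = b v w + b v w'"
      "b (scale V c v) w = c * b v w" "b v (scale W c w) = c * b v w"
      by (simp_all add: l1.add l2.add l1.scale l2.scale)
  qed
  show "tens V W (v + v') w = tens V W v w + tens V W v' w"
    and "tens V W v (w + w') = tens V W v w + tens V W v w'"
    and "tens V W (scale V c v) w = tscale c (tens V W v w)"
    and "tens V W v (scale W c w) = tscale c (tens V W v w)"
    by (auto simp: tens_def tscale_def fun_eq_iff *)
qed

lemma tprod_list:
  fixes V :: "('k::field, 'v::ab_group_add, 'x) vspace_scheme"
    and W :: "('k, 'w::ab_group_add, 'y) vspace_scheme"
  assumes "vspace V" and "t \<in> carrier (tprod V W)"
  obtains xs where "set xs \<subseteq> carrier V \<times> carrier W" "t = (\<Sum>(v, w)\<leftarrow>xs. tens V W v w)"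
proof -
  interpret vector_space "tscale :: 'k \<Rightarrow> ('k, 'v, 'w) tensor \<Rightarrow> _" by (rule vector_space_tscale)
  interpret V: vector_space "scale V" using assms by (simp add: vspace_def)
  have sub: "V.subspace (carrier V)" using assms by (simp add: vspace_def)
  from assms(2) have "t \<in> span {tens V W v w |v w. v \<in> carrier V \<and> w \<in> carrier W}"
    by (simp add: tprod_def)
  then have "\<exists>xs. set xs \<subseteq> carrier V \<times> carrier W \<and> t = (\<Sum>(v, w)\<leftarrow>xs. tens V W v w)"
  proof (induction rule: span_induct_alt)
    case base
    show ?case by (intro exI[of _ "[]"]) simp
  next
    case (step c x y)
    then obtain v w xs where "v \<in> carrier V" "w \<in> carrier W" "x = tens V W v w"
      "set xs \<subseteq> carrier V \<times> carrier W" "y = (\<Sum>(v, w)\<leftarrow>xs. tens V W v w)" by auto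
    then show ?case
      by (intro exI[of _ "(scale V c v, w) # xs"])
        (auto simp: tens_bilinear intro: V.subspace_scale[OF sub])
  qed
  with that show ?thesis by blast
qed

lemma subspace_projection:
  assumes "vspace V"
  obtains p where "Vector_Spaces.linear (scale V) (scale V) p"
    "\<And>x. p x \<in> carrier V" "\<And>x. x \<in> carrier V \<Longrightarrow> p x = x"
proof -
  interpret V: vector_space "scale V" using assms by (simp add: vspace_def)
  interpret vector_space_pair "scale V" "scale V" by unfold_locales
  have sub: "V.subspace (carrier V)" using assms by (simp add: vspace_def)
  obtain p where "range p \<subseteq> carrier V" "Vector_Spaces.linear (scale V) (scale V) p"
    "\<forall>x\<in>carrier V. p x = x"
    using linear_exists_left_inverse_on[OF V.linear_ident sub] by auto
  then show ?thesis by (intro that[of p]) auto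
qed

lemma separating_functional:
  assumes "vector_space s" and "x \<noteq> (0 :: 'v::ab_group_add)"
  obtains f where "Vector_Spaces.linear s ((*) :: 'k::field \<Rightarrow> 'k \<Rightarrow> 'k) f" "f x \<noteq> 0"
proof -
  interpret V: vector_space s by fact
  interpret K: vector_space "(*) :: 'k \<Rightarrow> 'k \<Rightarrow> 'k" by unfold_locales (auto simp: algebra_simps)
  interpret vector_space_pair s "(*) :: 'k \<Rightarrow> 'k \<Rightarrow> 'k" by unfold_locales
  have "V.independent {x}" using assms(2) by simp
  from linear_independent_extend[OF this, of "\<lambda>_. 1"] that show ?thesis by auto
qed

lemma tsum_list:
  fixes V :: "('k::field, 'v::ab_group_add, 'x) vspace_scheme"
    and W :: "('k, 'w::ab_group_add, 'y) vspace_scheme"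
    and U :: "('k, 'u::ab_group_add, 'z) vspace_scheme"
  assumes V: "vspace V" and W: "vspace W" and U: "vspace U" and B: "bilin V W U B"
    and xs: "set xs \<subseteq> carrier V \<times> carrier W"
  shows "tsum V W (\<Sum>(v, w)\<leftarrow>xs. tens V W v w) B = (\<Sum>(v, w)\<leftarrow>xs. B v w)"
proof -
  interpret V: vector_space "scale V" using V by (simp add: vspace_def)
  interpret W: vector_space "scale W" using W by (simp add: vspace_def)
  interpret U: vector_space "scale U" using U by (simp add: vspace_def)
  interpret K: vector_space "(*) :: 'k \<Rightarrow> 'k \<Rightarrow> 'k" by unfold_locales (auto simp: algebra_simps)
  obtain p where p: "Vector_Spaces.linear (scale V) (scale V) p"
    "\<And>x. p x \<in> carrier V" "\<And>x. x \<in> carrier V \<Longrightarrow> p x = x" using subspace_projection[OF V] by blast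
  obtain q where q: "Vector_Spaces.linear (scale W) (scale W) q"
    "\<And>x. q x \<in> carrier W" "\<And>x. x \<in> carrier W \<Longrightarrow> q x = x" using subspace_projection[OF W] by blast
  have eq: "(\<Sum>(v, w)\<leftarrow>ys. B v w) = (\<Sum>(v, w)\<leftarrow>xs. B v w)"
    if ys: "set ys \<subseteq> carrier V \<times> carrier W"
      and t: "(\<Sum>(v, w)\<leftarrow>xs. tens V W v w) = (\<Sum>(v, w)\<leftarrow>ys. tens V W v w)" for ys
  proof (rule ccontr)
    assume "\<not> ?thesis"
    then have "(\<Sum>(v, w)\<leftarrow>ys. B v w) - (\<Sum>(v, w)\<leftarrow>xs. B v w) \<noteq> 0" by simp
    from separating_functional[OF U.vector_space_axioms this]
    obtain f where f: "Vector_Spaces.linear (scale U) (*) f"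
      and f0: "f ((\<Sum>(v, w)\<leftarrow>ys. B v w) - (\<Sum>(v, w)\<leftarrow>xs. B v w)) \<noteq> 0" by blast
    interpret f: Vector_Spaces.linear "scale U" "(*)" f by fact
    interpret p: Vector_Spaces.linear "scale V" "scale V" p by fact
    interpret q: Vector_Spaces.linear "scale W" "scale W" q by fact
    define b where "b = (\<lambda>v w. f (B (p v) (q w)))"
    have b: "bilinear_form V W b"
      using B unfolding bilinear_form_def b_def bilin_def lin_def
      by (auto intro!: Vector_Spaces.linear.intro module_hom.intro module_hom_axioms.intro
            V.vector_space_axioms W.vector_space_axioms K.vector_space_axioms
            V.module_axioms W.module_axioms K.module_axioms
            simp: p.add q.add p.scale q.scale p(2) q(2) f.add f.scale)
    have ev: "(\<Sum>(v, w)\<leftarrow>zs. tens V W v w) b = f (\<Sum>(v, w)\<leftarrow>zs. B v w)"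
      if "set zs \<subseteq> carrier V \<times> carrier W" for zs
      using that by (induction zs) (auto simp: f.add f.zero tens_def b[unfolded b_def] b_def p(3) q(3))
    from f0 ev[OF xs] ev[OF ys] t show False by (simp add: f.diff)
  qed
  show ?thesis unfolding tsum_def
    by (rule the_equality) (use xs eq in blast)+
qed

lemma tsum_bilin:
  fixes V :: "('k::field, 'v::ab_group_add, 'x) vspace_scheme"
    and W :: "('k, 'w::ab_group_add, 'y) vspace_scheme"
    and U :: "('k, 'u::ab_group_add, 'z) vspace_scheme"
  assumes "vspace V" "vspace W" "vspace U" "bilin V W U B"
  shows "lin (tprod V W) U (\<lambda>t. tsum V W t B)"
    and "v \<in> carrier V \<Longrightarrow> w \<in> carrier W \<Longrightarrow> tsum V W (tens V W v w) B = B v w"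
proof -
  interpret V: vector_space "scale V" using assms by (simp add: vspace_def)
  interpret U: vector_space "scale U" using assms by (simp add: vspace_def)
  interpret T: vector_space "tscale :: 'k \<Rightarrow> ('k, 'v, 'w) tensor \<Rightarrow> _" by (rule vector_space_tscale)
  have subV: "V.subspace (carrier V)" and subU: "U.subspace (carrier U)"
    using assms by (simp_all add: vspace_def)
  note sl = tsum_list[OF assms]
  show "v \<in> carrier V \<Longrightarrow> w \<in> carrier W \<Longrightarrow> tsum V W (tens V W v w) B = B v w"
    using sl[of "[(v, w)]"] by simp
  have mem: "(\<Sum>(v, w)\<leftarrow>xs. B v w) \<in> carrier U" if "set xs \<subseteq> carrier V \<times> carrier W" for xs
    using that assms(4)
    by (induction xs) (auto simp: bilin_def lin_def intro: U.subspace_0[OF subU] U.subspace_add[OF subU])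
  show "lin (tprod V W) U (\<lambda>t. tsum V W t B)"
    unfolding lin_def
  proof (intro conjI ballI allI)
    fix t assume "t \<in> carrier (tprod V W)"
    from tprod_list[OF assms(1) this] obtain xs where xs: "set xs \<subseteq> carrier V \<times> carrier W"
      "t = (\<Sum>(v, w)\<leftarrow>xs. tens V W v w)" .
    with mem sl show "tsum V W t B \<in> carrier U" by simp
    fix c
    define ys where "ys = map (\<lambda>(v, w). (scale V c v, w)) xs"
    have ys: "set ys \<subseteq> carrier V \<times> carrier W"
      using xs(1) by (auto simp: ys_def intro: V.subspace_scale[OF subV])
    have 1: "tscale c (\<Sum>(v, w)\<leftarrow>xs. tens V W v w) = (\<Sum>(v, w)\<leftarrow>ys. tens V W v w)"
      unfolding ys_def
      by (induct xs) (auto simp: tens_bilinear tscale_def fun_eq_iff algebra_simps)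
    have 2: "scale U c (\<Sum>(v, w)\<leftarrow>xs. B v w) = (\<Sum>(v, w)\<leftarrow>ys. B v w)"
      using xs(1) assms(4) unfolding ys_def
      by (induct xs) (auto simp: U.scale_right_distrib bilin_def lin_def o_def)
    show "tsum V W (scale (tprod V W) c t) B = scale U c (tsum V W t B)"
      using sl[OF xs(1)] sl[OF ys] 1 2 xs(2) by (simp add: tprod_def)
  next
    fix t t' assume "t \<in> carrier (tprod V W)" "t' \<in> carrier (tprod V W)"
    with tprod_list[OF assms(1)] obtain xs xs' where xs: "set xs \<subseteq> carrier V \<times> carrier W"
      "t = (\<Sum>(v, w)\<leftarrow>xs. tens V W v w)" "set xs' \<subseteq> carrier V \<times> carrier W"
      "t' = (\<Sum>(v, w)\<leftarrow>xs'. tens V W v w)" by metis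
    then show "tsum V W (t + t') B = tsum V W t B + tsum V W t' B"
      using sl[OF xs(1)] sl[OF xs(3)] sl[of "xs @ xs'"] by simp
  qed
qed


section \<open>Hopf algebras and their comodules\<close>

text \<open>The underlying ring of a Hopf algebra is the type \<open>'h\<close>.\<close>

record ('k, 'h) hopf = "('k, 'h) vspace" +
  comult :: "'h \<Rightarrow> ('k, 'h, 'h) tensor"
  counit :: "'h \<Rightarrow> 'k"
  antipode :: "'h \<Rightarrow> 'h"

definition hopf_algebra :: "('k::field, 'h::ring_1) hopf \<Rightarrow> bool" where
  "hopf_algebra H \<longleftrightarrow>
     vspace H \<and> carrier H = UNIV \<and>
     (\<forall>c x y. scale H c (x * y) = scale H c x * y \<and> scale H c (x * y) = x * scale H c y) \<and>
     lin H (tprod H H) (comult H) \<and>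
     Vector_Spaces.linear (scale H) (*) (counit H) \<and>
     Vector_Spaces.linear (scale H) (scale H) (antipode H) \<and>
     (\<forall>h. tsum H H (comult H h) (\<lambda>h\<^sub>1 h\<^sub>2. tens (tprod H H) H (comult H h\<^sub>1) h\<^sub>2) =
          tsum H H (comult H h) (\<lambda>h\<^sub>1 h'. tsum H H (comult H h')
            (\<lambda>h\<^sub>2 h\<^sub>3. tens (tprod H H) H (tens H H h\<^sub>1 h\<^sub>2) h\<^sub>3))) \<and>
     (\<forall>h. tsum H H (comult H h) (\<lambda>h\<^sub>1 h\<^sub>2. scale H (counit H h\<^sub>1) h\<^sub>2) = h) \<and>
     (\<forall>h. tsum H H (comult H h) (\<lambda>h\<^sub>1 h\<^sub>2. scale H (counit H h\<^sub>2) h\<^sub>1) = h) \<and>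
     comult H 1 = tens H H 1 1 \<and>
     (\<forall>x y. comult H (x * y) =
        tsum H H (comult H x) (\<lambda>x\<^sub>1 x\<^sub>2. tsum H H (comult H y)
          (\<lambda>y\<^sub>1 y\<^sub>2. tens H H (x\<^sub>1 * y\<^sub>1) (x\<^sub>2 * y\<^sub>2)))) \<and>
     counit H 1 = 1 \<and>
     (\<forall>x y. counit H (x * y) = counit H x * counit H y) \<and>
     (\<forall>h. tsum H H (comult H h) (\<lambda>h\<^sub>1 h\<^sub>2. antipode H h\<^sub>1 * h\<^sub>2) = scale H (counit H h) 1) \<and>
     (\<forall>h. tsum H H (comult H h) (\<lambda>h\<^sub>1 h\<^sub>2. h\<^sub>1 * antipode H h\<^sub>2) = scale H (counit H h) 1)"

definition dual :: "('k::field, 'h::ring_1) hopf \<Rightarrow> ('h \<Rightarrow> 'k) set" where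
  "dual H = {f. Vector_Spaces.linear (scale H) (*) f}"

definition convolution :: "('k::field, 'h::ring_1) hopf \<Rightarrow> ('h \<Rightarrow> 'k) \<Rightarrow> ('h \<Rightarrow> 'k) \<Rightarrow> 'h \<Rightarrow> 'k"
  where "convolution H f g h = tsum H H (comult H h) (\<lambda>h\<^sub>1 h\<^sub>2. f h\<^sub>1 * g h\<^sub>2)"

definition left_dual_module :: "('k::field, 'h::ring_1) hopf
    \<Rightarrow> ('k, 'v::ab_group_add, 'x) vspace_scheme \<Rightarrow> (('h \<Rightarrow> 'k) \<Rightarrow> 'v \<Rightarrow> 'v) \<Rightarrow> bool" where
  "left_dual_module H V act \<longleftrightarrow>
     vspace V \<and>
     (\<forall>f\<in>dual H. lin V V (act f)) \<and>
     (\<forall>f\<in>dual H. \<forall>g\<in>dual H. \<forall>v\<in>carrier V. act (f + g) v = act f v + act g v) \<and>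
     (\<forall>c. \<forall>f\<in>dual H. \<forall>v\<in>carrier V. act (\<lambda>h. c * f h) v = scale V c (act f v)) \<and>
     (\<forall>f\<in>dual H. \<forall>g\<in>dual H. \<forall>v\<in>carrier V. act (convolution H f g) v = act f (act g v)) \<and>
     (\<forall>v\<in>carrier V. act (counit H) v = v)"

definition rational :: "('k::field, 'h::ring_1) hopf
    \<Rightarrow> ('k, 'v::ab_group_add, 'x) vspace_scheme \<Rightarrow> (('h \<Rightarrow> 'k) \<Rightarrow> 'v \<Rightarrow> 'v) \<Rightarrow> bool" where
  "rational H V act \<longleftrightarrow>
     left_dual_module H V act \<and>
     (\<forall>m\<in>carrier V. \<exists>t\<in>carrier (tprod V H). \<forall>f\<in>dual H.
        act f m = tsum V H t (\<lambda>v h. scale V (f h) v))"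

record ('k, 'h, 'v) comod = "('k, 'v) vspace" +
  coact :: "'v \<Rightarrow> ('k, 'v, 'h) tensor"

definition comodule :: "('k::field, 'h::ring_1) hopf \<Rightarrow> ('k, 'h, 'v::ab_group_add) comod \<Rightarrow> bool"
  where
  "comodule H M \<longleftrightarrow>
     vspace M \<and> lin M (tprod M H) (coact M) \<and>
     (\<forall>m\<in>carrier M.
        tsum M H (coact M m) (\<lambda>m\<^sub>0 m\<^sub>1. tens (tprod M H) H (coact M m\<^sub>0) m\<^sub>1) =
        tsum M H (coact M m) (\<lambda>m\<^sub>0 h. tsum H H (comult H h)
          (\<lambda>m\<^sub>1 m\<^sub>2. tens (tprod M H) H (tens M H m\<^sub>0 m\<^sub>1) m\<^sub>2))) \<and>
     (\<forall>m\<in>carrier M. tsum M H (coact M m) (\<lambda>m\<^sub>0 m\<^sub>1. scale M (counit H m\<^sub>1) m\<^sub>0) = m)"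

text \<open>Morphisms are total functions, normalised to vanish off the carrier of their domain.\<close>

definition comod_hom :: "('k::field, 'h::ring_1) hopf \<Rightarrow> ('k, 'h, 'v::ab_group_add) comod
    \<Rightarrow> ('k, 'h, 'w::ab_group_add) comod \<Rightarrow> ('v \<Rightarrow> 'w) set" where
  "comod_hom H M N = {f. lin M N f \<and> (\<forall>m. m \<notin> carrier M \<longrightarrow> f m = 0) \<and>
     (\<forall>m\<in>carrier M. coact N (f m) = tsum M H (coact M m) (\<lambda>m\<^sub>0 m\<^sub>1. tens N H (f m\<^sub>0) m\<^sub>1))}"

definition comod_iso :: "('k::field, 'h::ring_1) hopf \<Rightarrow> ('k, 'h, 'v::ab_group_add) comod
    \<Rightarrow> ('k, 'h, 'w::ab_group_add) comod \<Rightarrow> ('v \<Rightarrow> 'w) set" where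
  "comod_iso H M N = {f \<in> comod_hom H M N. \<exists>g\<in>comod_hom H N M.
     (\<forall>m\<in>carrier M. g (f m) = m) \<and> (\<forall>n\<in>carrier N. f (g n) = n)}"

definition comod_tensor :: "('k::field, 'h::ring_1) hopf \<Rightarrow> ('k, 'h, 'v::ab_group_add) comod
    \<Rightarrow> ('k, 'h, 'w::ab_group_add) comod \<Rightarrow> ('k, 'h, ('k, 'v, 'w) tensor) comod" where
  "comod_tensor H M N =
     \<lparr>carrier = carrier (tprod M N), scale = scale (tprod M N),
      coact = (\<lambda>t. tsum M N t (\<lambda>m n. tsum M H (coact M m) (\<lambda>m\<^sub>0 m\<^sub>1. tsum N H (coact N n)
        (\<lambda>n\<^sub>0 n\<^sub>1. tens (tprod M N) H (tens M N m\<^sub>0 n\<^sub>0) (m\<^sub>1 * n\<^sub>1)))))\<rparr>"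

definition comod_act :: "('k::field, 'h::ring_1) hopf \<Rightarrow> ('k, 'h, 'v::ab_group_add) comod
    \<Rightarrow> ('h \<Rightarrow> 'k) \<Rightarrow> 'v \<Rightarrow> 'v" where
  "comod_act H M f m = tsum M H (coact M m) (\<lambda>m\<^sub>0 m\<^sub>1. scale M (f m\<^sub>1) m\<^sub>0)"

text \<open>
  The comodule corresponding to a rational \<open>H\<^sup>*\<close>-module \<open>V\<close>; \<open>V \<otimes> H\<close> maps injectively to
  \<open>Hom(H\<^sup>*, V)\<close>, so the definite description is justified.
\<close>

definition rational_comod :: "('k::field, 'h::ring_1) hopf
    \<Rightarrow> ('k, 'v::ab_group_add) vspace \<Rightarrow> (('h \<Rightarrow> 'k) \<Rightarrow> 'v \<Rightarrow> 'v) \<Rightarrow> ('k, 'h, 'v) comod" where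
  "rational_comod H V act =
     \<lparr>carrier = carrier V, scale = scale V,
      coact = (\<lambda>m. THE t. t \<in> carrier (tprod V H) \<and>
        (\<forall>f\<in>dual H. act f m = tsum V H t (\<lambda>v h. scale V (f h) v)))\<rparr>"


section \<open>Co-\<open>H\<close>-categories and relative Hopf modules\<close>

text \<open>\<open>compos D X Y Z f g\<close> is the composite \<open>f g : X \<rightarrow> Z\<close> of \<open>g : X \<rightarrow> Y\<close> and \<open>f : Y \<rightarrow> Z\<close>.\<close>

record ('k, 'h, 'o, 'a) cocat =
  objs :: "'o set"
  homs :: "'o \<Rightarrow> 'o \<Rightarrow> ('k, 'h, 'a) comod"
  ident :: "'o \<Rightarrow> 'a"
  compos :: "'o \<Rightarrow> 'o \<Rightarrow> 'o \<Rightarrow> 'a \<Rightarrow> 'a \<Rightarrow> 'a"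

definition co_H_category :: "('k::field, 'h::ring_1) hopf
    \<Rightarrow> ('k, 'h, 'o, 'a::ab_group_add) cocat \<Rightarrow> bool" where
  "co_H_category H D \<longleftrightarrow>
     (\<forall>X\<in>objs D. \<forall>Y\<in>objs D. comodule H (homs D X Y)) \<and>
     (\<forall>X\<in>objs D. \<forall>Y\<in>objs D. \<forall>Z\<in>objs D.
        bilin (homs D Y Z) (homs D X Y) (homs D X Z) (compos D X Y Z)) \<and>
     (\<forall>X\<in>objs D. ident D X \<in> carrier (homs D X X)) \<and>
     (\<forall>X\<in>objs D. \<forall>Y\<in>objs D. \<forall>f\<in>carrier (homs D X Y).
        compos D X X Y f (ident D X) = f \<and> compos D X Y Y (ident D Y) f = f) \<and>
     (\<forall>W\<in>objs D. \<forall>X\<in>objs D. \<forall>Y\<in>objs D. \<forall>Z\<in>objs D. \<forall>f\<in>carrier (homs D Y Z).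
        \<forall>g\<in>carrier (homs D X Y). \<forall>e\<in>carrier (homs D W X).
        compos D W X Z (compos D X Y Z f g) e = compos D W Y Z f (compos D W X Y g e)) \<and>
     (\<forall>X\<in>objs D. coact (homs D X X) (ident D X) = tens (homs D X X) H (ident D X) 1) \<and>
     (\<forall>X\<in>objs D. \<forall>Y\<in>objs D. \<forall>Z\<in>objs D.
        \<forall>f\<in>carrier (homs D Y Z). \<forall>g\<in>carrier (homs D X Y).
        coact (homs D X Z) (compos D X Y Z f g) =
          tsum (homs D Y Z) H (coact (homs D Y Z) f) (\<lambda>f\<^sub>0 f\<^sub>1.
          tsum (homs D X Y) H (coact (homs D X Y) g) (\<lambda>g\<^sub>0 g\<^sub>1.
            tens (homs D X Z) H (compos D X Y Z f\<^sub>0 g\<^sub>0) (f\<^sub>1 * g\<^sub>1))))"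

text \<open>\<open>mact M X Y f\<close> is the map \<open>M(f) : M(X) \<rightarrow> M(Y)\<close>.\<close>

record ('k, 'o, 'a, 'm) dmod =
  mcarrier :: "'o \<Rightarrow> 'm set"
  mscale :: "'k \<Rightarrow> 'm \<Rightarrow> 'm"
  mact :: "'o \<Rightarrow> 'o \<Rightarrow> 'a \<Rightarrow> 'm \<Rightarrow> 'm"

definition dspace :: "('k, 'o, 'a, 'm, 'x) dmod_scheme \<Rightarrow> 'o \<Rightarrow> ('k, 'm) vspace" where
  "dspace M X = \<lparr>carrier = mcarrier M X, scale = mscale M\<rparr>"

definition dmodule :: "('k::field, 'h::ring_1, 'o, 'a::ab_group_add) cocat
    \<Rightarrow> ('k, 'o, 'a, 'm::ab_group_add, 'x) dmod_scheme \<Rightarrow> bool" where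
  "dmodule D M \<longleftrightarrow>
     vector_space (mscale M) \<and>
     (\<forall>X\<in>objs D. vspace (dspace M X)) \<and>
     (\<forall>X\<in>objs D. \<forall>Y\<in>objs D. bilin (homs D X Y) (dspace M X) (dspace M Y) (mact M X Y)) \<and>
     (\<forall>X\<in>objs D. \<forall>m\<in>mcarrier M X. mact M X X (ident D X) m = m) \<and>
     (\<forall>X\<in>objs D. \<forall>Y\<in>objs D. \<forall>Z\<in>objs D. \<forall>f\<in>carrier (homs D Y Z).
        \<forall>g\<in>carrier (homs D X Y). \<forall>m\<in>mcarrier M X.
        mact M X Z (compos D X Y Z f g) m = mact M Y Z f (mact M X Y g m))"

definition finitely_generated :: "('k::field, 'h::ring_1, 'o, 'a::ab_group_add) cocat
    \<Rightarrow> ('k, 'o, 'a, 'm::ab_group_add, 'x) dmod_scheme \<Rightarrow> bool" where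
  "finitely_generated D M \<longleftrightarrow>
     (\<exists>(n::nat) X m. (\<forall>i<n. X i \<in> objs D \<and> m i \<in> mcarrier M (X i)) \<and>
        (\<forall>Y\<in>objs D. \<forall>y\<in>mcarrier M Y. \<exists>f. (\<forall>i<n. f i \<in> carrier (homs D (X i) Y)) \<and>
           y = (\<Sum>i<n. mact M (X i) Y (f i) (m i))))"

definition dmod_hom :: "('k::field, 'h::ring_1, 'o, 'a::ab_group_add) cocat
    \<Rightarrow> ('k, 'o, 'a, 'm::ab_group_add, 'x) dmod_scheme
    \<Rightarrow> ('k, 'o, 'a, 'n::ab_group_add, 'y) dmod_scheme \<Rightarrow> ('o \<Rightarrow> 'm \<Rightarrow> 'n) set" where
  "dmod_hom D M N = {\<eta>.
     (\<forall>X\<in>objs D. lin (dspace M X) (dspace N X) (\<eta> X)) \<and>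
     (\<forall>X\<in>objs D. \<forall>Y\<in>objs D. \<forall>f\<in>carrier (homs D X Y). \<forall>m\<in>mcarrier M X.
        \<eta> Y (mact M X Y f m) = mact N X Y f (\<eta> X m)) \<and>
     (\<forall>X m. \<not> (X \<in> objs D \<and> m \<in> mcarrier M X) \<longrightarrow> \<eta> X m = 0)}"

definition homspace :: "('k::field, 'h::ring_1, 'o, 'a::ab_group_add) cocat
    \<Rightarrow> ('k, 'o, 'a, 'm::ab_group_add, 'x) dmod_scheme
    \<Rightarrow> ('k, 'o, 'a, 'n::ab_group_add, 'y) dmod_scheme \<Rightarrow> ('k, 'o \<Rightarrow> 'm \<Rightarrow> 'n) vspace" where
  "homspace D M N =
     \<lparr>carrier = dmod_hom D M N, scale = (\<lambda>c \<eta> X m. mscale N c (\<eta> X m))\<rparr>"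

record ('k, 'h, 'o, 'a, 'm) hopfmod = "('k, 'o, 'a, 'm) dmod" +
  mcoact :: "'o \<Rightarrow> 'm \<Rightarrow> ('k, 'm, 'h) tensor"

definition hcomod :: "('k, 'h, 'o, 'a, 'm) hopfmod \<Rightarrow> 'o \<Rightarrow> ('k, 'h, 'm) comod" where
  "hcomod M X = \<lparr>carrier = mcarrier M X, scale = mscale M, coact = mcoact M X\<rparr>"

definition hopf_module :: "('k::field, 'h::ring_1) hopf
    \<Rightarrow> ('k, 'h, 'o, 'a::ab_group_add) cocat
    \<Rightarrow> ('k, 'h, 'o, 'a, 'm::ab_group_add) hopfmod \<Rightarrow> bool" where
  "hopf_module H D M \<longleftrightarrow>
     dmodule D M \<and>
     (\<forall>X\<in>objs D. comodule H (hcomod M X)) \<and>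
     (\<forall>X\<in>objs D. \<forall>Y\<in>objs D. \<forall>f\<in>carrier (homs D X Y). \<forall>m\<in>mcarrier M X.
        mcoact M Y (mact M X Y f m) =
          tsum (homs D X Y) H (coact (homs D X Y) f) (\<lambda>f\<^sub>0 f\<^sub>1.
          tsum (hcomod M X) H (mcoact M X m) (\<lambda>m\<^sub>0 m\<^sub>1.
            tens (hcomod M Y) H (mact M X Y f\<^sub>0 m\<^sub>0) (f\<^sub>1 * m\<^sub>1))))"

definition hopf_hom :: "('k::field, 'h::ring_1) hopf \<Rightarrow> ('k, 'h, 'o, 'a::ab_group_add) cocat
    \<Rightarrow> ('k, 'h, 'o, 'a, 'm::ab_group_add) hopfmod
    \<Rightarrow> ('k, 'h, 'o, 'a, 'n::ab_group_add) hopfmod \<Rightarrow> ('o \<Rightarrow> 'm \<Rightarrow> 'n) set" where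
  "hopf_hom H D M N =
     {\<eta> \<in> dmod_hom D M N. \<forall>X\<in>objs D. \<eta> X \<in> comod_hom H (hcomod M X) (hcomod N X)}"

definition hom_act :: "('k::field, 'h::ring_1) hopf \<Rightarrow> ('k, 'h, 'o, 'a::ab_group_add) cocat
    \<Rightarrow> ('k, 'h, 'o, 'a, 'm::ab_group_add) hopfmod
    \<Rightarrow> ('k, 'h, 'o, 'a, 'n::ab_group_add) hopfmod
    \<Rightarrow> ('h \<Rightarrow> 'k) \<Rightarrow> ('o \<Rightarrow> 'm \<Rightarrow> 'n) \<Rightarrow> 'o \<Rightarrow> 'm \<Rightarrow> 'n" where
  "hom_act H D M N f \<eta> = (\<lambda>X m. if X \<in> objs D \<and> m \<in> mcarrier M X then
       tsum (hcomod M X) H (mcoact M X m) (\<lambda>m\<^sub>0 m\<^sub>1.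
       tsum (hcomod N X) H (mcoact N X (\<eta> X m\<^sub>0)) (\<lambda>n\<^sub>0 n\<^sub>1.
         mscale N (f (inv (antipode H) m\<^sub>1 * n\<^sub>1)) n\<^sub>0))
     else 0)"

text \<open>The comodule \<open>Hom(M, N)\<close>, meaningful when the \<open>H\<^sup>*\<close>-module \<open>Hom(M, N)\<close> is rational.\<close>

definition hom_comod :: "('k::field, 'h::ring_1) hopf \<Rightarrow> ('k, 'h, 'o, 'a::ab_group_add) cocat
    \<Rightarrow> ('k, 'h, 'o, 'a, 'm::ab_group_add) hopfmod
    \<Rightarrow> ('k, 'h, 'o, 'a, 'n::ab_group_add) hopfmod \<Rightarrow> ('k, 'h, 'o \<Rightarrow> 'm \<Rightarrow> 'n) comod" where
  "hom_comod H D M N = rational_comod H (homspace D M N) (hom_act H D M N)"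


section \<open>The functor \<open>M \<otimes> (-)\<close> and its right adjoint\<close>

definition hopf_tensor :: "('k::field, 'h::ring_1) hopf
    \<Rightarrow> ('k, 'h, 'o, 'a::ab_group_add, 'm::ab_group_add) hopfmod
    \<Rightarrow> ('k, 'h, 'q::ab_group_add) comod \<Rightarrow> ('k, 'h, 'o, 'a, ('k, 'm, 'q) tensor) hopfmod" where
  "hopf_tensor H M Q =
     \<lparr>mcarrier = (\<lambda>X. carrier (tprod (hcomod M X) Q)),
      mscale = tscale,
      mact = (\<lambda>X Y f t. tsum (hcomod M X) Q t
        (\<lambda>m q. tens (hcomod M Y) Q (mact M X Y f m) q)),
      mcoact = (\<lambda>X. coact (comod_tensor H (hcomod M X) Q))\<rparr>"

definition hopf_tensor_map :: "('k::field, 'h::ring_1, 'o, 'a::ab_group_add) cocat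
    \<Rightarrow> ('k, 'h, 'o, 'a, 'm::ab_group_add) hopfmod
    \<Rightarrow> ('k, 'h, 'q::ab_group_add) comod \<Rightarrow> ('k, 'h, 'r::ab_group_add) comod \<Rightarrow> ('q \<Rightarrow> 'r)
    \<Rightarrow> 'o \<Rightarrow> ('k, 'm, 'q) tensor \<Rightarrow> ('k, 'm, 'r) tensor" where
  "hopf_tensor_map D M Q R \<psi> = (\<lambda>X t.
     if X \<in> objs D \<and> t \<in> carrier (tprod (hcomod M X) Q)
     then tsum (hcomod M X) Q t (\<lambda>m q. tens (hcomod M X) R m (\<psi> q)) else 0)"

text \<open>
  \<open>R\<close> with \<open>\<epsilon> : M \<otimes> R \<rightarrow> P\<close> is a universal arrow from the functor \<open>M \<otimes> (-)\<close> to \<open>P\<close>.  As HOL cannot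
  quantify over types inside a formula, the type \<open>'q\<close> of the test comodules \<open>Q\<close> is a parameter.
  (Composites of normalised morphisms are again normalised, as morphisms map \<open>0\<close> to \<open>0\<close>.)
\<close>

definition universal_arrow :: "'q::ab_group_add itself \<Rightarrow> ('k::field, 'h::ring_1) hopf
    \<Rightarrow> ('k, 'h, 'o, 'a::ab_group_add) cocat
    \<Rightarrow> ('k, 'h, 'o, 'a, 'm::ab_group_add) hopfmod
    \<Rightarrow> ('k, 'h, 'o, 'a, 'p::ab_group_add) hopfmod
    \<Rightarrow> ('k, 'h, 'r::ab_group_add) comod \<Rightarrow> ('o \<Rightarrow> ('k, 'm, 'r) tensor \<Rightarrow> 'p) \<Rightarrow> bool" where
  "universal_arrow (T :: 'q itself) H D M P R \<epsilon> \<longleftrightarrow>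
     comodule H R \<and> \<epsilon> \<in> hopf_hom H D (hopf_tensor H M R) P \<and>
     (\<forall>Q :: ('k, 'h, 'q) comod. comodule H Q \<longrightarrow>
        bij_betw (\<lambda>\<psi> X. \<epsilon> X \<circ> hopf_tensor_map D M Q R \<psi> X)
          (comod_hom H Q R) (hopf_hom H D (hopf_tensor H M Q) P))"

text \<open>
  A right adjoint of \<open>M \<otimes> (-)\<close>, with object part \<open>R\<close>, morphism part \<open>Rm\<close> and counit \<open>\<epsilon>\<close>: the maps
  \<open>\<psi> \<mapsto> \<epsilon>\<^sub>P \<circ> (M \<otimes> \<psi>)\<close> are the adjunction bijections \<open>Hom(Q, R P) \<cong> Hom(M \<otimes> Q, P)\<close>.
\<close>

definition right_adjoint :: "'q::ab_group_add itself \<Rightarrow> ('k::field, 'h::ring_1) hopf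
    \<Rightarrow> ('k, 'h, 'o, 'a::ab_group_add) cocat
    \<Rightarrow> ('k, 'h, 'o, 'a, 'm::ab_group_add) hopfmod
    \<Rightarrow> (('k, 'h, 'o, 'a, 'p::ab_group_add) hopfmod \<Rightarrow> ('k, 'h, 'r::ab_group_add) comod)
    \<Rightarrow> (('k, 'h, 'o, 'a, 'p) hopfmod \<Rightarrow> ('k, 'h, 'o, 'a, 'p) hopfmod
          \<Rightarrow> ('o \<Rightarrow> 'p \<Rightarrow> 'p) \<Rightarrow> 'r \<Rightarrow> 'r)
    \<Rightarrow> (('k, 'h, 'o, 'a, 'p) hopfmod \<Rightarrow> 'o \<Rightarrow> ('k, 'm, 'r) tensor \<Rightarrow> 'p) \<Rightarrow> bool" where
  "right_adjoint T H D M R Rm \<epsilon> \<longleftrightarrow>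
     (\<forall>P. hopf_module H D P \<longrightarrow> comodule H (R P)) \<and>
     (\<forall>P P'. \<forall>\<eta>\<in>hopf_hom H D P P'. hopf_module H D P \<and> hopf_module H D P' \<longrightarrow>
        Rm P P' \<eta> \<in> comod_hom H (R P) (R P')) \<and>
     (\<forall>P. \<forall>\<iota>\<in>hopf_hom H D P P. hopf_module H D P \<and> (\<forall>X\<in>objs D. \<forall>p\<in>mcarrier P X. \<iota> X p = p) \<longrightarrow>
        (\<forall>r\<in>carrier (R P). Rm P P \<iota> r = r)) \<and>
     (\<forall>P P' P''. \<forall>\<eta>\<in>hopf_hom H D P P'. \<forall>\<eta>'\<in>hopf_hom H D P' P''.
        hopf_module H D P \<and> hopf_module H D P' \<and> hopf_module H D P'' \<longrightarrow>
        Rm P P'' (\<lambda>X. \<eta>' X \<circ> \<eta> X) = Rm P' P'' \<eta>' \<circ> Rm P P' \<eta>) \<and>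
     (\<forall>P P'. \<forall>\<eta>\<in>hopf_hom H D P P'. hopf_module H D P \<and> hopf_module H D P' \<longrightarrow>
        (\<lambda>X. \<epsilon> P' X \<circ> hopf_tensor_map D M (R P) (R P') (Rm P P' \<eta>) X) = (\<lambda>X. \<eta> X \<circ> \<epsilon> P X)) \<and>
     (\<forall>P. hopf_module H D P \<longrightarrow> universal_arrow T H D M P (R P) (\<epsilon> P))"

text \<open>The evaluation \<open>M \<otimes> Hom(M, N) \<rightarrow> N\<close>, \<open>m \<otimes> \<eta> \<mapsto> \<eta>(m)\<close>.\<close>

definition hom_eval :: "('k::field, 'h::ring_1, 'o, 'a::ab_group_add) cocat
    \<Rightarrow> ('k, 'h, 'o, 'a, 'm::ab_group_add) hopfmod
    \<Rightarrow> ('k, 'h, 'o, 'a, 'n::ab_group_add) hopfmod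
    \<Rightarrow> 'o \<Rightarrow> ('k, 'm, 'o \<Rightarrow> 'm \<Rightarrow> 'n) tensor \<Rightarrow> 'n" where
  "hom_eval D M N = (\<lambda>X t.
     if X \<in> objs D \<and> t \<in> carrier (tprod (hcomod M X) (homspace D M N))
     then tsum (hcomod M X) (homspace D M N) t (\<lambda>m \<eta>. \<eta> X m) else 0)"

end

theory Submission
  imports Defs
begin

text \<open>
  The antipode identities \<open>\<Sum> S\<inverse>(h\<^sub>2) h\<^sub>1 = \<epsilon>(h) 1\<close>, \<open>S\<inverse>(xy) = S\<inverse>(y) S\<inverse>(x)\<close> and
  \<open>\<Delta>(S\<inverse>(h)) = \<Sum> S\<inverse>(h\<^sub>2) \<otimes> S\<inverse>(h\<^sub>1)\<close> show that the \<open>H\<^sup>*\<close>-action on linear maps between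
  comodules preserves \<open>D\<close>-linearity and is a module structure.  For \<open>\<eta> : M \<rightarrow> N\<close> and generators
  \<open>m\<^sub>i\<close>, the elements \<open>(f\<eta>)(m\<^sub>i)\<close> depend only on the values of \<open>f\<close> on a finite set \<open>G \<subseteq> H\<close>.
  Since \<open>f\<eta>\<close> is determined by its values at the generators, a dual basis for the span of \<open>G\<close> yields
  a finite expansion of \<open>f\<eta>\<close>, so \<open>Hom(M, N)\<close> is rational.  Evaluation \<open>M \<otimes> Hom(M, N) \<rightarrow> N\<close> is
  then colinear because \<open>\<Sum> h\<^sub>2 S\<inverse>(h\<^sub>1) = \<epsilon>(h) 1\<close>, and it is universal by currying.
\<close>

section \<open>Multilinear calculus of Sweedler sums\<close>

text \<open>The coaction of \<open>Hom(M, N)\<close> is never given by a formula: it is the unique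
  tensor reproducing the action of the dual. Identities involving it are therefore proved by
  contracting both sides with an arbitrary functional on \<open>H\<close>
  (\<open>tprod_eqI\<close>), which turns them into statements about the action. For a fixed
  \<open>m\<close>, the element \<open>(f\<eta>)(m)\<close> is always the contraction with
  \<open>f\<close> of one tensor in \<open>N(X) \<otimes> H\<close>. The difficulty is to find a
  tensor in \<open>Hom(M, N) \<otimes> H\<close> that works for all \<open>m\<close> at once. The
  inverse antipode is forced by the order of the factors: in \<open>S\<inverse>(m_1) n_1\<close> an
  arrow \<open>a\<close> contributes the adjacent factors \<open>S\<inverse>(a_2) a_1\<close>, and
  these must cancel. A second obstacle is that a Sweedler sum \<open>tsum\<close> is a definite
  description, computable here only for integrands that are bilinear on the carriers. Closure rules
  for \<open>lin\<close> and \<open>bilin\<close> let the simplifier discharge these conditions; the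
  target space \<open>U\<close> of a sum occurs only in premises, so it is often instantiated
  explicitly.\<close>

definition base :: "('k::field, 'k) vspace" where
  "base = \<lparr>carrier = UNIV, scale = (*)\<rparr>"

lemma base_simps [simp]: "carrier base = UNIV" "scale base = (*)"
  by (simp_all add: base_def)

lemma vspace_base [simp]: "vspace (base :: ('k::field, 'k) vspace)"
proof -
  interpret K: vector_space "(*) :: 'k \<Rightarrow> 'k \<Rightarrow> 'k" by unfold_locales (auto simp: algebra_simps)
  show ?thesis by (simp add: vspace_def K.vector_space_axioms)
qed

lemma vspaceD:
  assumes "vspace V"
  shows "vector_space (scale V)" "module.subspace (scale V) (carrier V)"
    "0 \<in> carrier V" "x \<in> carrier V \<Longrightarrow> y \<in> carrier V \<Longrightarrow> x + y \<in> carrier V"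
    "x \<in> carrier V \<Longrightarrow> scale V c x \<in> carrier V"
    "scale V c (u + v) = scale V c u + scale V c v" "scale V (c + d) u = scale V c u + scale V d u"
    "scale V c (scale V d u) = scale V (c * d) u" "scale V 1 u = u" "scale V c 0 = 0" "scale V 0 u = 0"
proof -
  interpret V: vector_space "scale V" using assms by (simp add: vspace_def)
  show sub: "V.subspace (carrier V)" using assms by (simp add: vspace_def)
  show "vector_space (scale V)" by (rule V.vector_space_axioms)
  show "0 \<in> carrier V" "x \<in> carrier V \<Longrightarrow> y \<in> carrier V \<Longrightarrow> x + y \<in> carrier V"
    "x \<in> carrier V \<Longrightarrow> scale V c x \<in> carrier V"
    using V.subspace_0[OF sub] V.subspace_add[OF sub] V.subspace_scale[OF sub] by auto
  show "scale V c (u + v) = scale V c u + scale V c v" "scale V (c + d) u = scale V c u + scale V d u"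
    "scale V c (scale V d u) = scale V (c * d) u" "scale V 1 u = u" "scale V c 0 = 0" "scale V 0 u = 0"
    by (simp_all add: V.scale_right_distrib V.scale_left_distrib)
qed

lemma scale_mem [simp]: "vspace V \<Longrightarrow> x \<in> carrier V \<Longrightarrow> scale V c x \<in> carrier V"
  by (rule vspaceD)

lemma scale_tprod [simp]: "scale (tprod V W) = tscale"
  by (simp add: tprod_def)

declare vspace_tprod [simp] tens_in_tprod [simp]

lemma sum_list_mem:
  "vspace U \<Longrightarrow> (\<And>x. x \<in> set xs \<Longrightarrow> g x \<in> carrier U) \<Longrightarrow> (\<Sum>x\<leftarrow>xs. g x) \<in> carrier U"
  by (induction xs) (auto intro: vspaceD)

lemma linD:
  assumes "lin V W f"
  shows "x \<in> carrier V \<Longrightarrow> f x \<in> carrier W"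
    "x \<in> carrier V \<Longrightarrow> y \<in> carrier V \<Longrightarrow> f (x + y) = f x + f y"
    "x \<in> carrier V \<Longrightarrow> f (scale V c x) = scale W c (f x)"
  using assms by (auto simp: lin_def)

lemma lin_0:
  assumes "vspace V" "lin V W f" shows "f 0 = 0"
  using linD(2)[OF assms(2) vspaceD(3)[OF assms(1)] vspaceD(3)[OF assms(1)]] by simp

lemma lin_sum_list:
  assumes "vspace V" "lin V W f" "\<And>x. x \<in> set xs \<Longrightarrow> g x \<in> carrier V"
  shows "f (\<Sum>x\<leftarrow>xs. g x) = (\<Sum>x\<leftarrow>xs. f (g x))"
  using assms(3)
proof (induction xs)
  case Nil
  then show ?case using lin_0[OF assms(1,2)] by simp
next
  case (Cons a xs)
  then show ?case
    using linD(2)[OF assms(2), of "g a" "\<Sum>x\<leftarrow>xs. g x"] sum_list_mem[OF assms(1), of xs g] by simp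
qed

lemma lin_id [simp]: "lin V V (\<lambda>x. x)"
  by (simp add: lin_def)

lemma lin_comp: "lin V W f \<Longrightarrow> lin X V g \<Longrightarrow> lin X W (\<lambda>x. f (g x))"
  by (auto simp: lin_def)

text \<open>As a simplification rule this splits a bilinearity condition into linearity in each
  argument, with the other argument known to lie in its carrier; the \<open>lin\<close> rules then
  recurse through the integrand.\<close>

lemma bilinI [simp]:
  "(\<And>x. x \<in> carrier V \<Longrightarrow> lin W U (\<lambda>y. B x y)) \<Longrightarrow> (\<And>y. y \<in> carrier W \<Longrightarrow> lin V U (\<lambda>x. B x y)) \<Longrightarrow>
    bilin V W U B"
  by (simp add: bilin_def)

lemma bilin_lin1: "bilin V W U B \<Longrightarrow> lin X V g \<Longrightarrow> w \<in> carrier W \<Longrightarrow> lin X U (\<lambda>x. B (g x) w)"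
  and bilin_lin2: "bilin V W U B \<Longrightarrow> lin X W h \<Longrightarrow> v \<in> carrier V \<Longrightarrow> lin X U (\<lambda>x. B v (h x))"
  and bilin_mem: "bilin V W U B \<Longrightarrow> v \<in> carrier V \<Longrightarrow> w \<in> carrier W \<Longrightarrow> B v w \<in> carrier U"
  by (auto simp: bilin_def lin_def)

lemma lin_tens [simp]:
  "lin X V g \<Longrightarrow> w \<in> carrier W \<Longrightarrow> lin X (tprod V W) (\<lambda>x. tens V W (g x) w)"
  "lin X W h \<Longrightarrow> v \<in> carrier V \<Longrightarrow> lin X (tprod V W) (\<lambda>x. tens V W v (h x))"
  by (simp_all add: lin_def tens_bilinear)

lemma lin_scale [simp]:
  "vspace U \<Longrightarrow> lin X base f \<Longrightarrow> u \<in> carrier U \<Longrightarrow> lin X U (\<lambda>x. scale U (f x) u)"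
  "vspace U \<Longrightarrow> lin X U g \<Longrightarrow> lin X U (\<lambda>x. scale U c (g x))"
  by (simp_all add: lin_def vspaceD mult.commute)

lemmas lin_tscale [simp] = lin_scale[OF vspace_tprod, unfolded scale_tprod]
  and tscale_mem [simp] = scale_mem[OF vspace_tprod, unfolded scale_tprod]

lemma lin_base_mult [simp]:
  "lin X base f \<Longrightarrow> lin X base (\<lambda>x. f x * c)"
  "lin X base f \<Longrightarrow> lin X base (\<lambda>x. c * f x)"
  by (simp_all add: lin_def algebra_simps)

text \<open>The description behind \<open>tsum\<close> only looks at representations with entries in
  the carriers. As a congruence rule this supplies carrier membership of the Sweedler components
  when the simplifier works inside a sum.\<close>

lemma tsum_cong [cong]:
  assumes "t = t'" "\<And>v w. v \<in> carrier V \<Longrightarrow> w \<in> carrier W \<Longrightarrow> B v w = B' v w"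
  shows "tsum V W t B = tsum V W t' B'"
proof -
  have "(\<Sum>(v, w)\<leftarrow>xs. B v w) = (\<Sum>(v, w)\<leftarrow>xs. B' v w)" if "set xs \<subseteq> carrier V \<times> carrier W" for xs
    using that assms(2) by (induction xs) auto
  with assms(1) show ?thesis unfolding tsum_def by (metis (no_types, lifting))
qed

lemma tsum_tens:
  "vspace V \<Longrightarrow> vspace W \<Longrightarrow> vspace U \<Longrightarrow> bilin V W U B \<Longrightarrow> v \<in> carrier V \<Longrightarrow> w \<in> carrier W \<Longrightarrow>
    tsum V W (tens V W v w) B = B v w"
  by (rule tsum_bilin(2))

lemma tsum_mem [simp]:
  "vspace V \<Longrightarrow> vspace W \<Longrightarrow> vspace U \<Longrightarrow> bilin V W U B \<Longrightarrow> t \<in> carrier (tprod V W) \<Longrightarrow>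
    tsum V W t B \<in> carrier U"
  by (rule linD(1)[OF tsum_bilin(1)])

lemma lin_tsum1 [simp]:
  "vspace V \<Longrightarrow> vspace W \<Longrightarrow> vspace U \<Longrightarrow> bilin V W U B \<Longrightarrow> lin X (tprod V W) t \<Longrightarrow>
    lin X U (\<lambda>x. tsum V W (t x) B)"
  by (rule lin_comp[OF tsum_bilin(1)])

text \<open>Once a representation of \<open>t\<close> is fixed, the sum runs over the same finite
  list for every parameter \<open>x\<close>, so linearity passes through termwise. Together with
  \<open>lin_tsum1\<close> this covers both positions in which a variable can occur in a nested
  Sweedler sum.\<close>

lemma lin_tsum2 [simp]:
  assumes VWU: "vspace V" "vspace W" "vspace U" and X: "vspace X" and t: "t \<in> carrier (tprod V W)"
    and B: "\<And>x. x \<in> carrier X \<Longrightarrow> bilin V W U (B x)"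
    and L: "\<And>v w. v \<in> carrier V \<Longrightarrow> w \<in> carrier W \<Longrightarrow> lin X U (\<lambda>x. B x v w)"
  shows "lin X U (\<lambda>x. tsum V W t (B x))"
proof -
  obtain xs where xs: "set xs \<subseteq> carrier V \<times> carrier W" "t = (\<Sum>(v, w)\<leftarrow>xs. tens V W v w)"
    using tprod_list[OF VWU(1) t] .
  have eq: "tsum V W t (B x) = (\<Sum>(v, w)\<leftarrow>xs. B x v w)" if "x \<in> carrier X" for x
    using tsum_list[OF VWU B[OF that] xs(1)] xs(2) by simp
  have "lin X U (\<lambda>x. \<Sum>(v, w)\<leftarrow>xs. B x v w)" using xs(1)
  proof (induction xs)
    case Nil
    then show ?case using VWU by (simp add: lin_def vspaceD)
  next
    case (Cons a xs)
    then have "lin X U (\<lambda>x. B x (fst a) (snd a))" by (intro L) auto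
    with Cons show ?case using VWU by (auto simp: lin_def vspaceD case_prod_beta)
  qed
  with eq X show ?thesis by (simp add: lin_def vspaceD)
qed

text \<open>A representation of \<open>t\<close> turns both sides into finite sums, where
  \<open>L\<close> is additive. Flattening nested sums, pulling scalars inside and evaluating
  morphisms under a sum are all instances.\<close>

lemma lin_into_tsum:
  assumes "vspace V" "vspace W" "vspace U" "vspace U'" "lin U U' L" "bilin V W U B" "t \<in> carrier (tprod V W)"
  shows "L (tsum V W t B) = tsum V W t (\<lambda>v w. L (B v w))"
proof -
  obtain xs where xs: "set xs \<subseteq> carrier V \<times> carrier W" "t = (\<Sum>(v, w)\<leftarrow>xs. tens V W v w)"
    using tprod_list[OF assms(1,7)] .
  have b: "bilin V W U' (\<lambda>v w. L (B v w))"
    using assms(6) by (auto simp: bilin_def intro!: lin_comp[OF assms(5)])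
  have "L (\<Sum>x\<leftarrow>xs. B (fst x) (snd x)) = (\<Sum>x\<leftarrow>xs. L (B (fst x) (snd x)))"
    by (rule lin_sum_list[OF assms(3,5)]) (use xs(1) bilin_mem[OF assms(6)] in auto)
  then show ?thesis
    using tsum_list[OF assms(1-3,6) xs(1)] tsum_list[OF assms(1,2,4) b xs(1)] xs(2)
    unfolding xs(2) case_prod_beta by simp
qed

lemma tsum_tsum:
  assumes "vspace V" "vspace W" "vspace V'" "vspace W'" "vspace U" "bilin V W (tprod V' W') B"
    "bilin V' W' U C" "t \<in> carrier (tprod V W)"
  shows "tsum V' W' (tsum V W t B) C = tsum V W t (\<lambda>v w. tsum V' W' (B v w) C)"
  by (rule lin_into_tsum[OF assms(1,2) vspace_tprod assms(5) tsum_bilin(1)[OF assms(3,4,5,7)] assms(6,8)])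

text \<open>Fubini for Sweedler sums: representing both tensors by lists reduces the claim to
  exchanging two finite sums. The inner sums are first shown to be bilinear, so that the outer
  \<open>tsum\<close> can be computed.\<close>

lemma tsum_swap:
  assumes vs: "vspace V" "vspace W" "vspace V'" "vspace W'" "vspace U"
    and t: "t \<in> carrier (tprod V W)" and s: "s \<in> carrier (tprod V' W')"
    and B: "\<And>v w. v \<in> carrier V \<Longrightarrow> w \<in> carrier W \<Longrightarrow> bilin V' W' U (B v w)"
    and C: "\<And>v w. v \<in> carrier V' \<Longrightarrow> w \<in> carrier W' \<Longrightarrow> bilin V W U (\<lambda>x y. B x y v w)"
  shows "tsum V W t (\<lambda>v w. tsum V' W' s (B v w)) = tsum V' W' s (\<lambda>x y. tsum V W t (\<lambda>v w. B v w x y))"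
proof -
  obtain xs where xs: "set xs \<subseteq> carrier V \<times> carrier W" "t = (\<Sum>(v, w)\<leftarrow>xs. tens V W v w)"
    using tprod_list[OF vs(1) t] .
  have "bilin V W U (\<lambda>v w. tsum V' W' s (B v w))"
    using vs s B C by (auto intro!: lin_tsum2 simp: bilin_lin1 bilin_lin2 bilin_def)
  from tsum_list[OF vs(1,2,5) this xs(1)]
  have 1: "tsum V W t (\<lambda>v w. tsum V' W' s (B v w)) = (\<Sum>(v, w)\<leftarrow>xs. tsum V' W' s (B v w))"
    by (simp add: xs(2))
  have "tsum V' W' s (\<lambda>x y. tsum V W t (\<lambda>v w. B v w x y)) =
        tsum V' W' s (\<lambda>x y. \<Sum>(v, w)\<leftarrow>xs. B v w x y)"
    by (rule tsum_cong[OF refl]) (use tsum_list[OF vs(1,2,5) C xs(1)] in \<open>simp add: xs(2)\<close>)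
  moreover obtain ys where ys: "set ys \<subseteq> carrier V' \<times> carrier W'" "s = (\<Sum>(v, w)\<leftarrow>ys. tens V' W' v w)"
    using tprod_list[OF vs(3) s] .
  have bs: "bilin V' W' U (\<lambda>x y. \<Sum>(v, w)\<leftarrow>xs. B v w x y)" using xs(1)
  proof (induction xs)
    case Nil
    then show ?case using vs(5) by (simp add: lin_def vspaceD)
  next
    case (Cons a xs)
    then have "bilin V' W' U (B (fst a) (snd a))" by (intro B) auto
    with Cons show ?case using vs(5)
      by (simp add: case_prod_beta bilin_def lin_def vspaceD)
  qed
  ultimately have 2: "tsum V' W' s (\<lambda>x y. tsum V W t (\<lambda>v w. B v w x y)) =
      (\<Sum>(x, y)\<leftarrow>ys. \<Sum>(v, w)\<leftarrow>xs. B v w x y)"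
    using tsum_list[OF vs(3,4,5) bs ys(1)] ys(2) by simp
  have 3: "tsum V' W' s (B v w) = (\<Sum>(x, y)\<leftarrow>ys. B v w x y)" if "(v, w) \<in> set xs" for v w
    using tsum_list[OF vs(3,4,5) B ys(1), of v w] ys(2) that xs(1) by auto
  have "(\<Sum>(v, w)\<leftarrow>xs. tsum V' W' s (B v w)) = (\<Sum>p\<leftarrow>xs. \<Sum>(x, y)\<leftarrow>ys. B (fst p) (snd p) x y)"
    using 3 by (intro arg_cong[of _ _ sum_list] map_cong) auto
  also have "\<dots> = (\<Sum>(x, y)\<leftarrow>ys. \<Sum>(v, w)\<leftarrow>xs. B v w x y)"
    unfolding case_prod_beta by (induction xs) (simp_all add: sum_list_addf)
  finally show ?thesis using 1 2 by simp
qed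

lemma scale_tsum:
  assumes "vspace V" "vspace W" "vspace U" "bilin V W U B" "t \<in> carrier (tprod V W)"
  shows "scale U c (tsum V W t B) = tsum V W t (\<lambda>v w. scale U c (B v w))"
  by (rule lin_into_tsum[OF assms(1-3,3) _ assms(4,5)]) (use assms(3) in simp)

lemma tprod_ext:
  assumes "vspace V" "vspace W" "vspace U" "lin (tprod V W) U L" "lin (tprod V W) U L'"
    "\<And>v w. v \<in> carrier V \<Longrightarrow> w \<in> carrier W \<Longrightarrow> L (tens V W v w) = L' (tens V W v w)"
    "t \<in> carrier (tprod V W)"
  shows "L t = L' t"
proof -
  obtain xs where xs: "set xs \<subseteq> carrier V \<times> carrier W" "t = (\<Sum>(v, w)\<leftarrow>xs. tens V W v w)"
    using tprod_list[OF assms(1,7)] .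
  have m: "tens V W (fst x) (snd x) \<in> carrier (tprod V W)" if "x \<in> set xs" for x
    using that xs(1) by auto
  have "map (\<lambda>x. L (tens V W (fst x) (snd x))) xs = map (\<lambda>x. L' (tens V W (fst x) (snd x))) xs"
    using xs(1) assms(6) by auto
  then show ?thesis
    using lin_sum_list[OF vspace_tprod assms(4) m, of xs "\<lambda>x. x"]
      lin_sum_list[OF vspace_tprod assms(5) m, of xs "\<lambda>x. x"]
    unfolding xs(2) case_prod_beta by metis
qed

lemma tsum_tens_id [simp]:
  assumes "vspace V" "vspace W" "t \<in> carrier (tprod V W)"
  shows "tsum V W t (tens V W) = t"
  by (rule tprod_ext[OF assms(1,2) vspace_tprod[of V W] _ _ _ assms(3)])
    (use assms(1,2) in \<open>simp_all add: tsum_tens[where U="tprod V W"]\<close>)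

text \<open>Functionals on a full space become linear maps into \<open>base\<close>, so the closure
  rules for \<open>lin\<close> cover them as well.\<close>

lemma lin_base_iff:
  "vspace V \<Longrightarrow> carrier V = UNIV \<Longrightarrow> Vector_Spaces.linear (scale V) (*) f \<longleftrightarrow> lin V base f"
  by (auto simp: lin_def linear_iff vspace_def intro: vspaceD(1)[OF vspace_base, simplified])

text \<open>\<open>V \<otimes> W\<close> embeds into \<open>Hom(W\<^sup>*, V)\<close>: expanding second factors in a basis of \<open>W\<close> shows that
  a tensor is determined by its contractions with the coordinate functionals.\<close>

lemma tprod_eqI:
  fixes V :: "('k::field, 'v::ab_group_add, 'x) vspace_scheme"
    and W :: "('k, 'w::ab_group_add, 'y) vspace_scheme"
  assumes V: "vspace V" and W: "vspace W" and t: "t \<in> carrier (tprod V W)" and t': "t' \<in> carrier (tprod V W)"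
    and eq: "\<And>f. Vector_Spaces.linear (scale W) (*) f \<Longrightarrow>
      tsum V W t (\<lambda>v w. scale V (f w) v) = tsum V W t' (\<lambda>v w. scale V (f w) v)"
  shows "t = t'"
proof -
  interpret V: vector_space "scale V" using V by (simp add: vspace_def)
  interpret W: vector_space "scale W" using W by (simp add: vspace_def)
  interpret K: vector_space "(*) :: 'k \<Rightarrow> 'k \<Rightarrow> 'k" by unfold_locales (auto simp: algebra_simps)
  \<comment> \<open>A basis of the whole ambient type rather than of the carrier, because the
    functionals in \<open>eq\<close> have to be linear on all of it.\<close>
  define \<B> where "\<B> = W.extend_basis {}"
  have \<B>: "W.independent \<B>" "W.span \<B> = UNIV"
    unfolding \<B>_def using W.independent_extend_basis W.span_extend_basis by (auto simp: W.dependent_def)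
  define r where "r = W.representation \<B>"
  have rl: "Vector_Spaces.linear (scale W) (*) (\<lambda>w. r w b)" for b
    unfolding linear_iff r_def
    using W.representation_add[OF \<B>(1)] W.representation_scale[OF \<B>(1)] \<B>(2)
    by (auto intro: W.vector_space_axioms K.vector_space_axioms)
  obtain xs where xs: "set xs \<subseteq> carrier V \<times> carrier W" "t = (\<Sum>(v, w)\<leftarrow>xs. tens V W v w)"
    using tprod_list[OF V t] .
  obtain ys where ys: "set ys \<subseteq> carrier V \<times> carrier W" "t' = (\<Sum>(v, w)\<leftarrow>ys. tens V W v w)"
    using tprod_list[OF V t'] .
  \<comment> \<open>All basis vectors occurring in either representation; a common index set makes
    the two expansions comparable coefficient by coefficient.\<close>
  define F where "F = (\<Union>(v, w)\<in>set xs \<union> set ys. {b. r w b \<noteq> 0})"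
  have F: "finite F" unfolding F_def r_def by (auto intro: W.finite_representation)
  have expand: "(\<Sum>(v, w)\<leftarrow>zs. tens V W v w) =
      (\<Sum>b\<in>F. tens V W (\<Sum>(v, w)\<leftarrow>zs. scale V (r w b) v) b)"
    if "set zs \<subseteq> set xs \<union> set ys" for zs
    using that
  proof (induction zs)
    case Nil
    have "tens V W 0 b = 0" for b using tens_bilinear(3)[of V W 0 0 b] by (simp add: tscale_def fun_eq_iff)
    then show ?case by simp
  next
    case (Cons a zs)
    obtain v w where a: "a = (v, w)" by fastforce
    have sF: "{b. r w b \<noteq> 0} \<subseteq> F" using Cons.prems a by (auto simp: F_def)
    have "w = (\<Sum>b | r w b \<noteq> 0. scale W (r w b) b)"
      unfolding r_def using W.sum_nonzero_representation_eq[OF \<B>(1), of w] \<B>(2) by simp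
    also have "\<dots> = (\<Sum>b\<in>F. scale W (r w b) b)"
      by (rule sum.mono_neutral_left) (use F sF in auto)
    finally have w: "w = (\<Sum>b\<in>F. scale W (r w b) b)" .
    have add: "tens V W v (\<Sum>b\<in>G. g b) = (\<Sum>b\<in>G. tens V W v (g b))" if "finite G" for G and g :: "'w \<Rightarrow> 'w"
      using that
    proof induction
      case empty
      show ?case using tens_bilinear(4)[of V W v 0 0] by (simp add: tscale_def fun_eq_iff)
    qed (simp add: tens_bilinear)
    have "tens V W v w = (\<Sum>b\<in>F. tens V W v (scale W (r w b) b))"
      using add[OF F, of "\<lambda>b. scale W (r w b) b"] w by simp
    also have "\<dots> = (\<Sum>b\<in>F. tens V W (scale V (r w b) v) b)" by (simp add: tens_bilinear)
    finally have "tens V W v w = (\<Sum>b\<in>F. tens V W (scale V (r w b) v) b)" .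
    then show ?case
      using Cons by (simp only: a tens_bilinear(1) sum.distrib list.map sum_list.Cons split) auto
  qed
  have ts: "tsum V W (\<Sum>(v, w)\<leftarrow>zs. tens V W v w) (\<lambda>v w. scale V (r w b) v) = (\<Sum>(v, w)\<leftarrow>zs. scale V (r w b) v)"
    if "set zs \<subseteq> carrier V \<times> carrier W" for zs b
  proof (rule tsum_list[OF V W V _ that])
    have "lin W base (\<lambda>w. r w b)" using rl[of b] by (auto simp: lin_def linear_iff)
    then show "bilin V W V (\<lambda>v w. scale V (r w b) v)" using V by simp
  qed
  \<comment> \<open>Contraction with the coordinate functional at \<open>b\<close> reads off the
    coefficient of \<open>b\<close> in both expansions.\<close>
  have "(\<Sum>(v, w)\<leftarrow>xs. scale V (r w b) v) = (\<Sum>(v, w)\<leftarrow>ys. scale V (r w b) v)" for b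
    using eq[OF rl[of b]] ts[OF xs(1)] ts[OF ys(1)] by (simp add: xs(2) ys(2))
  then show ?thesis using expand[of xs] expand[of ys] by (simp add: xs(2) ys(2))
qed

text \<open>The linear notions see only the fields \<open>carrier\<close> and \<open>scale\<close>.
  Objects such as \<open>homspace\<close> and \<open>hom_comod\<close>, or \<open>dspace\<close> and
  \<open>hcomod\<close>, are different records over the same space, and these equations carry facts
  from one to the other.\<close>

lemma vspace_cong:
  assumes "carrier V = carrier V'" "scale V = scale V'"
  shows tens_cong_left: "tens V W = tens V' W" and tprod_cong_left: "tprod V W = tprod V' W"
    and tprod_cong_right: "tprod W V = tprod W V'"
    and tsum_cong_left: "tsum V W = tsum V' W" and tsum_cong_right: "tsum W V = tsum W V'"
    and lin_cong_left: "lin V W = lin V' W" and lin_cong_right: "lin W V = lin W V'"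
    and vspace_cong': "vspace V = vspace V'"
  using assms by (simp_all add: tens_def[abs_def] bilinear_form_def tprod_def tsum_def[abs_def]
      lin_def[abs_def] vspace_def)

section \<open>The antipode and its inverse\<close>

locale bijective_antipode =
  fixes H :: "('k::field, 'h::ring_1) hopf"
  assumes hopf: "hopf_algebra H" and bij: "bij (antipode H)"
begin

abbreviation S :: "'h \<Rightarrow> 'h" where "S \<equiv> antipode H"
abbreviation T :: "'h \<Rightarrow> 'h" where "T \<equiv> inv (antipode H)"
abbreviation \<Delta> :: "'h \<Rightarrow> ('k, 'h, 'h) tensor" where "\<Delta> \<equiv> comult H"
abbreviation \<epsilon> :: "'h \<Rightarrow> 'k" where "\<epsilon> \<equiv> counit H"

lemma vspace_H [simp]: "vspace H" and carrier_H [simp]: "carrier H = UNIV"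
  using hopf by (auto simp: hopf_algebra_def)

lemma dual_lin: "f \<in> dual H \<longleftrightarrow> lin H base f"
  by (simp add: dual_def lin_base_iff)

lemma scale_mult [simp]: "scale H c x * y = scale H c (x * y)" "x * scale H c y = scale H c (x * y)"
  using hopf unfolding hopf_algebra_def by metis+

lemma lin_mult [simp]:
  "lin X H g \<Longrightarrow> lin X H (\<lambda>x. g x * c)" "lin X H g \<Longrightarrow> lin X H (\<lambda>x. c * g x)"
  by (simp_all add: lin_def algebra_simps)

lemma lin_S: "lin H H S" and lin_counit: "lin H base \<epsilon>" and lin_comult: "lin H (tprod H H) \<Delta>"
  using hopf by (auto simp: hopf_algebra_def lin_base_iff) (auto simp: lin_def linear_iff)

lemma S_T [simp]: "S (T x) = x" "T (S x) = x"
  using bij by (auto simp: bij_def surj_f_inv_f)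

lemma S_eq_iff [simp]: "S x = S y \<longleftrightarrow> x = y"
  using bij by (auto simp: bij_def inj_eq)

lemma lin_T: "lin H H T"
proof -
  have "T (x + y) = T x + T y" for x y
    by (subst S_eq_iff[symmetric]) (use linD(2)[OF lin_S] in simp)
  moreover have "T (scale H c x) = scale H c (T x)" for c x
    by (subst S_eq_iff[symmetric]) (use linD(3)[OF lin_S] in simp)
  ultimately show ?thesis by (simp add: lin_def)
qed

lemmas lin_hopf_maps [simp] = lin_comp[OF lin_S] lin_comp[OF lin_T] lin_comp[OF lin_counit]
  lin_comp[OF lin_comult]

lemma comult_mem [simp]: "\<Delta> h \<in> carrier (tprod H H)"
  using linD(1)[OF lin_comult] by simp

lemma counit_comult:
  "tsum H H (\<Delta> h) (\<lambda>a b. scale H (\<epsilon> a) b) = h" "tsum H H (\<Delta> h) (\<lambda>a b. scale H (\<epsilon> b) a) = h"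
  using hopf by (auto simp: hopf_algebra_def)

lemma antipode_comult:
  "tsum H H (\<Delta> h) (\<lambda>a b. S a * b) = scale H (\<epsilon> h) 1" "tsum H H (\<Delta> h) (\<lambda>a b. a * S b) = scale H (\<epsilon> h) 1"
  using hopf by (auto simp: hopf_algebra_def)

lemma comult_mult:
  "\<Delta> (x * y) = tsum H H (\<Delta> x) (\<lambda>a b. tsum H H (\<Delta> y) (\<lambda>c d. tens H H (a * c) (b * d)))"
  and comult_1: "\<Delta> 1 = tens H H 1 1"
  and counit_1: "\<epsilon> 1 = 1"
  and counit_mult: "\<epsilon> (x * y) = \<epsilon> x * \<epsilon> y"
  using hopf by (auto simp: hopf_algebra_def)

text \<open>The coassociativity axiom is an equation in \<open>(V \<otimes> H) \<otimes> H\<close>;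
  applying the linear map induced by a trilinear \<open>F\<close> gives the usual Sweedler
  renumbering. Keeping \<open>\<rho>\<close> abstract serves comodules and the comultiplication of
  \<open>H\<close> alike.\<close>

lemma coassoc_aux:
  assumes V: "vspace V" and \<rho>: "lin V (tprod V H) \<rho>" and v: "v \<in> carrier V"
    and eq: "tsum V H (\<rho> v) (\<lambda>v\<^sub>0 v\<^sub>1. tens (tprod V H) H (\<rho> v\<^sub>0) v\<^sub>1) =
      tsum V H (\<rho> v) (\<lambda>v\<^sub>0 h. tsum H H (\<Delta> h) (\<lambda>a b. tens (tprod V H) H (tens V H v\<^sub>0 a) b))"
    and U: "vspace U"
    and F: "\<And>b c. lin V U (\<lambda>a. F a b c)" "\<And>a c. a \<in> carrier V \<Longrightarrow> lin H U (\<lambda>b. F a b c)"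
      "\<And>a b. a \<in> carrier V \<Longrightarrow> lin H U (\<lambda>c. F a b c)"
  shows "tsum V H (\<rho> v) (\<lambda>v\<^sub>0 v\<^sub>1. tsum V H (\<rho> v\<^sub>0) (\<lambda>a b. F a b v\<^sub>1)) =
    tsum V H (\<rho> v) (\<lambda>v\<^sub>0 h. tsum H H (\<Delta> h) (\<lambda>a b. F v\<^sub>0 a b))"
proof -
  define \<Phi> where "\<Phi> = (\<lambda>s. tsum (tprod V H) H s (\<lambda>t c. tsum V H t (\<lambda>a b. F a b c)))"
  note [simp] = V U F v linD(1)[OF \<rho>] lin_comp[OF \<rho>]
  have "\<Phi> (tsum V H (\<rho> v) (\<lambda>v\<^sub>0 v\<^sub>1. tens (tprod V H) H (\<rho> v\<^sub>0) v\<^sub>1)) =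
      tsum V H (\<rho> v) (\<lambda>v\<^sub>0 v\<^sub>1. tsum V H (\<rho> v\<^sub>0) (\<lambda>a b. F a b v\<^sub>1))"
    unfolding \<Phi>_def by (simp add: tsum_tsum[where U=U] tsum_tens[where U=U])
  moreover have "\<Phi> (tsum V H (\<rho> v) (\<lambda>v\<^sub>0 h. tsum H H (\<Delta> h) (\<lambda>a b. tens (tprod V H) H (tens V H v\<^sub>0 a) b))) =
     tsum V H (\<rho> v) (\<lambda>v\<^sub>0 h. tsum H H (\<Delta> h) (\<lambda>a b. F v\<^sub>0 a b))"
    unfolding \<Phi>_def by (simp add: tsum_tsum[where U=U] tsum_tens[where U=U])
  ultimately show ?thesis using eq by simp
qed

lemma comodule_vspace: "comodule H V \<Longrightarrow> vspace V"
  and comodule_lin: "comodule H V \<Longrightarrow> lin V (tprod V H) (coact V)"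
  by (auto simp: comodule_def)

lemma lin_coact [simp]: "comodule H V \<Longrightarrow> lin X V g \<Longrightarrow> lin X (tprod V H) (\<lambda>x. coact V (g x))"
  by (rule lin_comp[OF comodule_lin])

lemma coact_mem [simp]: "comodule H V \<Longrightarrow> v \<in> carrier V \<Longrightarrow> coact V v \<in> carrier (tprod V H)"
  by (rule linD(1)[OF comodule_lin])

lemma coassoc:
  assumes "comodule H V" "v \<in> carrier V" "vspace U"
    "\<And>b c. lin V U (\<lambda>a. F a b c)" "\<And>a c. a \<in> carrier V \<Longrightarrow> lin H U (\<lambda>b. F a b c)"
    "\<And>a b. a \<in> carrier V \<Longrightarrow> lin H U (\<lambda>c. F a b c)"
  shows "tsum V H (coact V v) (\<lambda>v\<^sub>0 v\<^sub>1. tsum V H (coact V v\<^sub>0) (\<lambda>a b. F a b v\<^sub>1)) =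
    tsum V H (coact V v) (\<lambda>v\<^sub>0 h. tsum H H (\<Delta> h) (\<lambda>a b. F v\<^sub>0 a b))"
  by (rule coassoc_aux) (use assms in \<open>simp_all add: comodule_def\<close>)

lemma counit_coact:
  assumes "comodule H V" "v \<in> carrier V" "vspace U" "lin V U L"
  shows "tsum V H (coact V v) (\<lambda>a b. scale U (\<epsilon> b) (L a)) = L v"
proof -
  note [simp] = assms comodule_vspace[OF assms(1)] linD(1)[OF assms(4)]
  have "L v = L (tsum V H (coact V v) (\<lambda>a b. scale V (\<epsilon> b) a))"
    using assms(1,2) by (simp add: comodule_def)
  also have "\<dots> = tsum V H (coact V v) (\<lambda>a b. L (scale V (\<epsilon> b) a))"
    by (rule lin_into_tsum[where U=V and U'=U]) simp_all
  finally show ?thesis by (simp add: linD(3)[OF assms(4)])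
qed

lemma coassoc_H:
  assumes "vspace U" "\<And>b c. lin H U (\<lambda>a. F a b c)" "\<And>a c. lin H U (\<lambda>b. F a b c)"
    "\<And>a b. lin H U (\<lambda>c. F a b c)"
  shows "tsum H H (\<Delta> h) (\<lambda>x y. tsum H H (\<Delta> x) (\<lambda>a b. F a b y)) =
    tsum H H (\<Delta> h) (\<lambda>x y. tsum H H (\<Delta> y) (\<lambda>a b. F x a b))"
  by (rule coassoc_aux) (use hopf assms in \<open>simp_all add: hopf_algebra_def\<close>)

text \<open>The counit and antipode axioms under a linear map \<open>L\<close>: the form needed when
  the product to be cancelled sits inside a larger Sweedler expression.\<close>

lemma hopf_tsum_lin:
  assumes "vspace U" "lin H U L"
  shows counit_l: "tsum H H (\<Delta> h) (\<lambda>a b. scale U (\<epsilon> a) (L b)) = L h"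
    and counit_r: "tsum H H (\<Delta> h) (\<lambda>a b. scale U (\<epsilon> b) (L a)) = L h"
    and antipode_l: "tsum H H (\<Delta> h) (\<lambda>a b. L (S a * b)) = scale U (\<epsilon> h) (L 1)"
    and antipode_r: "tsum H H (\<Delta> h) (\<lambda>a b. L (a * S b)) = scale U (\<epsilon> h) (L 1)"
proof -
  note [simp] = assms linD(1)[OF assms(2)]
  have 1: "tsum H H (\<Delta> h) (\<lambda>a b. L (B a b)) = L (tsum H H (\<Delta> h) B)" if "bilin H H H B" for B
    by (rule lin_into_tsum[where U=H and U'=U, symmetric]) (use that in simp_all)
  have 2: "scale U c (L x) = L (scale H c x)" for c x
    using linD(3)[OF assms(2)] by simp
  show "tsum H H (\<Delta> h) (\<lambda>a b. scale U (\<epsilon> a) (L b)) = L h"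
    "tsum H H (\<Delta> h) (\<lambda>a b. scale U (\<epsilon> b) (L a)) = L h"
    "tsum H H (\<Delta> h) (\<lambda>a b. L (S a * b)) = scale U (\<epsilon> h) (L 1)"
    "tsum H H (\<Delta> h) (\<lambda>a b. L (a * S b)) = scale U (\<epsilon> h) (L 1)"
    unfolding 2 using 1[of "\<lambda>a b. scale H (\<epsilon> a) b"] 1[of "\<lambda>a b. scale H (\<epsilon> b) a"]
      1[of "\<lambda>a b. S a * b"] 1[of "\<lambda>a b. a * S b"]
    by (simp_all add: counit_comult antipode_comult)
qed

lemma S_1: "S 1 = 1"
  using antipode_comult(1)[of 1] tsum_tens[where U=H and V=H and W=H and B="\<lambda>a b. S a * b" and v=1 and w=1]
  by (simp add: comult_1 counit_1 vspaceD(9))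

text \<open>Expanding \<open>h\<close> by the counit and using that \<open>\<epsilon>\<close> is
  multiplicative gives \<open>\<epsilon>\<close> of the sum of \<open>S a * b\<close>, which the
  antipode axiom evaluates.\<close>

lemma counit_S: "\<epsilon> (S h) = \<epsilon> h"
proof -
  have "\<epsilon> (S h) = tsum H H (\<Delta> h) (\<lambda>a b. scale base (\<epsilon> b) (\<epsilon> (S a)))"
    by (subst counit_r) simp_all
  also have "\<dots> = tsum H H (\<Delta> h) (\<lambda>a b. \<epsilon> (S a * b))"
    by (simp add: counit_mult mult.commute)
  also have "\<dots> = \<epsilon> h"
    by (subst antipode_l[where U=base]) (simp_all add: counit_1)
  finally show ?thesis .
qed

text \<open>Both sides are convolution inverse to the multiplication of \<open>H\<close>. Unfolded:
  \<open>S y * S x\<close> is padded with a counit of \<open>x\<close> and one of \<open>y\<close>,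
  their product is replaced by \<open>S(a_1 b_1) a_2 b_2\<close>, and the inner factors
  \<open>b_2 S(b_3)\<close> and then \<open>a_2 S(a_3)\<close> cancel, leaving
  \<open>S(x y)\<close>.\<close>

lemma S_mult: "S (x * y) = S y * S x"
proof -
  have "S y * S x = tsum H H (\<Delta> x) (\<lambda>a x'. scale H (\<epsilon> a)
      (tsum H H (\<Delta> y) (\<lambda>b y'. scale H (\<epsilon> b) (S y' * S x'))))"
    by (simp add: counit_l[where U=H])
  also have "\<dots> = tsum H H (\<Delta> x) (\<lambda>a x'. tsum H H (\<Delta> y) (\<lambda>b y'.
      scale H (\<epsilon> (a * b)) (1 * (S y' * S x'))))"
    by (simp add: scale_tsum counit_mult vspaceD(8))
  also have "\<dots> = tsum H H (\<Delta> x) (\<lambda>a x'. tsum H H (\<Delta> y) (\<lambda>b y'.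
      tsum H H (\<Delta> (a * b)) (\<lambda>u v. S u * v * (S y' * S x'))))"
    by (subst antipode_l[where U=H]) simp_all
  also have "\<dots> = tsum H H (\<Delta> x) (\<lambda>a x'. tsum H H (\<Delta> y) (\<lambda>b y'. tsum H H (\<Delta> a) (\<lambda>a\<^sub>1 a\<^sub>2.
      tsum H H (\<Delta> b) (\<lambda>b\<^sub>1 b\<^sub>2. S (a\<^sub>1 * b\<^sub>1) * (a\<^sub>2 * b\<^sub>2) * (S y' * S x')))))"
    by (simp add: comult_mult tsum_tsum[where U=H] tsum_tens[where U=H])
  also have "\<dots> = tsum H H (\<Delta> x) (\<lambda>a x'. tsum H H (\<Delta> a) (\<lambda>a\<^sub>1 a\<^sub>2. tsum H H (\<Delta> y) (\<lambda>b y'.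
      tsum H H (\<Delta> b) (\<lambda>b\<^sub>1 b\<^sub>2. S (a\<^sub>1 * b\<^sub>1) * (a\<^sub>2 * b\<^sub>2) * (S y' * S x')))))"
    by (rule tsum_cong[OF refl], rule tsum_swap[where U=H]) simp_all
  also have "\<dots> = tsum H H (\<Delta> x) (\<lambda>a\<^sub>1 x'. tsum H H (\<Delta> x') (\<lambda>a\<^sub>2 a\<^sub>3. tsum H H (\<Delta> y) (\<lambda>b\<^sub>1 y'.
      tsum H H (\<Delta> y') (\<lambda>b\<^sub>2 b\<^sub>3. S (a\<^sub>1 * b\<^sub>1) * (a\<^sub>2 * b\<^sub>2) * (S b\<^sub>3 * S a\<^sub>3)))))"
    by (simp add: coassoc_H[where U=H])
  also have "\<dots> = tsum H H (\<Delta> x) (\<lambda>a\<^sub>1 x'. tsum H H (\<Delta> x') (\<lambda>a\<^sub>2 a\<^sub>3. tsum H H (\<Delta> y) (\<lambda>b\<^sub>1 y'.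
      tsum H H (\<Delta> y') (\<lambda>b\<^sub>2 b\<^sub>3. S (a\<^sub>1 * b\<^sub>1) * (a\<^sub>2 * (b\<^sub>2 * S b\<^sub>3 * S a\<^sub>3))))))"
    by (simp add: mult.assoc)
  also have "\<dots> = tsum H H (\<Delta> x) (\<lambda>a\<^sub>1 x'. tsum H H (\<Delta> x') (\<lambda>a\<^sub>2 a\<^sub>3. tsum H H (\<Delta> y) (\<lambda>b\<^sub>1 y'.
      scale H (\<epsilon> y') (S (a\<^sub>1 * b\<^sub>1) * (a\<^sub>2 * S a\<^sub>3)))))"
    by (rule tsum_cong[OF refl])+ (subst antipode_r[where U=H and L="\<lambda>z. S (_ * _) * (_ * (z * _))"], simp_all)
  also have "\<dots> = tsum H H (\<Delta> x) (\<lambda>a\<^sub>1 x'. tsum H H (\<Delta> x') (\<lambda>a\<^sub>2 a\<^sub>3. S (a\<^sub>1 * y) * (a\<^sub>2 * S a\<^sub>3)))"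
    by (simp add: counit_r[where U=H])
  also have "\<dots> = tsum H H (\<Delta> x) (\<lambda>a\<^sub>1 x'. scale H (\<epsilon> x') (S (a\<^sub>1 * y)))"
    by (rule tsum_cong[OF refl]) (subst antipode_r[where U=H and L="\<lambda>z. S _ * z"], simp_all)
  also have "\<dots> = S (x * y)"
    by (simp add: counit_r[where U=H])
  finally show ?thesis by simp
qed

text \<open>The product of the tensor product algebra \<open>H \<otimes> H\<close>; with it
  \<open>comult_mult\<close> says that \<open>\<Delta>\<close> is multiplicative, and convolution
  inverses of \<open>\<Delta>\<close> can be handled by associativity.\<close>

definition mul2 :: "('k, 'h, 'h) tensor \<Rightarrow> ('k, 'h, 'h) tensor \<Rightarrow> ('k, 'h, 'h) tensor" where
  "mul2 s t = tsum H H s (\<lambda>a b. tsum H H t (\<lambda>c d. tens H H (a * c) (b * d)))"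

lemma mul2_mem [simp]:
  "s \<in> carrier (tprod H H) \<Longrightarrow> t \<in> carrier (tprod H H) \<Longrightarrow> mul2 s t \<in> carrier (tprod H H)"
  by (simp add: mul2_def)

lemma lin_mul2 [simp]:
  assumes "vspace X" "lin X (tprod H H) f" "t \<in> carrier (tprod H H)"
  shows "lin X (tprod H H) (\<lambda>x. mul2 (f x) t)" "lin X (tprod H H) (\<lambda>x. mul2 t (f x))"
  using assms by (simp_all add: mul2_def linD(1)[OF assms(2)])

lemma mul2_assoc:
  "s \<in> carrier (tprod H H) \<Longrightarrow> t \<in> carrier (tprod H H) \<Longrightarrow> u \<in> carrier (tprod H H) \<Longrightarrow>
    mul2 (mul2 s t) u = mul2 s (mul2 t u)"
  by (simp add: mul2_def tsum_tsum[where U="tprod H H"] tsum_tens[where U="tprod H H"] mult.assoc)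

lemma mul2_1: "t \<in> carrier (tprod H H) \<Longrightarrow> mul2 (tens H H 1 1) t = t"
  "t \<in> carrier (tprod H H) \<Longrightarrow> mul2 t (tens H H 1 1) = t"
  by (simp_all add: mul2_def tsum_tens[where U="tprod H H"])

text \<open>Both \<open>\<Delta> \<circ> S\<close> and \<open>h \<mapsto> S(h\<^sub>2) \<otimes> S(h\<^sub>1)\<close> are convolution inverse to \<open>\<Delta> : H \<rightarrow> H \<otimes> H\<close>.\<close>

lemma comult_S: "\<Delta> (S h) = tsum H H (\<Delta> h) (\<lambda>a b. tens H H (S b) (S a))"
proof -
  let ?U = "tprod H H"
  define Q where "Q h = tsum H H (\<Delta> h) (\<lambda>a b. tens H H (S b) (S a))" for h
  have Q_mem [simp]: "Q h \<in> carrier ?U" for h by (simp add: Q_def)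
  have "lin H ?U Q" unfolding Q_def by simp
  note lin_Q [simp] = lin_comp[OF this]
  \<comment> \<open>\<open>Q\<close> is a right convolution inverse of \<open>\<Delta>\<close>: two
    renumberings bring \<open>q\<close> and \<open>S c\<close> together, and after their
    cancellation \<open>p\<close> meets \<open>S h\<close>.\<close>
  have key: "tsum H H (\<Delta> b) (\<lambda>c d. mul2 (\<Delta> c) (Q d)) = tscale (\<epsilon> b) (tens H H 1 1)" for b
  proof -
    have "tsum H H (\<Delta> b) (\<lambda>c d. mul2 (\<Delta> c) (Q d)) =
      tsum H H (\<Delta> b) (\<lambda>x y. tsum H H (\<Delta> x) (\<lambda>p q. tsum H H (\<Delta> y) (\<lambda>c d. tens H H (p * S d) (q * S c))))"
      by (simp add: mul2_def Q_def tsum_tsum[where U="?U"] tsum_tens[where U="?U"])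
    also have "\<dots> = tsum H H (\<Delta> b) (\<lambda>p h. tsum H H (\<Delta> h) (\<lambda>q y. tsum H H (\<Delta> y) (\<lambda>c d. tens H H (p * S d) (q * S c))))"
      by (simp add: coassoc_H[where U="?U"])
    also have "\<dots> = tsum H H (\<Delta> b) (\<lambda>p h. tsum H H (\<Delta> h) (\<lambda>x d. tsum H H (\<Delta> x) (\<lambda>q c. tens H H (p * S d) (q * S c))))"
      by (simp add: coassoc_H[where U="?U"])
    also have "\<dots> = tsum H H (\<Delta> b) (\<lambda>p h. tsum H H (\<Delta> h) (\<lambda>x d. scale ?U (\<epsilon> x) (tens H H (p * S d) 1)))"
      by (rule tsum_cong[OF refl])+ (subst antipode_r[where U="?U" and L="\<lambda>z. tens H H _ z"], simp_all)
    also have "\<dots> = tsum H H (\<Delta> b) (\<lambda>p h. tens H H (p * S h) 1)"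
      by (rule tsum_cong[OF refl], rule counit_l) simp_all
    also have "\<dots> = tscale (\<epsilon> b) (tens H H 1 1)"
      by (subst antipode_r[where U="?U" and L="\<lambda>z. tens H H z _"]) simp_all
    finally show ?thesis .
  qed
  \<comment> \<open>\<open>\<Delta> (S h)\<close> is multiplied by the unit of
    \<open>H \<otimes> H\<close>, written as in \<open>key\<close>; after reassociating, the product
    of \<open>\<Delta> (S a)\<close> and \<open>\<Delta> c\<close> collapses and only
    \<open>Q\<close> remains.\<close>
  have "\<Delta> (S h) = tsum H H (\<Delta> h) (\<lambda>a b. scale ?U (\<epsilon> b) (\<Delta> (S a)))"
    by (subst counit_r) simp_all
  also have "\<dots> = tsum H H (\<Delta> h) (\<lambda>a b. mul2 (\<Delta> (S a)) (tscale (\<epsilon> b) (tens H H 1 1)))"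
  proof (rule tsum_cong[OF refl])
    fix a b
    have "lin ?U ?U (\<lambda>t. mul2 (\<Delta> (S a)) t)" by simp
    from linD(3)[OF this, of "tens H H 1 1" "\<epsilon> b"]
    show "scale ?U (\<epsilon> b) (\<Delta> (S a)) = mul2 (\<Delta> (S a)) (tscale (\<epsilon> b) (tens H H 1 1))"
      by (simp add: mul2_1)
  qed
  also have "\<dots> = tsum H H (\<Delta> h) (\<lambda>a b. tsum H H (\<Delta> b) (\<lambda>c d. mul2 (\<Delta> (S a)) (mul2 (\<Delta> c) (Q d))))"
    unfolding key[symmetric]
    by (rule tsum_cong[OF refl], rule lin_into_tsum[where U="?U" and U'="?U"]) simp_all
  also have "\<dots> = tsum H H (\<Delta> h) (\<lambda>x d. tsum H H (\<Delta> x) (\<lambda>a c. mul2 (\<Delta> (S a)) (mul2 (\<Delta> c) (Q d))))"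
    by (simp add: coassoc_H[where U="?U"])
  also have "\<dots> = tsum H H (\<Delta> h) (\<lambda>x d. tsum H H (\<Delta> x) (\<lambda>a c. mul2 (\<Delta> (S a * c)) (Q d)))"
    by (simp add: mul2_assoc[symmetric] comult_mult[folded mul2_def])
  also have "\<dots> = tsum H H (\<Delta> h) (\<lambda>x d. scale ?U (\<epsilon> x) (Q d))"
    by (rule tsum_cong[OF refl], subst antipode_l[where U="?U" and L="\<lambda>z. mul2 (\<Delta> z) _"])
      (simp_all add: comult_1 mul2_1)
  also have "\<dots> = Q h" by (rule counit_l) simp_all
  finally show ?thesis unfolding Q_def .
qed

lemma T_1: "T 1 = 1" and counit_T: "\<epsilon> (T h) = \<epsilon> h" and T_mult: "T (x * y) = T y * T x"
  using S_1 counit_S[of "T h"] S_mult[of "T y" "T x"] by (metis S_T)+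

text \<open>\<open>comult_S\<close> at \<open>T h\<close> expresses \<open>\<Delta> h\<close>
  through \<open>\<Delta> (T h)\<close>; applying \<open>T\<close> to both legs and flipping them
  back inverts that relation.\<close>

lemma comult_T: "\<Delta> (T h) = tsum H H (\<Delta> h) (\<lambda>a b. tens H H (T b) (T a))"
  using comult_S[of "T h"]
  by (simp add: tsum_tsum[where U="tprod H H"] tsum_tens[where U="tprod H H"])

text \<open>\<open>T\<close> reverses products, so it carries \<open>S a * b\<close> to
  \<open>T b * a\<close> and \<open>a * S b\<close> to \<open>b * T a\<close>. The legs appear in
  the opposite order to the identities for \<open>S\<close>; the first form cancels in
  \<open>hact_act\<close> and \<open>hact_pairing\<close>, the second in
  \<open>hact_eval\<close>.\<close>

lemma inverse_antipode_comult:
  assumes "vspace U" "lin H U L"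
  shows "tsum H H (\<Delta> h) (\<lambda>a b. L (T b * a)) = scale U (\<epsilon> h) (L 1)"
    and "tsum H H (\<Delta> h) (\<lambda>a b. L (b * T a)) = scale U (\<epsilon> h) (L 1)"
  using antipode_l[OF assms(1) lin_comp[OF assms(2) lin_comp[OF lin_T lin_id]], of h]
    antipode_r[OF assms(1) lin_comp[OF assms(2) lin_comp[OF lin_T lin_id]], of h]
  by (simp_all add: T_mult T_1)

declare comodule_vspace [simp]

section \<open>The action of the dual on linear maps between comodules\<close>

text \<open>The action of \<open>hom_act\<close> at one object, for arbitrary comodules and without
  reference to a category, so that the Hopf-algebraic identities can be proved
  componentwise.\<close>

definition hact :: "('k, 'h, 'v::ab_group_add) comod \<Rightarrow> ('k, 'h, 'w::ab_group_add) comod \<Rightarrow>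
    ('h \<Rightarrow> 'k) \<Rightarrow> ('v \<Rightarrow> 'w) \<Rightarrow> 'v \<Rightarrow> 'w" where
  "hact V W f \<eta> v = tsum V H (coact V v) (\<lambda>v\<^sub>0 v\<^sub>1. tsum W H (coact W (\<eta> v\<^sub>0))
     (\<lambda>w\<^sub>0 w\<^sub>1. scale W (f (T v\<^sub>1 * w\<^sub>1)) w\<^sub>0))"

lemma hact_cong:
  "(\<And>x. x \<in> carrier V \<Longrightarrow> \<eta> x = \<eta>' x) \<Longrightarrow> hact V W f \<eta> v = hact V W f \<eta>' v"
  by (simp add: hact_def)

lemma lin_hact:
  assumes "comodule H V" "comodule H W" "lin H base f" "lin V W \<eta>"
  shows "lin V W (hact V W f \<eta>)"
  using assms unfolding hact_def
  by (simp add: lin_comp[OF assms(3)] lin_comp[OF assms(4)] linD(1)[OF assms(4)])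

lemma lin_hact_map:
  assumes "comodule H V" "comodule H W" "lin H base f" "v \<in> carrier V" "vspace X"
    "\<And>x. x \<in> carrier X \<Longrightarrow> lin V W (\<eta> x)" "\<And>v. v \<in> carrier V \<Longrightarrow> lin X W (\<lambda>x. \<eta> x v)"
  shows "lin X W (\<lambda>x. hact V W f (\<eta> x) v)"
proof -
  note [simp] = assms lin_comp[OF assms(3)] lin_comp[OF assms(6)] linD(1)[OF assms(6)]
  show ?thesis unfolding hact_def by simp
qed

section \<open>Dependence of the action on the functional, and finite expansions\<close>

definition dual_space :: "('k, 'h \<Rightarrow> 'k) vspace" where
  "dual_space = \<lparr>carrier = dual H, scale = (\<lambda>c f h. c * f h)\<rparr>"

lemma vspace_dual [simp]: "vspace dual_space"
proof -
  interpret vector_space "scale dual_space"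
    by unfold_locales (auto simp: dual_space_def fun_eq_iff algebra_simps)
  have "subspace (carrier dual_space)"
    by (rule subspaceI) (auto simp: dual_space_def dual_lin lin_def algebra_simps)
  then show ?thesis by (simp add: vspace_def vector_space_axioms)
qed

text \<open>Rationality at a single point: collecting the legs \<open>w\<^sub>0\<close> and
  \<open>T v\<^sub>1 * w\<^sub>1\<close> gives one tensor that is independent of \<open>f\<close>.
  It still depends on \<open>v\<close>, which is the gap that finite generation closes
  later.\<close>

lemma hact_tensor:
  assumes "comodule H V" "comodule H W" "lin V W \<eta>" "v \<in> carrier V"
  obtains t where "t \<in> carrier (tprod W H)"
    "\<And>f. lin H base f \<Longrightarrow> hact V W f \<eta> v = tsum W H t (\<lambda>w h. scale W (f h) w)"
proof -
  note [simp] = assms lin_comp[OF assms(3)] linD(1)[OF assms(3)]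
  define t where "t = tsum V H (coact V v) (\<lambda>v\<^sub>0 v\<^sub>1. tsum W H (coact W (\<eta> v\<^sub>0))
    (\<lambda>w\<^sub>0 w\<^sub>1. tens W H w\<^sub>0 (T v\<^sub>1 * w\<^sub>1)))"
  have "t \<in> carrier (tprod W H)" by (simp add: t_def)
  moreover have "hact V W f \<eta> v = tsum W H t (\<lambda>w h. scale W (f h) w)" if "lin H base f" for f
    by (simp add: hact_def t_def tsum_tsum[where U=W] tsum_tens[where U=W] lin_comp[OF that])
  ultimately show ?thesis by (rule that)
qed

lemma lin_hact_functional:
  assumes "comodule H V" "comodule H W" "lin V W \<eta>" "v \<in> carrier V"
  shows "lin dual_space W (\<lambda>f. hact V W f \<eta> v)"
proof -
  obtain t where t: "t \<in> carrier (tprod W H)"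
    "\<And>f. lin H base f \<Longrightarrow> hact V W f \<eta> v = tsum W H t (\<lambda>w h. scale W (f h) w)"
    using hact_tensor[OF assms] by blast
  have ev: "lin dual_space base (\<lambda>f. f h)" for h
    by (simp add: lin_def dual_space_def)
  have "lin dual_space W (\<lambda>f. tsum W H t (\<lambda>w h. scale W (f h) w))"
  proof (rule lin_tsum2)
    show "bilin W H W (\<lambda>w h. scale W (f h) w)" if "f \<in> carrier dual_space" for f
      using that assms(2) by (simp add: dual_space_def dual_lin)
  qed (use assms t ev in simp_all)
  then show ?thesis
    using t(2) vspaceD(4,5)[OF vspace_dual] by (simp add: lin_def dual_space_def dual_lin)
qed

text \<open>The second legs of a list representing the tensor from \<open>hact_tensor\<close> form
  such a \<open>G\<close>.\<close>

lemma hact_finite_support: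
  assumes "comodule H V" "comodule H W" "lin V W \<eta>" "v \<in> carrier V"
  obtains G where "finite G" "\<And>f. lin H base f \<Longrightarrow> \<forall>h\<in>G. f h = 0 \<Longrightarrow> hact V W f \<eta> v = 0"
proof -
  obtain t where t: "t \<in> carrier (tprod W H)"
    "\<And>f. lin H base f \<Longrightarrow> hact V W f \<eta> v = tsum W H t (\<lambda>w h. scale W (f h) w)"
    using hact_tensor[OF assms] by blast
  have W: "vspace W" using assms(2) by simp
  obtain xs where xs: "set xs \<subseteq> carrier W \<times> carrier H" "t = (\<Sum>(w, h)\<leftarrow>xs. tens W H w h)"
    using tprod_list[OF W t(1)] .
  show ?thesis
  proof (rule that[of "snd ` set xs"])
    fix f assume f: "lin H base f" "\<forall>h\<in>snd ` set xs. f h = 0"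
    have "(\<Sum>(w, h)\<leftarrow>xs. scale W (f h) w) = (\<Sum>x\<leftarrow>xs. 0)"
      using f(2) by (intro arg_cong[of _ _ sum_list] map_cong) (auto simp: vspaceD(11)[OF W])
    then show "hact V W f \<eta> v = 0"
      using tsum_list[OF W vspace_H W _ xs(1), of "\<lambda>w h. scale W (f h) w"] t(2)[OF f(1)] xs(2) W f(1)
      by simp
  qed simp
qed

lemma finite_dual_basis:
  fixes G :: "'h set"
  assumes "finite G"
  obtains bs g where "\<And>b. lin H base (g b)"
    "\<And>f h. lin H base f \<Longrightarrow> h \<in> G \<Longrightarrow> f h = (\<Sum>b\<leftarrow>bs. f b * g b h)"
proof -
  interpret V: vector_space "scale H" using vspace_H by (simp add: vspace_def)
  obtain B where B: "B \<subseteq> G" "V.independent B" "G \<subseteq> V.span B"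
    using V.maximal_independent_subset[of G] by blast
  \<comment> \<open>Extending \<open>B\<close> to a basis of \<open>H\<close> makes its coordinate
    functionals linear on all of \<open>H\<close>; on the span of \<open>B\<close> they agree with
    the coordinates in \<open>B\<close>.\<close>
  define C where "C = V.extend_basis B"
  have C: "V.independent C" "V.span C = UNIV" "B \<subseteq> C"
    unfolding C_def using B(2) V.independent_extend_basis V.span_extend_basis V.extend_basis_superset by auto
  define g where "g b h = V.representation C h b" for b h
  have fB: "finite B" using B(1) assms finite_subset by auto
  then obtain bs where bs: "set bs = B" "distinct bs"
    using finite_distinct_list by blast
  show ?thesis
  proof
    show "lin H base (g b)" for b
      using V.representation_add[OF C(1)] V.representation_scale[OF C(1)] C(2)
      by (simp add: lin_def g_def)
    fix f h assume f: "lin H base f" and h: "h \<in> G"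
    interpret f: Vector_Spaces.linear "scale H" "(*)" f
      using f lin_base_iff[of H f] by simp
    have hB: "h \<in> V.span B" using h B(3) by auto
    have "V.representation C h = V.representation B h"
      using V.representation_extend[OF C(1) hB C(3)] .
    then have "h = (\<Sum>b\<in>B. scale H (g b h) b)"
      using V.sum_representation_eq[OF B(2) hB fB order_refl] by (simp add: g_def)
    then have "f h = f (\<Sum>b\<in>B. scale H (g b h) b)" by simp
    also have "\<dots> = (\<Sum>b\<in>B. f b * g b h)"
      by (simp add: f.sum f.scale mult.commute)
    finally show "f h = (\<Sum>b\<leftarrow>bs. f b * g b h)"
      using bs by (simp add: sum_list_distinct_conv_sum_set)
  qed
qed

text \<open>The functional \<open>p\<close> is a finite combination of the \<open>g b\<close> that
  agrees with \<open>f\<close> on \<open>G\<close>, so \<open>f - p\<close> acts by zero at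
  \<open>v\<close>, and linearity in the functional finishes. The data \<open>bs\<close> and
  \<open>g\<close> are tied to \<open>G\<close> and not to \<open>v\<close>, hence one choice can
  serve several points.\<close>

lemma hact_dual_basis:
  assumes cm: "comodule H V" "comodule H W" "lin V W \<eta>" "v \<in> carrier V"
    and G: "\<And>f. lin H base f \<Longrightarrow> \<forall>h\<in>G. f h = 0 \<Longrightarrow> hact V W f \<eta> v = 0"
    and g: "\<And>b. lin H base (g b)"
    and expand: "\<And>f h. lin H base f \<Longrightarrow> h \<in> G \<Longrightarrow> f h = (\<Sum>b\<leftarrow>bs. f b * g b h)"
    and f: "lin H base f"
  shows "hact V W f \<eta> v = (\<Sum>b\<leftarrow>bs. scale W (f b) (hact V W (g b) \<eta> v))"
proof -
  note L = lin_hact_functional[OF cm]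
  define p where "p = (\<Sum>b\<leftarrow>bs. scale dual_space (f b) (g b))"
  have gd: "g b \<in> carrier dual_space" for b using g by (simp add: dual_space_def dual_lin)
  have p_mem: "p \<in> carrier dual_space"
    unfolding p_def by (rule sum_list_mem) (use gd in simp_all)
  have p_eval: "p h = (\<Sum>b\<leftarrow>bs. f b * g b h)" for h
    unfolding p_def by (induction bs) (auto simp: dual_space_def)
  have fp: "lin H base (f - p)"
    using f p_mem by (simp add: dual_space_def dual_lin lin_def algebra_simps)
  have "hact V W (f - p) \<eta> v = 0"
    by (rule G[OF fp]) (use expand[OF f] p_eval in simp)
  moreover have "hact V W p \<eta> v = (\<Sum>b\<leftarrow>bs. scale W (f b) (hact V W (g b) \<eta> v))"
    unfolding p_def using lin_sum_list[OF vspace_dual L, of bs "\<lambda>b. scale dual_space (f b) (g b)"]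
    by (simp add: gd linD(3)[OF L gd])
  moreover have "hact V W f \<eta> v = hact V W (f - p) \<eta> v + hact V W p \<eta> v"
    using linD(2)[OF L, of "f - p" p] fp p_mem by (simp add: dual_space_def dual_lin)
  ultimately show ?thesis by simp
qed

text \<open>This yields closure of the action on \<open>D\<close>-module morphisms, with
  \<open>A\<close> a Hom comodule. Since \<open>T\<close> reverses products,
  \<open>T (a_1 * v_1)\<close> puts \<open>T a_1\<close> directly before the leg that
  \<open>a\<close> contributes through the coaction of \<open>\<beta>\<close>, and these two factors
  cancel.\<close>

lemma hact_act:
  assumes cm [simp]: "comodule H A" "comodule H V" "comodule H V'" "comodule H W" "comodule H W'"
    and \<alpha>: "bilin A V V' \<alpha>" and \<beta>: "bilin A W W' \<beta>"
    and \<alpha>_coact: "\<And>a v. a \<in> carrier A \<Longrightarrow> v \<in> carrier V \<Longrightarrow> coact V' (\<alpha> a v) =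
      tsum A H (coact A a) (\<lambda>a\<^sub>0 a\<^sub>1. tsum V H (coact V v) (\<lambda>v\<^sub>0 v\<^sub>1. tens V' H (\<alpha> a\<^sub>0 v\<^sub>0) (a\<^sub>1 * v\<^sub>1)))"
    and \<beta>_coact: "\<And>a w. a \<in> carrier A \<Longrightarrow> w \<in> carrier W \<Longrightarrow> coact W' (\<beta> a w) =
      tsum A H (coact A a) (\<lambda>a\<^sub>0 a\<^sub>1. tsum W H (coact W w) (\<lambda>w\<^sub>0 w\<^sub>1. tens W' H (\<beta> a\<^sub>0 w\<^sub>0) (a\<^sub>1 * w\<^sub>1)))"
    and \<eta>: "lin V W \<eta>" and \<eta>': "lin V' W' \<eta>'"
    and \<eta>_eq: "\<And>a v. a \<in> carrier A \<Longrightarrow> v \<in> carrier V \<Longrightarrow> \<eta>' (\<alpha> a v) = \<beta> a (\<eta> v)"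
    and f: "lin H base f" and a [simp]: "a \<in> carrier A" and v [simp]: "v \<in> carrier V"
  shows "hact V' W' f \<eta>' (\<alpha> a v) = \<beta> a (hact V W f \<eta> v)"
proof -
  note [simp] = lin_comp[OF \<eta>] lin_comp[OF \<eta>'] linD(1)[OF \<eta>] linD(1)[OF \<eta>'] lin_comp[OF f]
    bilin_lin1[OF \<alpha>] bilin_lin2[OF \<alpha>] bilin_mem[OF \<alpha>] bilin_lin1[OF \<beta>] bilin_lin2[OF \<beta>] bilin_mem[OF \<beta>]
  have "hact V' W' f \<eta>' (\<alpha> a v) = tsum A H (coact A a) (\<lambda>a\<^sub>0 a\<^sub>1. tsum V H (coact V v) (\<lambda>v\<^sub>0 v\<^sub>1.
      tsum W' H (coact W' (\<beta> a\<^sub>0 (\<eta> v\<^sub>0))) (\<lambda>w\<^sub>0 w\<^sub>1. scale W' (f (T (a\<^sub>1 * v\<^sub>1) * w\<^sub>1)) w\<^sub>0)))"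
    by (simp add: hact_def \<alpha>_coact tsum_tsum[where U=W'] tsum_tens[where U=W'] \<eta>_eq)
  also have "\<dots> = tsum A H (coact A a) (\<lambda>a\<^sub>0 a\<^sub>1. tsum V H (coact V v) (\<lambda>v\<^sub>0 v\<^sub>1.
      tsum A H (coact A a\<^sub>0) (\<lambda>b\<^sub>0 b\<^sub>1. tsum W H (coact W (\<eta> v\<^sub>0)) (\<lambda>w\<^sub>0 w\<^sub>1.
        scale W' (f (T v\<^sub>1 * (T a\<^sub>1 * b\<^sub>1 * w\<^sub>1))) (\<beta> b\<^sub>0 w\<^sub>0)))))"
    by (simp add: \<beta>_coact tsum_tsum[where U=W'] tsum_tens[where U=W'] T_mult mult.assoc)
  \<comment> \<open>The sum over the coaction of \<open>v\<close> is moved inside, so that the two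
    coactions on \<open>A\<close> become adjacent and coassociativity applies.\<close>
  also have "\<dots> = tsum A H (coact A a) (\<lambda>a\<^sub>0 a\<^sub>1. tsum A H (coact A a\<^sub>0) (\<lambda>b\<^sub>0 b\<^sub>1. tsum V H (coact V v) (\<lambda>v\<^sub>0 v\<^sub>1.
      tsum W H (coact W (\<eta> v\<^sub>0)) (\<lambda>w\<^sub>0 w\<^sub>1. scale W' (f (T v\<^sub>1 * (T a\<^sub>1 * b\<^sub>1 * w\<^sub>1))) (\<beta> b\<^sub>0 w\<^sub>0)))))"
    by (rule tsum_cong[OF refl], rule tsum_swap[where U=W']) simp_all
  also have "\<dots> = tsum A H (coact A a) (\<lambda>a\<^sub>0 h. tsum H H (\<Delta> h) (\<lambda>b c. tsum V H (coact V v) (\<lambda>v\<^sub>0 v\<^sub>1.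
      tsum W H (coact W (\<eta> v\<^sub>0)) (\<lambda>w\<^sub>0 w\<^sub>1. scale W' (f (T v\<^sub>1 * (T c * b * w\<^sub>1))) (\<beta> a\<^sub>0 w\<^sub>0)))))"
    by (subst coassoc[where U=W']) simp_all
  also have "\<dots> = tsum A H (coact A a) (\<lambda>a\<^sub>0 h. scale W' (\<epsilon> h) (tsum V H (coact V v) (\<lambda>v\<^sub>0 v\<^sub>1.
      tsum W H (coact W (\<eta> v\<^sub>0)) (\<lambda>w\<^sub>0 w\<^sub>1. scale W' (f (T v\<^sub>1 * w\<^sub>1)) (\<beta> a\<^sub>0 w\<^sub>0)))))"
    by (rule tsum_cong[OF refl], subst inverse_antipode_comult(1)[where U=W' and L="\<lambda>z. tsum V H (coact V v)
      (\<lambda>v\<^sub>0 v\<^sub>1. tsum W H (coact W (\<eta> v\<^sub>0)) (\<lambda>w\<^sub>0 w\<^sub>1. scale W' (f (T v\<^sub>1 * (z * w\<^sub>1))) (\<beta> _ w\<^sub>0)))"]) simp_all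
  also have "\<dots> = tsum V H (coact V v) (\<lambda>v\<^sub>0 v\<^sub>1.
      tsum W H (coact W (\<eta> v\<^sub>0)) (\<lambda>w\<^sub>0 w\<^sub>1. scale W' (f (T v\<^sub>1 * w\<^sub>1)) (\<beta> a w\<^sub>0)))"
    by (subst counit_coact) simp_all
  also have "\<dots> = \<beta> a (hact V W f \<eta> v)"
    by (simp add: hact_def lin_into_tsum[where U=W and U'=W' and L="\<beta> a"]
        linD(3)[where V=W and W=W' and f="\<beta> a"])
  finally show ?thesis .
qed

lemma lin_convolution:
  assumes "lin H base f" "lin H base g"
  shows "lin H base (convolution H f g)"
proof -
  have "lin H base (\<lambda>h. convolution H f g h)"
    unfolding convolution_def by (simp add: lin_comp[OF assms(1)] lin_comp[OF assms(2)])
  then show ?thesis .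
qed

text \<open>\<open>T\<close> reverses the comultiplication: for legs \<open>h\<close> from
  \<open>V\<close> and \<open>k\<close> from \<open>W\<close>, the coproduct of
  \<open>T h * k\<close> is the sum of \<open>T h_2 * k_1 \<otimes> T h_1 * k_2\<close>. The
  iterated action produces the same pairing, since \<open>g\<close> acts first and takes the inner
  leg from \<open>V\<close> and the outer leg from \<open>W\<close>.\<close>

lemma hact_convolution:
  assumes cm [simp]: "comodule H V" "comodule H W" and f: "lin H base f" and g: "lin H base g"
    and \<eta>: "lin V W \<eta>" and v [simp]: "v \<in> carrier V"
  shows "hact V W (convolution H f g) \<eta> v = hact V W f (hact V W g \<eta>) v"
proof -
  note [simp] = lin_comp[OF \<eta>] linD(1)[OF \<eta>] lin_comp[OF f] lin_comp[OF g]
  \<comment> \<open>The inner action is itself a Sweedler sum inside \<open>coact W\<close>; these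
    three facts move the coaction through its two sums and its scalar.\<close>
  have *: "tsum W H (coact W (tsum V H t B)) C = tsum V H t (\<lambda>a b. tsum W H (coact W (B a b)) C)"
    if "bilin V H W B" "bilin W H W C" "t \<in> carrier (tprod V H)" for t B C
    by (rule lin_into_tsum[where U=W and U'=W]) (use that in simp_all)
  have **: "tsum W H (coact W (tsum W H t B)) C = tsum W H t (\<lambda>a b. tsum W H (coact W (B a b)) C)"
    if "bilin W H W B" "bilin W H W C" "t \<in> carrier (tprod W H)" for t B C
    by (rule lin_into_tsum[where U=W and U'=W]) (use that in simp_all)
  have ***: "tsum W H (coact W (scale W c w)) C = scale W c (tsum W H (coact W w) C)"
    if "w \<in> carrier W" "bilin W H W C" for c w C
  proof -
    have "lin W W (\<lambda>w. tsum W H (coact W w) C)" using that by simp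
    from linD(3)[OF this that(1)] show ?thesis .
  qed
  have "hact V W f (hact V W g \<eta>) v = tsum V H (coact V v) (\<lambda>v\<^sub>0 v\<^sub>1. tsum V H (coact V v\<^sub>0) (\<lambda>a b.
     tsum W H (coact W (\<eta> a)) (\<lambda>w\<^sub>0 w\<^sub>1. tsum W H (coact W w\<^sub>0) (\<lambda>x y.
       scale W (g (T b * w\<^sub>1) * f (T v\<^sub>1 * y)) x))))"
    by (simp add: hact_def * ** *** scale_tsum vspaceD(8))
  also have "\<dots> = tsum V H (coact V v) (\<lambda>a h. tsum H H (\<Delta> h) (\<lambda>b c.
     tsum W H (coact W (\<eta> a)) (\<lambda>w\<^sub>0 w\<^sub>1. tsum W H (coact W w\<^sub>0) (\<lambda>x y.
       scale W (g (T b * w\<^sub>1) * f (T c * y)) x))))"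
    by (subst coassoc[where U=W]) simp_all
  also have "\<dots> = tsum V H (coact V v) (\<lambda>a h. tsum H H (\<Delta> h) (\<lambda>b c.
     tsum W H (coact W (\<eta> a)) (\<lambda>x k. tsum H H (\<Delta> k) (\<lambda>p q.
       scale W (g (T b * q) * f (T c * p)) x))))"
    by (rule tsum_cong[OF refl], rule tsum_cong[OF refl], subst coassoc[where U=W]) simp_all
  also have "\<dots> = tsum V H (coact V v) (\<lambda>a h. tsum W H (coact W (\<eta> a)) (\<lambda>x k. tsum H H (\<Delta> h) (\<lambda>b c.
     tsum H H (\<Delta> k) (\<lambda>p q. scale W (f (T c * p) * g (T b * q)) x))))"
    by (rule tsum_cong[OF refl], subst tsum_swap[where U=W]) (simp_all add: mult.commute)
  also have "\<dots> = tsum V H (coact V v) (\<lambda>a h. tsum W H (coact W (\<eta> a)) (\<lambda>x k.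
     scale W (tsum H H (\<Delta> h) (\<lambda>b c. tsum H H (\<Delta> k) (\<lambda>p q. f (T c * p) * g (T b * q)))) x))"
  proof (rule tsum_cong[OF refl])+
    fix a h x k assume "x \<in> carrier W"
    then have L: "lin base W (\<lambda>c. scale W c x)" by simp
    show "tsum H H (\<Delta> h) (\<lambda>b c. tsum H H (\<Delta> k) (\<lambda>p q. scale W (f (T c * p) * g (T b * q)) x)) =
       scale W (tsum H H (\<Delta> h) (\<lambda>b c. tsum H H (\<Delta> k) (\<lambda>p q. f (T c * p) * g (T b * q)))) x"
      by (simp add: lin_into_tsum[where U=base and U'=W, OF _ _ _ _ L])
  qed
  also have "\<dots> = hact V W (convolution H f g) \<eta> v"
    by (simp add: hact_def convolution_def comult_mult comult_T tsum_tsum[where U=base]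
      tsum_tens[where U=base] tsum_tsum[where U="tprod H H"] tsum_tens[where U="tprod H H"])
  finally show ?thesis by simp
qed

lemma hact_counit:
  assumes "comodule H V" "comodule H W" "lin V W \<eta>" "v \<in> carrier V"
  shows "hact V W \<epsilon> \<eta> v = \<eta> v"
proof -
  note [simp] = assms lin_comp[OF assms(3)] linD(1)[OF assms(3)]
  have "hact V W \<epsilon> \<eta> v = tsum V H (coact V v) (\<lambda>v\<^sub>0 v\<^sub>1. scale W (\<epsilon> v\<^sub>1) (tsum W H (coact W (\<eta> v\<^sub>0))
     (\<lambda>w\<^sub>0 w\<^sub>1. scale W (\<epsilon> w\<^sub>1) w\<^sub>0)))"
    by (simp add: hact_def counit_mult counit_T scale_tsum vspaceD(8))
  then show ?thesis by (simp add: counit_coact[where U=W])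
qed

text \<open>Coassociativity on \<open>V\<close> makes the product \<open>c * T b\<close> of the two
  legs collapse to the counit, undoing the twist in the action. With the coaction of
  \<open>Hom(M, N)\<close> substituted for the action, this becomes colinearity of
  evaluation.\<close>

lemma hact_eval:
  assumes cm [simp]: "comodule H V" "comodule H W" and f: "lin H base f"
    and \<eta>: "lin V W \<eta>" and v [simp]: "v \<in> carrier V"
  shows "tsum V H (coact V v) (\<lambda>v\<^sub>0 v\<^sub>1. hact V W (\<lambda>h. f (v\<^sub>1 * h)) \<eta> v\<^sub>0) =
     tsum W H (coact W (\<eta> v)) (\<lambda>w\<^sub>0 w\<^sub>1. scale W (f w\<^sub>1) w\<^sub>0)"
proof -
  note [simp] = lin_comp[OF \<eta>] linD(1)[OF \<eta>] lin_comp[OF f]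
  have "tsum V H (coact V v) (\<lambda>v\<^sub>0 v\<^sub>1. hact V W (\<lambda>h. f (v\<^sub>1 * h)) \<eta> v\<^sub>0) =
    tsum V H (coact V v) (\<lambda>v\<^sub>0 v\<^sub>1. tsum V H (coact V v\<^sub>0) (\<lambda>a b.
     tsum W H (coact W (\<eta> a)) (\<lambda>w\<^sub>0 w\<^sub>1. scale W (f (v\<^sub>1 * T b * w\<^sub>1)) w\<^sub>0)))"
    by (simp add: hact_def mult.assoc)
  also have "\<dots> = tsum V H (coact V v) (\<lambda>a h. tsum H H (\<Delta> h) (\<lambda>b c.
     tsum W H (coact W (\<eta> a)) (\<lambda>w\<^sub>0 w\<^sub>1. scale W (f (c * T b * w\<^sub>1)) w\<^sub>0)))"
    by (subst coassoc[where U=W]) simp_all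
  also have "\<dots> = tsum V H (coact V v) (\<lambda>a h. scale W (\<epsilon> h)
     (tsum W H (coact W (\<eta> a)) (\<lambda>w\<^sub>0 w\<^sub>1. scale W (f w\<^sub>1) w\<^sub>0)))"
    by (rule tsum_cong[OF refl], subst inverse_antipode_comult(2)[where U=W and
      L="\<lambda>z. tsum W H (coact W (\<eta> _)) (\<lambda>w\<^sub>0 w\<^sub>1. scale W (f (z * w\<^sub>1)) w\<^sub>0)"]) simp_all
  also have "\<dots> = tsum W H (coact W (\<eta> v)) (\<lambda>w\<^sub>0 w\<^sub>1. scale W (f w\<^sub>1) w\<^sub>0)"
    by (subst counit_coact[where U=W]) simp_all
  finally show ?thesis .
qed

text \<open>The legs of \<open>v\<close> cancel as \<open>T c * b\<close> when \<open>B\<close> is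
  colinear on \<open>V \<otimes> Q\<close>, so acting on \<open>B\<close> with its second argument
  fixed only involves the coaction of \<open>q\<close>. This is what makes curried maps
  colinear.\<close>

lemma hact_pairing:
  assumes cm [simp]: "comodule H V" "comodule H Q" "comodule H W" and f: "lin H base f"
    and B: "bilin V Q W B"
    and B_coact: "\<And>v q. v \<in> carrier V \<Longrightarrow> q \<in> carrier Q \<Longrightarrow> coact W (B v q) =
      tsum V H (coact V v) (\<lambda>v\<^sub>0 v\<^sub>1. tsum Q H (coact Q q) (\<lambda>q\<^sub>0 q\<^sub>1. tens W H (B v\<^sub>0 q\<^sub>0) (v\<^sub>1 * q\<^sub>1)))"
    and v [simp]: "v \<in> carrier V" and q [simp]: "q \<in> carrier Q"
  shows "hact V W f (\<lambda>v. B v q) v = tsum Q H (coact Q q) (\<lambda>q\<^sub>0 q\<^sub>1. scale W (f q\<^sub>1) (B v q\<^sub>0))"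
proof -
  note [simp] = bilin_lin1[OF B] bilin_lin2[OF B] bilin_mem[OF B] lin_comp[OF f]
  have "hact V W f (\<lambda>v. B v q) v = tsum V H (coact V v) (\<lambda>v\<^sub>0 v\<^sub>1. tsum V H (coact V v\<^sub>0) (\<lambda>a b.
     tsum Q H (coact Q q) (\<lambda>q\<^sub>0 q\<^sub>1. scale W (f (T v\<^sub>1 * b * q\<^sub>1)) (B a q\<^sub>0))))"
    by (simp add: hact_def B_coact tsum_tsum[where U=W] tsum_tens[where U=W] mult.assoc)
  also have "\<dots> = tsum V H (coact V v) (\<lambda>a h. tsum H H (\<Delta> h) (\<lambda>b c.
     tsum Q H (coact Q q) (\<lambda>q\<^sub>0 q\<^sub>1. scale W (f (T c * b * q\<^sub>1)) (B a q\<^sub>0))))"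
    by (subst coassoc[where U=W]) simp_all
  also have "\<dots> = tsum V H (coact V v) (\<lambda>a h. scale W (\<epsilon> h)
     (tsum Q H (coact Q q) (\<lambda>q\<^sub>0 q\<^sub>1. scale W (f q\<^sub>1) (B a q\<^sub>0))))"
    by (rule tsum_cong[OF refl], subst inverse_antipode_comult(1)[where U=W and
      L="\<lambda>z. tsum Q H (coact Q q) (\<lambda>q\<^sub>0 q\<^sub>1. scale W (f (z * q\<^sub>1)) (B _ q\<^sub>0))"]) simp_all
  also have "\<dots> = tsum Q H (coact Q q) (\<lambda>q\<^sub>0 q\<^sub>1. scale W (f q\<^sub>1) (B v q\<^sub>0))"
    by (subst counit_coact[where U=W]) simp_all
  finally show ?thesis .
qed

section \<open>Rational modules as comodules\<close>

context
  fixes V :: "('k, 'v::ab_group_add) vspace" and act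
  assumes rat: "rational H V act"
begin

lemma rational_vspace: "vspace V"
  and rational_act: "lin H base f \<Longrightarrow> lin V V (act f)"
  using rat by (auto simp: rational_def left_dual_module_def dual_lin)

text \<open>Existence of the tensor is rationality, and uniqueness is \<open>tprod_eqI\<close>. All
  later facts about the coaction of \<open>rational_comod\<close> are derived from these
  two.\<close>

lemma rational_coact:
  assumes m: "m \<in> carrier V"
  shows "coact (rational_comod H V act) m \<in> carrier (tprod V H)"
    and "lin H base f \<Longrightarrow> tsum V H (coact (rational_comod H V act) m) (\<lambda>v h. scale V (f h) v) = act f m"
proof -
  have V: "vspace V" by (rule rational_vspace)
  let ?P = "\<lambda>t. t \<in> carrier (tprod V H) \<and>
    (\<forall>f\<in>dual H. act f m = tsum V H t (\<lambda>v h. scale V (f h) v))"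
  have "\<exists>t. ?P t" using rat m by (auto simp: rational_def)
  moreover have "t = t'" if "?P t" "?P t'" for t t'
    by (rule tprod_eqI[OF V vspace_H]) (use that in \<open>auto simp: dual_def\<close>)
  ultimately have "\<exists>!t. ?P t" by blast
  from theI'[OF this] have P: "?P (THE t. ?P t)" .
  have eq: "coact (rational_comod H V act) m = (THE t. ?P t)"
    by (simp only: rational_comod_def comod.select_convs)
  show "coact (rational_comod H V act) m \<in> carrier (tprod V H)"
    unfolding eq using P by blast
  show "tsum V H (coact (rational_comod H V act) m) (\<lambda>v h. scale V (f h) v) = act f m" if "lin H base f"
    unfolding eq using P that unfolding dual_lin[symmetric] by (metis (no_types, lifting))
qed

lemma rational_comod_simps:
  "carrier (rational_comod H V act) = carrier V" "scale (rational_comod H V act) = scale V"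
  by (simp_all add: rational_comod_def)

lemmas rational_comod_eqs = tens_cong_left[OF rational_comod_simps] tprod_cong_left[OF rational_comod_simps]
  tsum_cong_left[OF rational_comod_simps] lin_cong_left[OF rational_comod_simps]
  lin_cong_right[OF rational_comod_simps] vspace_cong'[OF rational_comod_simps]

lemma rational_comod_act:
  "m \<in> carrier V \<Longrightarrow> f \<in> dual H \<Longrightarrow> comod_act H (rational_comod H V act) f m = act f m"
  unfolding comod_act_def rational_comod_eqs rational_comod_simps
  by (rule rational_coact(2)) (simp_all add: dual_lin)

text \<open>Contraction with functionals translates the comodule axioms into module axioms:
  linearity of each \<open>act f\<close>, the convolution law for coassociativity, and the action of
  \<open>\<epsilon>\<close> for the counit.\<close>

lemma comodule_rational_comod: "comodule H (rational_comod H V act)"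
proof -
  let ?R = "rational_comod H V act"
  let ?\<rho> = "coact ?R"
  have V [simp]: "vspace V" by (rule rational_vspace)
  have mem [simp]: "m \<in> carrier V \<Longrightarrow> ?\<rho> m \<in> carrier (tprod V H)" for m by (rule rational_coact)
  have contr: "lin (tprod V H) V (\<lambda>t. tsum V H t (\<lambda>v h. scale V (f h) v))" if "lin H base f" for f
    by (simp add: lin_comp[OF that])
  have lin: "lin V (tprod V H) ?\<rho>"
    unfolding lin_def
  proof (intro conjI ballI allI)
    fix x y c assume [simp]: "x \<in> carrier V" "y \<in> carrier V"
    show "?\<rho> x \<in> carrier (tprod V H)" by simp
    have [simp]: "x + y \<in> carrier V" using vspaceD(4)[OF V] by simp
    have sum [simp]: "?\<rho> x + ?\<rho> y \<in> carrier (tprod V H)" by (rule vspaceD(4)[OF vspace_tprod]) simp_all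
    have sc [simp]: "tscale c (?\<rho> x) \<in> carrier (tprod V H)"
      using vspaceD(5)[OF vspace_tprod[of V H]] by simp
    show "?\<rho> (x + y) = ?\<rho> x + ?\<rho> y"
    proof (rule tprod_eqI[OF V vspace_H])
      fix f assume "Vector_Spaces.linear (scale H) (*) f"
      then have f: "lin H base f" by (simp add: lin_base_iff)
      show "tsum V H (?\<rho> (x + y)) (\<lambda>v h. scale V (f h) v) =
        tsum V H (?\<rho> x + ?\<rho> y) (\<lambda>v h. scale V (f h) v)"
        using linD(2)[OF contr[OF f], of "?\<rho> x" "?\<rho> y"] linD(2)[OF rational_act[OF f], of x y]
        by (simp add: rational_coact(2)[OF _ f])
    qed simp_all
    have "?\<rho> (scale V c x) = tscale c (?\<rho> x)"
    proof (rule tprod_eqI[OF V vspace_H])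
      fix f assume "Vector_Spaces.linear (scale H) (*) f"
      then have f: "lin H base f" by (simp add: lin_base_iff)
      show "tsum V H (?\<rho> (scale V c x)) (\<lambda>v h. scale V (f h) v) =
        tsum V H (tscale c (?\<rho> x)) (\<lambda>v h. scale V (f h) v)"
        using linD(3)[OF contr[OF f], of "?\<rho> x"] linD(3)[OF rational_act[OF f], of x]
        by (simp add: rational_coact(2)[OF _ f])
    qed simp_all
    then show "?\<rho> (scale V c x) = scale (tprod V H) c (?\<rho> x)" by simp
  qed
  note [simp] = lin_comp[OF lin]
  have coassoc: "tsum V H (?\<rho> m) (\<lambda>m\<^sub>0 m\<^sub>1. tens (tprod V H) H (?\<rho> m\<^sub>0) m\<^sub>1) =
      tsum V H (?\<rho> m) (\<lambda>m\<^sub>0 h. tsum H H (\<Delta> h) (\<lambda>a b. tens (tprod V H) H (tens V H m\<^sub>0 a) b))"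
    (is "?l = ?r") if m [simp]: "m \<in> carrier V" for m
  proof (rule tprod_eqI[OF vspace_tprod vspace_H])
    show "?l \<in> carrier (tprod (tprod V H) H)" "?r \<in> carrier (tprod (tprod V H) H)" by simp_all
    fix f assume "Vector_Spaces.linear (scale H) (*) f"
    then have f: "lin H base f" by (simp add: lin_base_iff)
    note [simp] = lin_comp[OF f]
    let ?c = "\<lambda>s. tsum (tprod V H) H s (\<lambda>t h. scale (tprod V H) (f h) t)"
    \<comment> \<open>The outer \<open>H\<close> leg has been contracted with \<open>f\<close>; the
      remaining tensors in \<open>V \<otimes> H\<close> are compared by contracting with a second
      functional \<open>g\<close>.\<close>
    show "?c ?l = ?c ?r"
    proof (rule tprod_eqI[OF V vspace_H])
      show "?c ?l \<in> carrier (tprod V H)" "?c ?r \<in> carrier (tprod V H)" by simp_all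
      fix g assume "Vector_Spaces.linear (scale H) (*) g"
      then have g: "lin H base g" by (simp add: lin_base_iff)
      note [simp] = lin_comp[OF g]
      let ?d = "\<lambda>t. tsum V H t (\<lambda>v h. scale V (g h) v)"
      have d_scale: "?d (tscale c t) = scale V c (?d t)" if "t \<in> carrier (tprod V H)" for c t
        using linD(3)[OF contr[OF g] that] by simp
      have d: "?d (?\<rho> v) = act g v" if "v \<in> carrier V" for v
        by (rule rational_coact(2)[OF that g])
      have "?d (?c ?l) = tsum V H (?\<rho> m) (\<lambda>m\<^sub>0 m\<^sub>1. scale V (f m\<^sub>1) (act g m\<^sub>0))"
        by (simp add: tsum_tsum[where U="tprod V H"] tsum_tens[where U="tprod V H"]
            tsum_tsum[where U=V] d_scale d)
      also have "\<dots> = act g (act f m)"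
        using lin_into_tsum[OF V vspace_H V V rational_act[OF g], of "\<lambda>m\<^sub>0 m\<^sub>1. scale V (f m\<^sub>1) m\<^sub>0" "?\<rho> m"]
        by (simp add: linD(3)[OF rational_act[OF g]] rational_coact(2)[OF m f])
      also have "\<dots> = act (convolution H g f) m"
        using rat m f g by (simp add: rational_def left_dual_module_def dual_lin)
      also have "\<dots> = tsum V H (?\<rho> m) (\<lambda>m\<^sub>0 h. scale V (convolution H g f h) m\<^sub>0)"
        by (rule rational_coact(2)[OF m lin_convolution[OF g f], symmetric])
      also have "\<dots> = tsum V H (?\<rho> m) (\<lambda>m\<^sub>0 h. tsum H H (\<Delta> h) (\<lambda>a b. scale V (g a * f b) m\<^sub>0))"
      proof (rule tsum_cong[OF refl])
        fix v h assume "v \<in> carrier V"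
        then have L: "lin base V (\<lambda>c. scale V c v)" by simp
        show "scale V (convolution H g f h) v = tsum H H (\<Delta> h) (\<lambda>a b. scale V (g a * f b) v)"
          unfolding convolution_def by (rule lin_into_tsum[OF _ _ _ _ L]) simp_all
      qed
      also have "\<dots> = ?d (?c ?r)"
        by (simp add: tsum_tsum[where U="tprod V H"] tsum_tens[where U="tprod V H"]
            tsum_tsum[where U=V] tsum_tens[where U=V] d_scale vspaceD(8) mult.commute)
      finally show "?d (?c ?l) = ?d (?c ?r)" .
    qed
  qed
  have counit: "tsum V H (?\<rho> m) (\<lambda>m\<^sub>0 m\<^sub>1. scale V (\<epsilon> m\<^sub>1) m\<^sub>0) = m" if "m \<in> carrier V" for m
    using rational_coact(2)[OF that, of \<epsilon>] rat that lin_counit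
    by (simp add: rational_def left_dual_module_def)
  show ?thesis unfolding comodule_def rational_comod_eqs rational_comod_simps
    using lin coassoc counit by simp
qed

end

end

section \<open>Morphisms of relative Hopf modules\<close>

text \<open>Oriented towards the comodule record of each object, so that facts phrased by module
  fields become accessible to the calculus of \<open>lin\<close>, \<open>tsum\<close> and
  \<open>coact\<close>.\<close>

lemma hcomod_simps [simp]:
  "mcarrier M X = carrier (hcomod M X)" "scale (hcomod M X) = mscale M" "mcoact M X = coact (hcomod M X)"
  by (simp_all add: hcomod_def)

lemma dspace_eqs:
  "lin (dspace M X) = lin (hcomod M X)" "lin V (dspace M X) = lin V (hcomod M X)"
  "vspace (dspace M X) = vspace (hcomod M X)"
  by (auto intro!: lin_cong_left lin_cong_right vspace_cong' simp: dspace_def)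

lemma bilin_dspace: "bilin A (dspace M X) (dspace N Y) = bilin A (hcomod M X) (hcomod N Y)"
  by (simp add: bilin_def fun_eq_iff dspace_eqs) (simp add: dspace_def)

lemma dmod_hom_iff:
  "\<eta> \<in> dmod_hom D M N \<longleftrightarrow>
     (\<forall>X\<in>objs D. lin (hcomod M X) (hcomod N X) (\<eta> X)) \<and>
     (\<forall>X\<in>objs D. \<forall>Y\<in>objs D. \<forall>f\<in>carrier (homs D X Y). \<forall>m\<in>mcarrier M X.
        \<eta> Y (mact M X Y f m) = mact N X Y f (\<eta> X m)) \<and>
     (\<forall>X m. \<not> (X \<in> objs D \<and> m \<in> mcarrier M X) \<longrightarrow> \<eta> X m = 0)"
  by (simp add: dmod_hom_def dspace_eqs)

lemma dmod_homD:
  assumes "\<eta> \<in> dmod_hom D M N"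
  shows "X \<in> objs D \<Longrightarrow> lin (hcomod M X) (hcomod N X) (\<eta> X)"
    and "X \<in> objs D \<Longrightarrow> Y \<in> objs D \<Longrightarrow> f \<in> carrier (homs D X Y) \<Longrightarrow> m \<in> mcarrier M X \<Longrightarrow>
      \<eta> Y (mact M X Y f m) = mact N X Y f (\<eta> X m)"
    and "\<not> (X \<in> objs D \<and> m \<in> mcarrier M X) \<Longrightarrow> \<eta> X m = 0"
  using assms by (auto simp: dmod_hom_iff)

locale hopf_modules = bijective_antipode H
  for H :: "('k::field, 'h::ring_1) hopf" +
  fixes D :: "('k, 'h, 'o, 'a::ab_group_add) cocat"
    and M :: "('k, 'h, 'o, 'a, 'm::ab_group_add) hopfmod"
    and N :: "('k, 'h, 'o, 'a, 'n::ab_group_add) hopfmod"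
  assumes cat: "co_H_category H D" and M: "hopf_module H D M" and N: "hopf_module H D N"
begin

lemma comodule_homs [simp]: "X \<in> objs D \<Longrightarrow> Y \<in> objs D \<Longrightarrow> comodule H (homs D X Y)"
  using cat by (auto simp: co_H_category_def)

lemma comodule_hcomod [simp]: "X \<in> objs D \<Longrightarrow> comodule H (hcomod M X)" "X \<in> objs D \<Longrightarrow> comodule H (hcomod N X)"
  using M N by (auto simp: hopf_module_def)

lemma bilin_mact:
  assumes "X \<in> objs D" "Y \<in> objs D"
  shows "bilin (homs D X Y) (hcomod M X) (hcomod M Y) (mact M X Y)"
    "bilin (homs D X Y) (hcomod N X) (hcomod N Y) (mact N X Y)"
  using M N assms by (auto simp: hopf_module_def dmodule_def bilin_dspace)

lemma mcoact_mact:
  assumes "X \<in> objs D" "Y \<in> objs D" "f \<in> carrier (homs D X Y)"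
  shows "m \<in> mcarrier M X \<Longrightarrow> mcoact M Y (mact M X Y f m) =
          tsum (homs D X Y) H (coact (homs D X Y) f) (\<lambda>f\<^sub>0 f\<^sub>1.
          tsum (hcomod M X) H (mcoact M X m) (\<lambda>m\<^sub>0 m\<^sub>1.
            tens (hcomod M Y) H (mact M X Y f\<^sub>0 m\<^sub>0) (f\<^sub>1 * m\<^sub>1)))"
    and "n \<in> mcarrier N X \<Longrightarrow> mcoact N Y (mact N X Y f n) =
          tsum (homs D X Y) H (coact (homs D X Y) f) (\<lambda>f\<^sub>0 f\<^sub>1.
          tsum (hcomod N X) H (mcoact N X n) (\<lambda>m\<^sub>0 m\<^sub>1.
            tens (hcomod N Y) H (mact N X Y f\<^sub>0 m\<^sub>0) (f\<^sub>1 * m\<^sub>1)))"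
  using assms M N by (auto simp: hopf_module_def)

abbreviation HomMN :: "('k, 'o \<Rightarrow> 'm \<Rightarrow> 'n) vspace" where "HomMN \<equiv> homspace D M N"

lemma homspace_simps [simp]:
  "carrier HomMN = dmod_hom D M N" "scale HomMN = (\<lambda>c \<eta> X m. mscale N c (\<eta> X m))"
  by (simp_all add: homspace_def)

lemma vector_space_N: "vector_space (mscale N)"
  using N by (simp add: hopf_module_def dmodule_def)

lemma vspace_homspace [simp]: "vspace HomMN"
proof -
  interpret N: vector_space "mscale N" by (rule vector_space_N)
  interpret vector_space "scale HomMN"
    by unfold_locales (auto simp: fun_eq_iff N.scale_right_distrib N.scale_left_distrib)
  have "subspace (carrier HomMN)"
  proof (rule subspaceI)
    have lin0: "lin (hcomod M X) (hcomod N X) (\<lambda>m. 0)" if "X \<in> objs D" for X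
      using that vspaceD(3)[OF comodule_vspace[OF comodule_hcomod(2)[OF that]]] by (simp add: lin_def)
    have lin_add: "lin (hcomod M X) (hcomod N X) (\<lambda>m. \<eta> m + \<zeta> m)"
      if "X \<in> objs D" "lin (hcomod M X) (hcomod N X) \<eta>" "lin (hcomod M X) (hcomod N X) \<zeta>" for X \<eta> \<zeta>
      using that(2,3) vspaceD(4)[OF comodule_vspace[OF comodule_hcomod(2)[OF that(1)]]]
      by (simp add: lin_def algebra_simps N.scale_right_distrib)
    have lin_sc: "lin (hcomod M X) (hcomod N X) (\<lambda>m. mscale N c (\<eta> m))"
      if "X \<in> objs D" "lin (hcomod M X) (hcomod N X) \<eta>" for X \<eta> c
      using lin_scale(2)[OF comodule_vspace[OF comodule_hcomod(2)[OF that(1)]] that(2)] by simp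
    have act: "lin (hcomod N X) (hcomod N Y) (mact N X Y f)"
      if "X \<in> objs D" "Y \<in> objs D" "f \<in> carrier (homs D X Y)" for X Y f
      using bilin_mact(2)[OF that(1,2)] that(3) by (simp add: bilin_def)
    show "0 \<in> carrier HomMN"
      using lin_0[OF _ act] by (auto simp: dmod_hom_iff zero_fun_def lin0)
    fix \<eta> \<zeta> c assume "\<eta> \<in> carrier HomMN"
    then have \<eta>: "\<eta> \<in> dmod_hom D M N" by simp
    show "scale HomMN c \<eta> \<in> carrier HomMN"
      using dmod_homD[OF \<eta>] linD(3)[OF act] linD(1)[OF dmod_homD(1)[OF \<eta>]]
      by (auto simp: dmod_hom_iff lin_sc)
    assume "\<zeta> \<in> carrier HomMN"
    then have \<zeta>: "\<zeta> \<in> dmod_hom D M N" by simp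
    show "\<eta> + \<zeta> \<in> carrier HomMN"
      using dmod_homD[OF \<eta>] dmod_homD[OF \<zeta>] linD(2)[OF act] linD(1)[OF dmod_homD(1)[OF \<eta>]]
        linD(1)[OF dmod_homD(1)[OF \<zeta>]]
      by (auto simp: dmod_hom_iff plus_fun_def lin_add)
  qed
  then show ?thesis using vector_space_axioms by (simp add: vspace_def)
qed

lemma lin_eval: "X \<in> objs D \<Longrightarrow> m \<in> mcarrier M X \<Longrightarrow> lin HomMN (hcomod N X) (\<lambda>\<eta>. \<eta> X m)"
  using linD(1)[OF dmod_homD(1)] by (auto simp: lin_def)

lemma hom_act_eq:
  "X \<in> objs D \<Longrightarrow> m \<in> mcarrier M X \<Longrightarrow>
    hom_act H D M N f \<eta> X m = hact (hcomod M X) (hcomod N X) f (\<eta> X) m"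
  "\<not> (X \<in> objs D \<and> m \<in> mcarrier M X) \<Longrightarrow> hom_act H D M N f \<eta> X m = 0"
  by (auto simp: hom_act_def hact_def)

lemma hom_ext:
  "(\<And>X m. \<not> (X \<in> objs D \<and> m \<in> mcarrier M X) \<Longrightarrow> \<eta> X m = \<zeta> X m) \<Longrightarrow>
    (\<And>X m. X \<in> objs D \<Longrightarrow> m \<in> mcarrier M X \<Longrightarrow> \<eta> X m = \<zeta> X m) \<Longrightarrow> \<eta> = \<zeta>"
  by (intro ext) blast

text \<open>Linearity of the components is \<open>lin_hact\<close>, and compatibility with arrows is
  \<open>hact_act\<close> for the Hom comodule acting on \<open>M\<close> and
  \<open>N\<close>.\<close>

lemma hom_act_closed:
  assumes f: "lin H base f" and \<eta>: "\<eta> \<in> dmod_hom D M N"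
  shows "hom_act H D M N f \<eta> \<in> dmod_hom D M N"
  unfolding dmod_hom_iff
proof (intro conjI ballI allI impI)
  fix X assume X: "X \<in> objs D"
  have "lin (hcomod M X) (hcomod N X) (hact (hcomod M X) (hcomod N X) f (\<eta> X))"
    by (rule lin_hact) (use X f dmod_homD(1)[OF \<eta>] in simp_all)
  \<comment> \<open>\<open>hom_act\<close> is only known to agree with \<open>hact\<close> on the
    carrier, which is all that \<open>lin\<close> inspects.\<close>
  moreover have "lin (hcomod M X) (hcomod N X) g \<Longrightarrow> (\<And>m. m \<in> mcarrier M X \<Longrightarrow> g' m = g m) \<Longrightarrow>
    lin (hcomod M X) (hcomod N X) g'" for g g'
    using vspaceD(4,5)[OF comodule_vspace[OF comodule_hcomod(1)[OF X]]] by (simp add: lin_def)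
  ultimately show "lin (hcomod M X) (hcomod N X) (hom_act H D M N f \<eta> X)"
    using hom_act_eq(1)[OF X] by blast
  fix Y a m assume Y: "Y \<in> objs D" and a: "a \<in> carrier (homs D X Y)" and m: "m \<in> mcarrier M X"
  have "mact M X Y a m \<in> mcarrier M Y" using bilin_mem[OF bilin_mact(1)[OF X Y] a, of m] m by simp
  moreover have "hact (hcomod M Y) (hcomod N Y) f (\<eta> Y) (mact M X Y a m) =
      mact N X Y a (hact (hcomod M X) (hcomod N X) f (\<eta> X) m)"
    by (rule hact_act[OF _ _ _ _ _ bilin_mact(1)[OF X Y] bilin_mact(2)[OF X Y]])
      (use X Y a m f dmod_homD[OF \<eta>] mcoact_mact[OF X Y] in simp_all)
  ultimately show "hom_act H D M N f \<eta> Y (mact M X Y a m) = mact N X Y a (hom_act H D M N f \<eta> X m)"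
    using X Y m by (simp add: hom_act_eq(1))
next
  fix X m assume "\<not> (X \<in> objs D \<and> m \<in> mcarrier M X)"
  then show "hom_act H D M N f \<eta> X m = 0" by (rule hom_act_eq(2))
qed

lemma left_dual_module_hom: "left_dual_module H HomMN (hom_act H D M N)"
  unfolding left_dual_module_def
proof (intro conjI ballI allI)
  show "vspace HomMN" by simp
  interpret N: vector_space "mscale N" by (rule vector_space_N)
  have N0: "mscale N c 0 = 0" for c by simp
  {
    fix f assume "f \<in> dual H"
    then have f: "lin H base f" by (simp add: dual_lin)
    show "lin HomMN HomMN (hom_act H D M N f)"
      unfolding lin_def
    proof (intro conjI ballI allI)
      fix \<eta> \<zeta> c assume "\<eta> \<in> carrier HomMN" "\<zeta> \<in> carrier HomMN"
      then have e: "\<eta> \<in> dmod_hom D M N" "\<zeta> \<in> dmod_hom D M N" by simp_all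
      have L: "lin HomMN (hcomod N X) (\<lambda>\<eta>. hact (hcomod M X) (hcomod N X) f (\<eta> X) m)"
        if "X \<in> objs D" "m \<in> mcarrier M X" for X m
        by (rule lin_hact_map) (use that f lin_eval dmod_homD(1) in simp_all)
      show "hom_act H D M N f \<eta> \<in> carrier HomMN" using hom_act_closed f e by simp
      show "hom_act H D M N f (\<eta> + \<zeta>) = hom_act H D M N f \<eta> + hom_act H D M N f \<zeta>"
        by (rule hom_ext) (use linD(2)[OF L] e in \<open>simp_all add: hom_act_eq\<close>)
      show "hom_act H D M N f (scale HomMN c \<eta>) = scale HomMN c (hom_act H D M N f \<eta>)"
        by (rule hom_ext) (use linD(3)[OF L] e in \<open>simp_all add: hom_act_eq N0\<close>)
    qed
  }
  fix \<eta> assume "\<eta> \<in> carrier HomMN"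
  then have e: "\<eta> \<in> dmod_hom D M N" by simp
  show "hom_act H D M N \<epsilon> \<eta> = \<eta>"
    by (rule hom_ext) (use dmod_homD(1,3)[OF e] in \<open>simp_all add: hom_act_eq hact_counit\<close>)
  fix f assume "f \<in> dual H"
    then have f: "lin H base f" by (simp add: dual_lin)
  have L: "lin dual_space (hcomod N X) (\<lambda>f. hact (hcomod M X) (hcomod N X) f (\<eta> X) m)"
    if "X \<in> objs D" "m \<in> mcarrier M X" for X m
    by (rule lin_hact_functional) (use that dmod_homD(1)[OF e] in simp_all)
  have d: "g \<in> carrier dual_space" if "lin H base g" for g
    using that by (simp add: dual_space_def dual_lin)
  show "hom_act H D M N (\<lambda>h. c * f h) \<eta> = scale HomMN c (hom_act H D M N f \<eta>)" for c
    by (rule hom_ext) (use linD(3)[OF L] f d in \<open>simp_all add: hom_act_eq N0 dual_space_def\<close>)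
  fix g assume "g \<in> dual H"
  then have g: "lin H base g" by (simp add: dual_lin)
  show "hom_act H D M N (f + g) \<eta> = hom_act H D M N f \<eta> + hom_act H D M N g \<eta>"
    by (rule hom_ext) (use linD(2)[OF L] f g d in \<open>simp_all add: hom_act_eq\<close>)
  show "hom_act H D M N (convolution H f g) \<eta> = hom_act H D M N f (hom_act H D M N g \<eta>)"
  proof (rule hom_ext)
    fix X m assume X: "X \<in> objs D" and m: "m \<in> mcarrier M X"
    have "hact (hcomod M X) (hcomod N X) (convolution H f g) (\<eta> X) m =
      hact (hcomod M X) (hcomod N X) f (hact (hcomod M X) (hcomod N X) g (\<eta> X)) m"
      by (rule hact_convolution) (use X m f g dmod_homD(1)[OF e] in simp_all)
    also have "\<dots> = hact (hcomod M X) (hcomod N X) f (hom_act H D M N g \<eta> X) m"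
      by (rule hact_cong) (use X in \<open>simp add: hom_act_eq\<close>)
    finally show "hom_act H D M N (convolution H f g) \<eta> X m = hom_act H D M N f (hom_act H D M N g \<eta>) X m"
      using X m by (simp add: hom_act_eq)
  qed (simp_all add: hom_act_eq)
qed

text \<open>By naturality and additivity, the value at a combination of the \<open>m i\<close> is
  determined by the values at the \<open>m i\<close> themselves.\<close>

lemma dmod_hom_eqI:
  fixes n :: nat
  assumes gen: "\<forall>i<n. X i \<in> objs D \<and> m i \<in> mcarrier M (X i)"
    "\<forall>Y\<in>objs D. \<forall>y\<in>mcarrier M Y. \<exists>f. (\<forall>i<n. f i \<in> carrier (homs D (X i) Y)) \<and>
           y = (\<Sum>i<n. mact M (X i) Y (f i) (m i))"
    and \<eta>: "\<eta> \<in> dmod_hom D M N" and \<zeta>: "\<zeta> \<in> dmod_hom D M N"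
    and eq: "\<And>i. i < n \<Longrightarrow> \<eta> (X i) (m i) = \<zeta> (X i) (m i)"
  shows "\<eta> = \<zeta>"
proof (rule hom_ext)
  show "\<not> (Y \<in> objs D \<and> y \<in> mcarrier M Y) \<Longrightarrow> \<eta> Y y = \<zeta> Y y" for Y y
    using dmod_homD(3)[OF \<eta>] dmod_homD(3)[OF \<zeta>] by metis
  fix Y y assume Y: "Y \<in> objs D" and "y \<in> mcarrier M Y"
  with gen(2) obtain f where f: "\<forall>i<n. f i \<in> carrier (homs D (X i) Y)"
    "y = (\<Sum>i<n. mact M (X i) Y (f i) (m i))" by blast
  have y: "y = (\<Sum>i\<leftarrow>[0..<n]. mact M (X i) Y (f i) (m i))"
    unfolding f(2) by (simp add: interv_sum_list_conv_sum_set_nat atLeast0LessThan)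
  have val: "\<xi> Y y = (\<Sum>i\<leftarrow>[0..<n]. mact N (X i) Y (f i) (\<xi> (X i) (m i)))"
    if \<xi>: "\<xi> \<in> dmod_hom D M N" for \<xi>
  proof -
    have mem: "mact M (X i) Y (f i) (m i) \<in> carrier (hcomod M Y)" if "i \<in> set [0..<n]" for i
      using bilin_mem[OF bilin_mact(1)[OF _ Y], of "X i" "f i" "m i"] that gen(1) f(1) by simp
    have "\<xi> Y y = (\<Sum>i\<leftarrow>[0..<n]. \<xi> Y (mact M (X i) Y (f i) (m i)))"
      unfolding y by (rule lin_sum_list[OF _ dmod_homD(1)[OF \<xi> Y] mem]) (use Y in auto)
    also have "\<dots> = (\<Sum>i\<leftarrow>[0..<n]. mact N (X i) Y (f i) (\<xi> (X i) (m i)))"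
      using gen(1) f(1) Y by (intro arg_cong[of _ _ sum_list] map_cong refl dmod_homD(2)[OF \<xi>]) auto
    finally show ?thesis .
  qed
  show "\<eta> Y y = \<zeta> Y y"
    unfolding val[OF \<eta>] val[OF \<zeta>] using eq by (intro arg_cong[of _ _ sum_list] map_cong) auto
qed

lemma rational_hom:
  assumes "finitely_generated D M"
  shows "rational H HomMN (hom_act H D M N)"
  unfolding rational_def
proof (intro conjI ballI)
  show "left_dual_module H HomMN (hom_act H D M N)" by (rule left_dual_module_hom)
  fix \<eta> assume "\<eta> \<in> carrier HomMN"
  then have \<eta>: "\<eta> \<in> dmod_hom D M N" by simp
  obtain n :: nat and X m where gen: "\<forall>i<n. X i \<in> objs D \<and> m i \<in> mcarrier M (X i)"
    "\<forall>Y\<in>objs D. \<forall>y\<in>mcarrier M Y. \<exists>f. (\<forall>i<n. f i \<in> carrier (homs D (X i) Y)) \<and>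
           y = (\<Sum>i<n. mact M (X i) Y (f i) (m i))"
    using assms unfolding finitely_generated_def by blast
  have "\<exists>G. finite G \<and> (\<forall>f. lin H base f \<longrightarrow> (\<forall>h\<in>G. f h = 0) \<longrightarrow>
      hact (hcomod M (X i)) (hcomod N (X i)) f (\<eta> (X i)) (m i) = 0)" if "i < n" for i
  proof -
    have i: "comodule H (hcomod M (X i))" "comodule H (hcomod N (X i))"
      "lin (hcomod M (X i)) (hcomod N (X i)) (\<eta> (X i))" "m i \<in> carrier (hcomod M (X i))"
      using gen(1) that dmod_homD(1)[OF \<eta>] by simp_all
    show ?thesis
      by (rule hact_finite_support[OF i], rule exI, intro conjI allI impI) assumption+
  qed
  then obtain G where G: "\<And>i. i < n \<Longrightarrow> finite (G i)"
    "\<And>i f. i < n \<Longrightarrow> lin H base f \<Longrightarrow> \<forall>h\<in>G i. f h = 0 \<Longrightarrow>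
      hact (hcomod M (X i)) (hcomod N (X i)) f (\<eta> (X i)) (m i) = 0"
    by metis
  \<comment> \<open>The union is finite because there are only \<open>n\<close> generators; a dual
    basis for it works at all of them simultaneously.\<close>
  have fin: "finite (\<Union>i<n. G i)" using G(1) by auto
  obtain bs g where bg: "\<And>b. lin H base (g b)"
    "\<And>f h. lin H base f \<Longrightarrow> h \<in> (\<Union>i<n. G i) \<Longrightarrow> f h = (\<Sum>b\<leftarrow>bs. f b * g b h)"
    by (rule finite_dual_basis[OF fin]) (rule that)
  define \<eta>s where "\<eta>s b = hom_act H D M N (g b) \<eta>" for b
  have \<eta>s: "\<eta>s b \<in> dmod_hom D M N" for b
    unfolding \<eta>s_def by (rule hom_act_closed[OF bg(1) \<eta>])
  \<comment> \<open>The candidate for the coaction of \<open>\<eta>\<close>: the sum over the basis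
    list of \<open>b\<close> tensored with the result of letting \<open>g b\<close> act on
    \<open>\<eta>\<close>.\<close>
  define t where "t = (\<Sum>(v, w)\<leftarrow>map (\<lambda>b. (\<eta>s b, b)) bs. tens HomMN H v w)"
  show "\<exists>t\<in>carrier (tprod HomMN H). \<forall>f\<in>dual H.
      hom_act H D M N f \<eta> = tsum HomMN H t (\<lambda>v h. scale HomMN (f h) v)"
  proof (intro bexI ballI)
    show "t \<in> carrier (tprod HomMN H)"
      unfolding t_def by (rule sum_list_mem) (use \<eta>s in auto)
    fix f assume "f \<in> dual H"
    then have f: "lin H base f" by (simp add: dual_lin)
    have "tsum HomMN H t (\<lambda>v h. scale HomMN (f h) v) =
        (\<Sum>(v, w)\<leftarrow>map (\<lambda>b. (\<eta>s b, b)) bs. scale HomMN (f w) v)"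
      unfolding t_def
    proof (rule tsum_list)
      show "bilin HomMN H HomMN (\<lambda>v h. scale HomMN (f h) v)"
        by (intro bilinI lin_scale) (simp_all del: homspace_simps(2) add: f)
    qed (use \<eta>s in auto)
    also have "\<dots> = (\<Sum>b\<leftarrow>bs. scale HomMN (f b) (\<eta>s b))" by (simp add: o_def)
    finally have ts: "tsum HomMN H t (\<lambda>v h. scale HomMN (f h) v) = (\<Sum>b\<leftarrow>bs. scale HomMN (f b) (\<eta>s b))" .
    have mem: "(\<Sum>b\<leftarrow>bs. scale HomMN (f b) (\<eta>s b)) \<in> carrier HomMN"
      by (rule sum_list_mem, simp, rule scale_mem) (use \<eta>s in auto)
    \<comment> \<open>Both sides are morphisms, so it suffices to compare them at the generators,
      where only finitely many values of \<open>f\<close> matter.\<close>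
    show "hom_act H D M N f \<eta> = tsum HomMN H t (\<lambda>v h. scale HomMN (f h) v)"
      unfolding ts
    proof (rule dmod_hom_eqI[OF gen hom_act_closed[OF f \<eta>]])
      show "(\<Sum>b\<leftarrow>bs. scale HomMN (f b) (\<eta>s b)) \<in> dmod_hom D M N" using mem by simp
      fix i assume i: "i < n"
      then have Xm: "X i \<in> objs D" "m i \<in> mcarrier M (X i)" using gen(1) by auto
      have "hom_act H D M N f \<eta> (X i) (m i) = hact (hcomod M (X i)) (hcomod N (X i)) f (\<eta> (X i)) (m i)"
        using Xm by (simp add: hom_act_eq)
      also have "\<dots> = (\<Sum>b\<leftarrow>bs. scale (hcomod N (X i)) (f b)
          (hact (hcomod M (X i)) (hcomod N (X i)) (g b) (\<eta> (X i)) (m i)))"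
      \<comment> \<open>The vanishing condition is applied with \<open>G i\<close> alone; the
        expansion, valid on the whole union, is restricted to it.\<close>
      proof (rule hact_dual_basis[OF _ _ _ _ G(2)[OF i] bg(1) _ f])
        show "f h = (\<Sum>b\<leftarrow>bs. f b * g b h)" if "lin H base f" "h \<in> G i" for f h
          using bg(2)[OF that(1)] that(2) i by blast
      qed (use Xm dmod_homD(1)[OF \<eta>] in simp_all)
      also have "\<dots> = (\<Sum>b\<leftarrow>bs. scale HomMN (f b) (\<eta>s b)) (X i) (m i)"
        by (induction bs) (use Xm in \<open>auto simp: \<eta>s_def hom_act_eq\<close>)
      finally show "hom_act H D M N f \<eta> (X i) (m i) = (\<Sum>b\<leftarrow>bs. scale HomMN (f b) (\<eta>s b)) (X i) (m i)" .
    qed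
  qed
qed

end

section \<open>The functor \<open>M \<otimes> (-)\<close> and Hopf module morphisms out of its
  values\<close>

lemma hopf_tensor_simps [simp]:
  "carrier (hcomod (hopf_tensor H M Q) X) = carrier (tprod (hcomod M X) Q)"
  "mscale (hopf_tensor H M Q) = tscale"
  by (simp_all add: hopf_tensor_def hcomod_def del: hcomod_simps)

lemma coact_hopf_tensor:
  "coact (hcomod (hopf_tensor H M Q) X) = coact (comod_tensor H (hcomod M X) Q)"
  by (simp add: hopf_tensor_def hcomod_def del: hcomod_simps)

lemma hopf_tensor_eqs:
  "lin (hcomod (hopf_tensor H M Q) X) V = lin (tprod (hcomod M X) Q) V"
  "tsum (hcomod (hopf_tensor H M Q) X) W = tsum (tprod (hcomod M X) Q) W"
proof -
  have "carrier (hcomod (hopf_tensor H M Q) X) = carrier (tprod (hcomod M X) Q)"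
    "scale (hcomod (hopf_tensor H M Q) X) = scale (tprod (hcomod M X) Q)" by simp_all
  note eqs = lin_cong_left[OF this] tsum_cong_left[OF this]
  show "lin (hcomod (hopf_tensor H M Q) X) V = lin (tprod (hcomod M X) Q) V"
    "tsum (hcomod (hopf_tensor H M Q) X) W = tsum (tprod (hcomod M X) Q) W"
    by (simp_all only: eqs)
qed

context bijective_antipode
begin

lemma comod_hom_comp:
  assumes P: "comodule H P" and Q: "comodule H Q" and R: "comodule H R"
    and \<psi>: "\<psi> \<in> comod_hom H P Q" and \<chi>: "\<chi> \<in> comod_hom H Q R"
  shows "\<chi> \<circ> \<psi> \<in> comod_hom H P R"
proof -
  have L: "lin P Q \<psi>" "lin Q R \<chi>" using \<psi> \<chi> by (auto simp: comod_hom_def)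
  note [simp] = P Q R lin_comp[OF L(1)] lin_comp[OF L(2)] linD(1)[OF L(1)] linD(1)[OF L(2)]
  \<comment> \<open>Off the carrier \<open>\<psi>\<close> is \<open>0\<close>, so this keeps the
    composite normalised.\<close>
  have "\<chi> 0 = 0" by (rule lin_0[OF _ L(2)]) simp
  moreover have "coact R (\<chi> (\<psi> p)) = tsum P H (coact P p) (\<lambda>p\<^sub>0 p\<^sub>1. tens R H (\<chi> (\<psi> p\<^sub>0)) p\<^sub>1)"
    if [simp]: "p \<in> carrier P" for p
  proof -
    have "coact R (\<chi> (\<psi> p)) = tsum Q H (coact Q (\<psi> p)) (\<lambda>q\<^sub>0 q\<^sub>1. tens R H (\<chi> q\<^sub>0) q\<^sub>1)"
      using \<chi> by (simp add: comod_hom_def)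
    also have "coact Q (\<psi> p) = tsum P H (coact P p) (\<lambda>p\<^sub>0 p\<^sub>1. tens Q H (\<psi> p\<^sub>0) p\<^sub>1)"
      using \<psi> by (simp add: comod_hom_def)
    finally show ?thesis
      by (simp add: tsum_tsum[where U="tprod R H"] tsum_tens[where U="tprod R H"])
  qed
  ultimately show ?thesis
    using \<psi> lin_comp[OF L(2,1)] by (auto simp: comod_hom_def o_def)
qed

text \<open>Cut off outside the carrier because morphisms are normalised there: this function is the
  identity of \<open>Q\<close> in the category.\<close>

lemma comod_hom_id:
  assumes Q: "comodule H Q"
  shows "(\<lambda>q. if q \<in> carrier Q then q else 0) \<in> comod_hom H Q Q"
proof -
  have V: "vspace Q" using Q by simp
  have "coact Q q = tsum Q H (coact Q q) (tens Q H)" if "q \<in> carrier Q" for q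
    using Q that by simp
  then show ?thesis
    using vspaceD(4,5)[OF V] by (auto simp: comod_hom_def lin_def)
qed

end

context hopf_modules
begin

lemmas lin_mscale [simp] = lin_scale[OF comodule_vspace[OF comodule_hcomod(2)], unfolded hcomod_simps(2)]

context
  fixes Q :: "('k, 'h, 'q::ab_group_add) comod"
  assumes Q [simp]: "comodule H Q"
begin

lemma mact_tens:
  assumes "X \<in> objs D" "Y \<in> objs D" "f \<in> carrier (homs D X Y)"
  shows "lin (tprod (hcomod M X) Q) (tprod (hcomod M Y) Q) (mact (hopf_tensor H M Q) X Y f)"
    and "m \<in> carrier (hcomod M X) \<Longrightarrow> q \<in> carrier Q \<Longrightarrow>
      mact (hopf_tensor H M Q) X Y f (tens (hcomod M X) Q m q) = tens (hcomod M Y) Q (mact M X Y f m) q"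
proof -
  note B = bilin_mact(1)[OF assms(1,2)]
  have [simp]: "mact M X Y f m \<in> carrier (hcomod M Y)" if "m \<in> carrier (hcomod M X)" for m
    using bilin_mem[OF B assms(3), of m] that by simp
  have "lin (tprod (hcomod M X) Q) (tprod (hcomod M Y) Q) (\<lambda>t. mact (hopf_tensor H M Q) X Y f t)"
    using assms by (simp add: hopf_tensor_def bilin_lin2[OF B])
  then show "lin (tprod (hcomod M X) Q) (tprod (hcomod M Y) Q) (mact (hopf_tensor H M Q) X Y f)" .
  show "m \<in> carrier (hcomod M X) \<Longrightarrow> q \<in> carrier Q \<Longrightarrow>
      mact (hopf_tensor H M Q) X Y f (tens (hcomod M X) Q m q) = tens (hcomod M Y) Q (mact M X Y f m) q"
    using assms by (simp add: hopf_tensor_def bilin_lin2[OF B] tsum_tens[where U="tprod (hcomod M Y) Q"])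
qed

lemma mcoact_tens:
  assumes [simp]: "X \<in> objs D"
  shows "lin (tprod (hcomod M X) Q) (tprod (tprod (hcomod M X) Q) H) (coact (hcomod (hopf_tensor H M Q) X))"
    and "m \<in> carrier (hcomod M X) \<Longrightarrow> q \<in> carrier Q \<Longrightarrow>
      coact (hcomod (hopf_tensor H M Q) X) (tens (hcomod M X) Q m q) =
        tsum (hcomod M X) H (coact (hcomod M X) m) (\<lambda>m\<^sub>0 m\<^sub>1. tsum Q H (coact Q q)
          (\<lambda>q\<^sub>0 q\<^sub>1. tens (tprod (hcomod M X) Q) H (tens (hcomod M X) Q m\<^sub>0 q\<^sub>0) (m\<^sub>1 * q\<^sub>1)))"
proof -
  let ?T = "tprod (tprod (hcomod M X) Q) H"
  have "lin (tprod (hcomod M X) Q) ?T (\<lambda>t. coact (hcomod (hopf_tensor H M Q) X) t)"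
    by (simp add: coact_hopf_tensor comod_tensor_def)
  then show "lin (tprod (hcomod M X) Q) ?T (coact (hcomod (hopf_tensor H M Q) X))" .
  show "m \<in> carrier (hcomod M X) \<Longrightarrow> q \<in> carrier Q \<Longrightarrow>
      coact (hcomod (hopf_tensor H M Q) X) (tens (hcomod M X) Q m q) =
        tsum (hcomod M X) H (coact (hcomod M X) m) (\<lambda>m\<^sub>0 m\<^sub>1. tsum Q H (coact Q q)
          (\<lambda>q\<^sub>0 q\<^sub>1. tens (tprod (hcomod M X) Q) H (tens (hcomod M X) Q m\<^sub>0 q\<^sub>0) (m\<^sub>1 * q\<^sub>1)))"
    by (simp add: coact_hopf_tensor comod_tensor_def tsum_tens[where U="?T"])
qed

text \<open>One side of the colinearity condition, computed on a pure tensor. Only linearity of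
  \<open>\<phi>\<close> is assumed, so the formula serves both the elimination and the introduction
  rule for Hopf module morphisms out of \<open>M \<otimes> Q\<close>.\<close>

lemma hopf_hom_tensor_coact:
  assumes [simp]: "X \<in> objs D" and m [simp]: "m \<in> carrier (hcomod M X)" and q [simp]: "q \<in> carrier Q"
    and \<phi>: "lin (tprod (hcomod M X) Q) (hcomod N X) \<phi>"
  shows "tsum (tprod (hcomod M X) Q) H (coact (hcomod (hopf_tensor H M Q) X) (tens (hcomod M X) Q m q))
      (\<lambda>t h. tens (hcomod N X) H (\<phi> t) h) =
    tsum (hcomod M X) H (coact (hcomod M X) m) (\<lambda>m\<^sub>0 m\<^sub>1. tsum Q H (coact Q q)
          (\<lambda>q\<^sub>0 q\<^sub>1. tens (hcomod N X) H (\<phi> (tens (hcomod M X) Q m\<^sub>0 q\<^sub>0)) (m\<^sub>1 * q\<^sub>1)))"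
proof -
  let ?U = "tprod (hcomod N X) H"
  have [simp]: "\<phi> t \<in> carrier (hcomod N X)" if "t \<in> carrier (tprod (hcomod M X) Q)" for t
    using linD(1)[OF \<phi> that] by simp
  note [simp] = lin_comp[OF \<phi>]
  show ?thesis
    by (simp add: mcoact_tens tsum_tsum[where U="?U"] tsum_tens[where U="?U"])
qed

lemma hopf_hom_tensorD:
  assumes \<phi>: "\<phi> \<in> hopf_hom H D (hopf_tensor H M Q) N" and X: "X \<in> objs D"
  shows "lin (tprod (hcomod M X) Q) (hcomod N X) (\<phi> X)"
    and "Y \<in> objs D \<Longrightarrow> f \<in> carrier (homs D X Y) \<Longrightarrow> m \<in> carrier (hcomod M X) \<Longrightarrow> q \<in> carrier Q \<Longrightarrow>
      \<phi> Y (tens (hcomod M Y) Q (mact M X Y f m) q) = mact N X Y f (\<phi> X (tens (hcomod M X) Q m q))"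
    and "m \<in> carrier (hcomod M X) \<Longrightarrow> q \<in> carrier Q \<Longrightarrow> coact (hcomod N X) (\<phi> X (tens (hcomod M X) Q m q)) =
      tsum (hcomod M X) H (coact (hcomod M X) m) (\<lambda>m\<^sub>0 m\<^sub>1. tsum Q H (coact Q q)
          (\<lambda>q\<^sub>0 q\<^sub>1. tens (hcomod N X) H (\<phi> X (tens (hcomod M X) Q m\<^sub>0 q\<^sub>0)) (m\<^sub>1 * q\<^sub>1)))"
proof -
  have d: "\<phi> \<in> dmod_hom D (hopf_tensor H M Q) N" using \<phi> by (simp add: hopf_hom_def)
  show L: "lin (tprod (hcomod M X) Q) (hcomod N X) (\<phi> X)"
    using dmod_homD(1)[OF d X] by (simp add: hopf_tensor_eqs)
  show "\<phi> Y (tens (hcomod M Y) Q (mact M X Y f m) q) = mact N X Y f (\<phi> X (tens (hcomod M X) Q m q))"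
    if "Y \<in> objs D" "f \<in> carrier (homs D X Y)" "m \<in> carrier (hcomod M X)" "q \<in> carrier Q"
    using dmod_homD(2)[OF d X that(1,2), of "tens (hcomod M X) Q m q"] that X by (simp add: mact_tens)
  show "coact (hcomod N X) (\<phi> X (tens (hcomod M X) Q m q)) =
      tsum (hcomod M X) H (coact (hcomod M X) m) (\<lambda>m\<^sub>0 m\<^sub>1. tsum Q H (coact Q q)
          (\<lambda>q\<^sub>0 q\<^sub>1. tens (hcomod N X) H (\<phi> X (tens (hcomod M X) Q m\<^sub>0 q\<^sub>0)) (m\<^sub>1 * q\<^sub>1)))"
    if "m \<in> carrier (hcomod M X)" "q \<in> carrier Q"
    unfolding hopf_hom_tensor_coact[OF X that L, symmetric]
    using \<phi> X that by (simp add: hopf_hom_def comod_hom_def hopf_tensor_eqs)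
qed

text \<open>Naturality and colinearity are equations between linear maps on
  \<open>M(X) \<otimes> Q\<close>, so verifying them on pure tensors suffices.\<close>

lemma hopf_hom_tensorI:
  assumes "\<And>X t. \<not> (X \<in> objs D \<and> t \<in> carrier (tprod (hcomod M X) Q)) \<Longrightarrow> \<phi> X t = 0"
    and L: "\<And>X. X \<in> objs D \<Longrightarrow> lin (tprod (hcomod M X) Q) (hcomod N X) (\<phi> X)"
    and "\<And>X Y f m q. X \<in> objs D \<Longrightarrow> Y \<in> objs D \<Longrightarrow> f \<in> carrier (homs D X Y) \<Longrightarrow>
      m \<in> carrier (hcomod M X) \<Longrightarrow> q \<in> carrier Q \<Longrightarrow>
      \<phi> Y (tens (hcomod M Y) Q (mact M X Y f m) q) = mact N X Y f (\<phi> X (tens (hcomod M X) Q m q))"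
    and "\<And>X m q. X \<in> objs D \<Longrightarrow> m \<in> carrier (hcomod M X) \<Longrightarrow> q \<in> carrier Q \<Longrightarrow>
      coact (hcomod N X) (\<phi> X (tens (hcomod M X) Q m q)) =
      tsum (hcomod M X) H (coact (hcomod M X) m) (\<lambda>m\<^sub>0 m\<^sub>1. tsum Q H (coact Q q)
          (\<lambda>q\<^sub>0 q\<^sub>1. tens (hcomod N X) H (\<phi> X (tens (hcomod M X) Q m\<^sub>0 q\<^sub>0)) (m\<^sub>1 * q\<^sub>1)))"
  shows "\<phi> \<in> hopf_hom H D (hopf_tensor H M Q) N"
proof -
  have 1: "\<phi> Y (mact (hopf_tensor H M Q) X Y f t) = mact N X Y f (\<phi> X t)"
    if X [simp]: "X \<in> objs D" and Y [simp]: "Y \<in> objs D" and f: "f \<in> carrier (homs D X Y)"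
      and t: "t \<in> carrier (tprod (hcomod M X) Q)" for X Y f t
  proof (rule tprod_ext[OF _ _ _ _ _ _ t])
    show "lin (tprod (hcomod M X) Q) (hcomod N Y) (\<lambda>t. \<phi> Y (mact (hopf_tensor H M Q) X Y f t))"
      by (rule lin_comp[OF L[OF Y] mact_tens(1)[OF X Y f]])
    show "lin (tprod (hcomod M X) Q) (hcomod N Y) (\<lambda>t. mact N X Y f (\<phi> X t))"
      by (rule bilin_lin2[OF bilin_mact(2)[OF X Y] L[OF X] f])
  qed (use f assms(3) in \<open>simp_all add: mact_tens\<close>)
  have 2: "coact (hcomod N X) (\<phi> X t) = tsum (tprod (hcomod M X) Q) H (coact (hcomod (hopf_tensor H M Q) X) t)
      (\<lambda>t h. tens (hcomod N X) H (\<phi> X t) h)"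
    if X [simp]: "X \<in> objs D" and t: "t \<in> carrier (tprod (hcomod M X) Q)" for X t
  proof (rule tprod_ext[OF _ _ _ _ _ _ t])
    show "lin (tprod (hcomod M X) Q) (tprod (hcomod N X) H) (\<lambda>t. coact (hcomod N X) (\<phi> X t))"
      using lin_coact[OF comodule_hcomod(2)[OF X] L[OF X]] by simp
    show "lin (tprod (hcomod M X) Q) (tprod (hcomod N X) H)
      (\<lambda>t. tsum (tprod (hcomod M X) Q) H (coact (hcomod (hopf_tensor H M Q) X) t)
        (\<lambda>t h. tens (hcomod N X) H (\<phi> X t) h))"
      using linD(1)[OF L[OF X]] by (simp add: mcoact_tens lin_comp[OF L[OF X]])
    show "coact (hcomod N X) (\<phi> X (tens (hcomod M X) Q m q)) =
      tsum (tprod (hcomod M X) Q) H (coact (hcomod (hopf_tensor H M Q) X) (tens (hcomod M X) Q m q))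
        (\<lambda>t h. tens (hcomod N X) H (\<phi> X t) h)"
      if "m \<in> carrier (hcomod M X)" "q \<in> carrier Q" for m q
      using that assms(4)[OF X] by (simp add: hopf_hom_tensor_coact[OF X _ _ L[OF X]])
  qed simp_all
  show ?thesis
    using assms(1) L 1 2 by (auto simp: hopf_hom_def dmod_hom_iff comod_hom_def hopf_tensor_eqs)
qed

end

lemma hopf_tensor_map_tens:
  assumes "comodule H Q" "comodule H R" "lin Q R \<psi>" "X \<in> objs D" "m \<in> carrier (hcomod M X)" "q \<in> carrier Q"
  shows "hopf_tensor_map D M Q R \<psi> X (tens (hcomod M X) Q m q) = tens (hcomod M X) R m (\<psi> q)"
  using assms linD(1)[OF assms(3)] lin_comp[OF assms(3)]
  by (simp add: hopf_tensor_map_def tsum_tens[where U="tprod (hcomod M X) R"] lin_comp[OF assms(3)])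

lemma lin_hopf_tensor_map:
  assumes "comodule H Q" "comodule H R" "lin Q R \<psi>" "X \<in> objs D"
  shows "lin (tprod (hcomod M X) Q) (tprod (hcomod M X) R) (hopf_tensor_map D M Q R \<psi> X)"
proof -
  have "lin (tprod (hcomod M X) Q) (tprod (hcomod M X) R)
      (\<lambda>t. tsum (hcomod M X) Q t (\<lambda>m q. tens (hcomod M X) R m (\<psi> q)))"
    using assms linD(1)[OF assms(3)] by (simp add: lin_comp[OF assms(3)])
  then show ?thesis
    using assms(4) vspaceD(4,5)[OF vspace_tprod[of "hcomod M X" Q]]
    by (simp add: lin_def hopf_tensor_map_def)
qed

lemma hopf_tensor_map_off:
  "\<not> (X \<in> objs D \<and> t \<in> carrier (tprod (hcomod M X) Q)) \<Longrightarrow> hopf_tensor_map D M Q R \<psi> X t = 0"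
  by (auto simp: hopf_tensor_map_def)

lemma hopf_hom_0:
  assumes "comodule H Q" "\<phi> \<in> hopf_hom H D (hopf_tensor H M Q) N"
  shows "\<phi> X 0 = 0"
proof (cases "X \<in> objs D")
  case True
  then show ?thesis by (intro lin_0[OF _ hopf_hom_tensorD(1)[OF assms True]]) simp
next
  case False
  then show ?thesis using assms(2) by (simp add: hopf_hom_def dmod_hom_iff)
qed

lemma hopf_hom_tensor_off:
  assumes "\<phi> \<in> hopf_hom H D (hopf_tensor H M Q) N"
    and "\<not> (X \<in> objs D \<and> t \<in> carrier (tprod (hcomod M X) Q))"
  shows "\<phi> X t = 0"
  using assms by (auto simp: hopf_hom_def dmod_hom_iff)

text \<open>On pure tensors both sides send \<open>m \<otimes> p\<close> to
  \<open>m \<otimes> \<chi> (\<psi> p)\<close>; off the carrier both vanish, so the equation can be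
  used as an identity of total functions.\<close>

lemma hopf_tensor_map_comp:
  assumes P: "comodule H P" and Q: "comodule H Q" and R: "comodule H R"
    and \<psi>: "\<psi> \<in> comod_hom H P Q" and \<chi>: "\<chi> \<in> comod_hom H Q R"
  shows "hopf_tensor_map D M P R (\<chi> \<circ> \<psi>) X t =
    hopf_tensor_map D M Q R \<chi> X (hopf_tensor_map D M P Q \<psi> X t)"
proof (cases "X \<in> objs D")
  case X: True
  have L: "lin P Q \<psi>" "lin Q R \<chi>" using \<psi> \<chi> by (auto simp: comod_hom_def)
  have L': "lin P R (\<chi> \<circ> \<psi>)" using lin_comp[OF L(2,1)] by (simp add: o_def)
  note HL = lin_hopf_tensor_map[OF P Q L(1) X] lin_hopf_tensor_map[OF Q R L(2) X]
    lin_hopf_tensor_map[OF P R L' X]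
  show ?thesis
  proof (cases "t \<in> carrier (tprod (hcomod M X) P)")
    case True
    show ?thesis
    proof (rule tprod_ext[OF _ _ _ HL(3) lin_comp[OF HL(2,1)] _ True])
      fix m p assume "m \<in> carrier (hcomod M X)" "p \<in> carrier P"
      then show "hopf_tensor_map D M P R (\<chi> \<circ> \<psi>) X (tens (hcomod M X) P m p) =
        hopf_tensor_map D M Q R \<chi> X (hopf_tensor_map D M P Q \<psi> X (tens (hcomod M X) P m p))"
        using X linD(1)[OF L(1)] P Q R L L' by (simp add: hopf_tensor_map_tens)
    qed (use P X in simp_all)
  next
    case False
    then show ?thesis using lin_0[OF _ HL(2)] by (simp add: hopf_tensor_map_off)
  qed
qed (simp add: hopf_tensor_map_off)

lemma hopf_tensor_map_id:
  assumes Q: "comodule H Q" and X: "X \<in> objs D" and t: "t \<in> carrier (tprod (hcomod M X) Q)"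
  shows "hopf_tensor_map D M Q Q (\<lambda>q. if q \<in> carrier Q then q else 0) X t = t"
proof -
  have L: "lin Q Q (\<lambda>q. if q \<in> carrier Q then q else 0)"
    using comod_hom_id[OF Q] by (simp add: comod_hom_def)
  show ?thesis
    by (rule tprod_ext[OF _ _ _ lin_hopf_tensor_map[OF Q Q L X] lin_id _ t])
      (use Q X L in \<open>simp_all add: hopf_tensor_map_tens\<close>)
qed

end

section \<open>The universal property\<close>

lemma universal_arrowD:
  assumes "universal_arrow (T :: 'q::ab_group_add itself) H D M P R \<epsilon>"
  shows "comodule H R" "\<epsilon> \<in> hopf_hom H D (hopf_tensor H M R) P"
    and "comodule H (Q :: ('k::field, 'h::ring_1, 'q) comod) \<Longrightarrow>
      bij_betw (\<lambda>\<psi> X. \<epsilon> X \<circ> hopf_tensor_map D M Q R \<psi> X) (comod_hom H Q R) (hopf_hom H D (hopf_tensor H M Q) P)"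
  using assms by (auto simp: universal_arrow_def)

locale rational_hopf_modules = hopf_modules H D M N
  for H :: "('k::field, 'h::ring_1) hopf"
    and D :: "('k, 'h, 'o, 'a::ab_group_add) cocat"
    and M :: "('k, 'h, 'o, 'a, 'm::ab_group_add) hopfmod"
    and N :: "('k, 'h, 'o, 'a, 'n::ab_group_add) hopfmod" +
  assumes fg: "finitely_generated D M"
begin

lemmas rational = rational_hom[OF fg]

abbreviation R where "R \<equiv> hom_comod H D M N"

lemma comodule_R [simp]: "comodule H R"
  unfolding hom_comod_def by (rule comodule_rational_comod[OF rational])

text \<open>Morphisms are rewritten to elements of the comodule \<open>R\<close>, so that the rules
  for comodules apply to them. The second equation is switched off where a scalar multiple must stay
  in the form \<open>scale R\<close>, since \<open>homspace_simps\<close> would expand it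
  pointwise.\<close>

lemma R_simps [simp]: "dmod_hom D M N = carrier R" "scale R = scale HomMN"
  by (simp_all add: hom_comod_def rational_comod_def)

lemma R_act: "f \<in> dual H \<Longrightarrow> \<eta> \<in> dmod_hom D M N \<Longrightarrow> comod_act H R f \<eta> = hom_act H D M N f \<eta>"
  unfolding hom_comod_def by (rule rational_comod_act[OF rational]) simp_all

lemmas R_D = dmod_homD[of _ D M N, unfolded R_simps(1)]
  and hom_act_closed_R = hom_act_closed[unfolded R_simps(1)]

lemma lin_eval_R: "X \<in> objs D \<Longrightarrow> m \<in> carrier (hcomod M X) \<Longrightarrow> lin R (hcomod N X) (\<lambda>\<eta>. \<eta> X m)"
  using lin_eval[of X m] lin_cong_left[of R HomMN "hcomod N X"] by simp

text \<open>Evaluation at \<open>m\<close> is linear, hence commutes with the Sweedler sum defining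
  \<open>comod_act\<close>, and on \<open>R\<close> that action is \<open>hom_act\<close>.\<close>

lemma R_coact_eval:
  assumes "X \<in> objs D" "m \<in> carrier (hcomod M X)" "\<eta> \<in> carrier R" "lin H base f"
  shows "tsum R H (coact R \<eta>) (\<lambda>\<eta>\<^sub>0 h. mscale N (f h) (\<eta>\<^sub>0 X m)) =
    hact (hcomod M X) (hcomod N X) f (\<eta> X) m"
proof -
  note [simp] = assms lin_comp[OF assms(4)]
  note L = lin_eval_R[OF assms(1,2)]
  have "comod_act H R f \<eta> X m = tsum R H (coact R \<eta>) (\<lambda>\<eta>\<^sub>0 h. scale R (f h) \<eta>\<^sub>0 X m)"
    unfolding comod_act_def
    by (rule lin_into_tsum[OF _ _ _ _ L]) (simp_all del: R_simps(2))
  then show ?thesis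
    using R_act[of f \<eta>] by (simp add: dual_lin hom_act_eq)
qed

text \<open>Colinearity of evaluation on pure tensors. After contraction with \<open>f\<close>,
  \<open>hact_eval\<close> expresses the left side by actions of the shifted functionals
  \<open>f (m_1 * h)\<close>, and \<open>R_coact_eval\<close> rewrites these as contractions of the
  coaction of \<open>\<eta>\<close>.\<close>

lemma R_pairing_coact:
  assumes X [simp]: "X \<in> objs D" and m [simp]: "m \<in> carrier (hcomod M X)" and \<eta> [simp]: "\<eta> \<in> carrier R"
  shows "coact (hcomod N X) (\<eta> X m) =
    tsum (hcomod M X) H (coact (hcomod M X) m) (\<lambda>m\<^sub>0 m\<^sub>1. tsum R H (coact R \<eta>)
      (\<lambda>\<eta>\<^sub>0 \<eta>\<^sub>1. tens (hcomod N X) H (\<eta>\<^sub>0 X m\<^sub>0) (m\<^sub>1 * \<eta>\<^sub>1)))"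
proof (rule tprod_eqI[OF comodule_vspace[OF comodule_hcomod(2)[OF X]] vspace_H])
  have [simp]: "\<zeta> X n \<in> carrier (hcomod N X)" "lin (hcomod M X) (hcomod N X) (\<zeta> X)"
    if "n \<in> carrier (hcomod M X)" "\<zeta> \<in> carrier R" for \<zeta> n
    using R_D(1)[OF that(2) X] linD(1)[OF R_D(1)[OF that(2) X] that(1)] by simp_all
  have [simp]: "lin (hcomod M X) (hcomod N X) (\<lambda>m. \<zeta> X m)" if "\<zeta> \<in> carrier R" for \<zeta>
    using R_D(1)[OF that X] by simp
  note [simp] = lin_eval_R[OF X]
  have "coact R \<eta> \<in> carrier (tprod R H)" by (rule coact_mem) simp_all
  note [simp] = this
  show "coact (hcomod N X) (\<eta> X m) \<in> carrier (tprod (hcomod N X) H)" by simp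
  show "tsum (hcomod M X) H (coact (hcomod M X) m) (\<lambda>m\<^sub>0 m\<^sub>1. tsum R H (coact R \<eta>)
      (\<lambda>\<eta>\<^sub>0 \<eta>\<^sub>1. tens (hcomod N X) H (\<eta>\<^sub>0 X m\<^sub>0) (m\<^sub>1 * \<eta>\<^sub>1))) \<in> carrier (tprod (hcomod N X) H)"
    by simp
  fix f assume "Vector_Spaces.linear (scale H) (*) f"
  then have f [simp]: "lin H base f" by (simp add: lin_base_iff)
  note [simp] = lin_comp[OF f]
  have "tsum (hcomod N X) H (coact (hcomod N X) (\<eta> X m)) (\<lambda>v h. scale (hcomod N X) (f h) v) =
    tsum (hcomod M X) H (coact (hcomod M X) m) (\<lambda>m\<^sub>0 m\<^sub>1.
      hact (hcomod M X) (hcomod N X) (\<lambda>h. f (m\<^sub>1 * h)) (\<eta> X) m\<^sub>0)"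
    by (rule hact_eval[symmetric]) simp_all
  also have "\<dots> = tsum (hcomod M X) H (coact (hcomod M X) m) (\<lambda>m\<^sub>0 m\<^sub>1.
      tsum R H (coact R \<eta>) (\<lambda>\<eta>\<^sub>0 h. mscale N (f (m\<^sub>1 * h)) (\<eta>\<^sub>0 X m\<^sub>0)))"
    by (rule tsum_cong[OF refl], rule R_coact_eval[symmetric]) simp_all
  also have "\<dots> = tsum (hcomod N X) H (tsum (hcomod M X) H (coact (hcomod M X) m)
      (\<lambda>m\<^sub>0 m\<^sub>1. tsum R H (coact R \<eta>) (\<lambda>\<eta>\<^sub>0 \<eta>\<^sub>1. tens (hcomod N X) H (\<eta>\<^sub>0 X m\<^sub>0) (m\<^sub>1 * \<eta>\<^sub>1))))
      (\<lambda>v h. scale (hcomod N X) (f h) v)"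
    by (simp add: tsum_tsum[where U="hcomod N X"] tsum_tens[where U="hcomod N X"])
  finally show "tsum (hcomod N X) H (coact (hcomod N X) (\<eta> X m)) (\<lambda>v h. scale (hcomod N X) (f h) v) = \<dots>" .
qed

lemma hom_eval_tens:
  assumes X [simp]: "X \<in> objs D"
  shows "lin (tprod (hcomod M X) R) (hcomod N X) (hom_eval D M N X)"
    and "m \<in> carrier (hcomod M X) \<Longrightarrow> \<eta> \<in> carrier R \<Longrightarrow>
      hom_eval D M N X (tens (hcomod M X) R m \<eta>) = \<eta> X m"
proof -
  have [simp]: "lin (hcomod M X) (hcomod N X) (\<lambda>m. \<zeta> X m)" if "\<zeta> \<in> carrier R" for \<zeta>
    using R_D(1)[OF that X] by simp
  note [simp] = lin_eval_R[OF X]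
  \<comment> \<open>\<open>hom_eval\<close> is defined over the plain space \<open>homspace\<close>,
    while the tensor product here is formed with the comodule \<open>R\<close>.\<close>
  have "carrier R = carrier HomMN" "scale R = scale HomMN" by simp_all
  note R_eqs = tprod_cong_right[OF this, of "hcomod M X"] tsum_cong_right[OF this, of "hcomod M X"]
  have eq: "hom_eval D M N X t = tsum (hcomod M X) R t (\<lambda>m \<eta>. \<eta> X m)"
    if "t \<in> carrier (tprod (hcomod M X) R)" for t
    using that X by (simp only: hom_eval_def R_eqs) simp
  have "lin (tprod (hcomod M X) R) (hcomod N X) (\<lambda>t. tsum (hcomod M X) R t (\<lambda>m \<eta>. \<eta> X m))"
    by simp
  then show "lin (tprod (hcomod M X) R) (hcomod N X) (hom_eval D M N X)"
    using vspaceD(4,5)[OF vspace_tprod[of "hcomod M X" R]] by (simp add: lin_def eq)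
  show "m \<in> carrier (hcomod M X) \<Longrightarrow> \<eta> \<in> carrier R \<Longrightarrow>
      hom_eval D M N X (tens (hcomod M X) R m \<eta>) = \<eta> X m"
    by (simp add: eq tsum_tens[where U="hcomod N X"])
qed

lemma hom_eval_off:
  "\<not> (X \<in> objs D \<and> t \<in> carrier (tprod (hcomod M X) R)) \<Longrightarrow> hom_eval D M N X t = 0"
proof -
  have "carrier R = carrier HomMN" "scale R = scale HomMN" by simp_all
  note R_eqs = tprod_cong_right[OF this, of "hcomod M X"]
  show "\<not> (X \<in> objs D \<and> t \<in> carrier (tprod (hcomod M X) R)) \<Longrightarrow> hom_eval D M N X t = 0"
    by (simp only: hom_eval_def R_eqs) auto
qed

lemma hom_eval_hopf_hom: "hom_eval D M N \<in> hopf_hom H D (hopf_tensor H M R) N"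
proof (rule hopf_hom_tensorI)
  fix X Y f m \<eta> assume a: "X \<in> objs D" "Y \<in> objs D" "f \<in> carrier (homs D X Y)"
    "m \<in> carrier (hcomod M X)" "\<eta> \<in> carrier R"
  have "mact M X Y f m \<in> carrier (hcomod M Y)"
    by (rule bilin_mem[OF bilin_mact(1)[OF a(1,2)] a(3,4)])
  then show "hom_eval D M N Y (tens (hcomod M Y) R (mact M X Y f m) \<eta>) =
      mact N X Y f (hom_eval D M N X (tens (hcomod M X) R m \<eta>))"
    using a R_D(2)[of \<eta> X Y f m] by (simp add: hom_eval_tens)
next
  fix X m \<eta> assume a: "X \<in> objs D" "m \<in> carrier (hcomod M X)" "\<eta> \<in> carrier R"
  then show "coact (hcomod N X) (hom_eval D M N X (tens (hcomod M X) R m \<eta>)) =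
      tsum (hcomod M X) H (coact (hcomod M X) m) (\<lambda>m\<^sub>0 m\<^sub>1. tsum R H (coact R \<eta>)
        (\<lambda>q\<^sub>0 q\<^sub>1. tens (hcomod N X) H (hom_eval D M N X (tens (hcomod M X) R m\<^sub>0 q\<^sub>0)) (m\<^sub>1 * q\<^sub>1)))"
    by (simp add: hom_eval_tens R_pairing_coact)
qed (simp_all add: hom_eval_tens(1) hom_eval_off)

lemma hom_eqI: "\<eta> = \<zeta>" if "\<eta> \<in> carrier R" "\<zeta> \<in> carrier R"
  "\<And>X m. X \<in> objs D \<Longrightarrow> m \<in> carrier (hcomod M X) \<Longrightarrow> \<eta> X m = \<zeta> X m"
  using R_D(3)[OF that(1)] R_D(3)[OF that(2)] that(3) by (intro hom_ext) simp_all

context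
  fixes Q :: "('k, 'h, 'q::ab_group_add) comod"
  assumes Q [simp]: "comodule H Q"
begin

definition ev_map :: "('q \<Rightarrow> 'o \<Rightarrow> 'm \<Rightarrow> 'n) \<Rightarrow> 'o \<Rightarrow> ('k, 'm, 'q) tensor \<Rightarrow> 'n" where
  "ev_map \<psi> = (\<lambda>X. hom_eval D M N X \<circ> hopf_tensor_map D M Q R \<psi> X)"

text \<open>The inverse of \<open>ev_map\<close>. The zero values serve two normalisations at once:
  that of \<open>D\<close>-module morphisms and that of comodule morphisms on
  \<open>Q\<close>.\<close>

definition curry_map :: "('o \<Rightarrow> ('k, 'm, 'q) tensor \<Rightarrow> 'n) \<Rightarrow> 'q \<Rightarrow> 'o \<Rightarrow> 'm \<Rightarrow> 'n" where
  "curry_map \<phi> = (\<lambda>q X m. if q \<in> carrier Q \<and> X \<in> objs D \<and> m \<in> carrier (hcomod M X)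
     then \<phi> X (tens (hcomod M X) Q m q) else 0)"

lemma ev_map_tens:
  assumes \<psi>: "\<psi> \<in> comod_hom H Q R" and X [simp]: "X \<in> objs D"
  shows "lin (tprod (hcomod M X) Q) (hcomod N X) (ev_map \<psi> X)"
    and "m \<in> carrier (hcomod M X) \<Longrightarrow> q \<in> carrier Q \<Longrightarrow> ev_map \<psi> X (tens (hcomod M X) Q m q) = \<psi> q X m"
proof -
  have L: "lin Q R \<psi>" using \<psi> by (simp add: comod_hom_def)
  show "lin (tprod (hcomod M X) Q) (hcomod N X) (ev_map \<psi> X)"
    using lin_comp[OF hom_eval_tens(1)[OF X] lin_hopf_tensor_map[OF Q comodule_R L X]]
    by (simp add: ev_map_def o_def)
  show "m \<in> carrier (hcomod M X) \<Longrightarrow> q \<in> carrier Q \<Longrightarrow> ev_map \<psi> X (tens (hcomod M X) Q m q) = \<psi> q X m"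
    using linD(1)[OF L] by (simp add: ev_map_def hopf_tensor_map_tens[OF Q comodule_R L] hom_eval_tens)
qed

text \<open>Colinearity combines \<open>R_pairing_coact\<close> at \<open>\<psi> q\<close> with the
  colinearity of \<open>\<psi>\<close>, which replaces the coaction of \<open>R\<close> by that of
  \<open>Q\<close>.\<close>

lemma ev_map_hopf_hom:
  assumes \<psi>: "\<psi> \<in> comod_hom H Q R"
  shows "ev_map \<psi> \<in> hopf_hom H D (hopf_tensor H M Q) N"
proof (rule hopf_hom_tensorI[OF Q])
  have L: "lin Q R \<psi>" using \<psi> by (simp add: comod_hom_def)
  have mem: "\<psi> q \<in> carrier R" if "q \<in> carrier Q" for q using linD(1)[OF L that] by simp
  show "ev_map \<psi> X t = 0" if "\<not> (X \<in> objs D \<and> t \<in> carrier (tprod (hcomod M X) Q))" for X t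
    using hopf_hom_0[OF comodule_R hom_eval_hopf_hom] hopf_tensor_map_off[OF that, of R \<psi>] by (simp add: ev_map_def)
  show "lin (tprod (hcomod M X) Q) (hcomod N X) (ev_map \<psi> X)" if "X \<in> objs D" for X
    by (rule ev_map_tens(1)[OF \<psi> that])
  show "ev_map \<psi> Y (tens (hcomod M Y) Q (mact M X Y f m) q) = mact N X Y f (ev_map \<psi> X (tens (hcomod M X) Q m q))"
    if a: "X \<in> objs D" "Y \<in> objs D" "f \<in> carrier (homs D X Y)" "m \<in> carrier (hcomod M X)" "q \<in> carrier Q"
    for X Y f m q
  proof -
    have "mact M X Y f m \<in> carrier (hcomod M Y)"
      by (rule bilin_mem[OF bilin_mact(1)[OF a(1,2)] a(3,4)])
    then show ?thesis
      using a R_D(2)[OF mem, of q X Y f m] by (simp add: ev_map_tens(2)[OF \<psi>])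
  qed
  fix X m q assume X [simp]: "X \<in> objs D" and m [simp]: "m \<in> carrier (hcomod M X)" and q [simp]: "q \<in> carrier Q"
  have [simp]: "lin (hcomod M X) (hcomod N X) (\<lambda>m. \<zeta> X m)" "m \<in> carrier (hcomod M X) \<Longrightarrow> \<zeta> X m \<in> carrier (hcomod N X)"
    if "\<zeta> \<in> carrier R" for \<zeta> m
    using R_D(1)[OF that X] linD(1)[OF R_D(1)[OF that X]] by simp_all
  note [simp] = lin_eval_R[OF X] lin_comp[OF L] mem
  have "coact (hcomod N X) (\<psi> q X m) =
    tsum (hcomod M X) H (coact (hcomod M X) m) (\<lambda>m\<^sub>0 m\<^sub>1. tsum R H (coact R (\<psi> q))
      (\<lambda>\<eta>\<^sub>0 \<eta>\<^sub>1. tens (hcomod N X) H (\<eta>\<^sub>0 X m\<^sub>0) (m\<^sub>1 * \<eta>\<^sub>1)))"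
    by (rule R_pairing_coact) simp_all
  also have "coact R (\<psi> q) = tsum Q H (coact Q q) (\<lambda>q\<^sub>0 q\<^sub>1. tens R H (\<psi> q\<^sub>0) q\<^sub>1)"
    using \<psi> by (simp add: comod_hom_def)
  finally show "coact (hcomod N X) (ev_map \<psi> X (tens (hcomod M X) Q m q)) =
      tsum (hcomod M X) H (coact (hcomod M X) m) (\<lambda>m\<^sub>0 m\<^sub>1. tsum Q H (coact Q q)
        (\<lambda>q\<^sub>0 q\<^sub>1. tens (hcomod N X) H (ev_map \<psi> X (tens (hcomod M X) Q m\<^sub>0 q\<^sub>0)) (m\<^sub>1 * q\<^sub>1)))"
    by (simp add: ev_map_tens(2)[OF \<psi>] tsum_tsum[where U="tprod (hcomod N X) H"]
        tsum_tens[where U="tprod (hcomod N X) H"])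
qed

text \<open>Colinearity is tested by contraction with \<open>f\<close>: the left side becomes the
  action on the curried map, which \<open>hact_pairing\<close> computes for the pairing that sends
  \<open>m\<close> and \<open>q\<close> to \<open>\<phi> (m \<otimes> q)\<close>.\<close>

lemma curry_map_comod_hom:
  assumes \<phi>: "\<phi> \<in> hopf_hom H D (hopf_tensor H M Q) N"
  shows "curry_map \<phi> \<in> comod_hom H Q R"
proof -
  note \<phi>D = hopf_hom_tensorD[OF Q \<phi>]
  have [simp]: "\<phi> X (tens (hcomod M X) Q m q) \<in> carrier (hcomod N X)"
    if "X \<in> objs D" "m \<in> carrier (hcomod M X)" "q \<in> carrier Q" for X m q
    by (rule linD(1)[OF \<phi>D(1)[OF that(1)]]) (use that in simp)
  have Lm: "lin (hcomod M X) (hcomod N X) (\<lambda>m. \<phi> X (tens (hcomod M X) Q m q))"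
    if "X \<in> objs D" "q \<in> carrier Q" for X q
    by (rule lin_comp[OF \<phi>D(1)[OF that(1)]]) (use that in simp)
  have Lq: "lin Q (hcomod N X) (\<lambda>q. \<phi> X (tens (hcomod M X) Q m q))"
    if "X \<in> objs D" "m \<in> carrier (hcomod M X)" for X m
    by (rule lin_comp[OF \<phi>D(1)[OF that(1)]]) (use that in simp)
  have mem: "curry_map \<phi> q \<in> carrier R" if q: "q \<in> carrier Q" for q
    unfolding R_simps(1)[symmetric] dmod_hom_iff
  proof (intro conjI ballI allI impI)
    fix X assume X: "X \<in> objs D"
    show "lin (hcomod M X) (hcomod N X) (curry_map \<phi> q X)"
      using Lm[OF X q] vspaceD(4,5)[OF comodule_vspace[OF comodule_hcomod(1)[OF X]]] X q
      by (simp add: lin_def curry_map_def)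
    fix Y f m assume a: "Y \<in> objs D" "f \<in> carrier (homs D X Y)" "m \<in> mcarrier M X"
    have "mact M X Y f m \<in> carrier (hcomod M Y)"
      by (rule bilin_mem[OF bilin_mact(1)[OF X a(1)] a(2)]) (use a in simp)
    then show "curry_map \<phi> q Y (mact M X Y f m) = mact N X Y f (curry_map \<phi> q X m)"
      using X a q \<phi>D(2)[OF X a(1,2)] by (simp add: curry_map_def)
  qed (auto simp: curry_map_def)
  have N0: "mscale N c 0 = 0" for c
  proof -
    interpret N: vector_space "mscale N" by (rule vector_space_N)
    show ?thesis by simp
  qed
  have L: "lin Q R (curry_map \<phi>)"
    unfolding lin_def
  proof (intro conjI ballI allI)
    fix p q c assume [simp]: "p \<in> carrier Q" "q \<in> carrier Q"
    have [simp]: "p + q \<in> carrier Q" using vspaceD(4)[OF comodule_vspace[OF Q]] by simp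
    show "curry_map \<phi> p \<in> carrier R" using mem by simp
    show "curry_map \<phi> (p + q) = curry_map \<phi> p + curry_map \<phi> q"
      by (rule hom_ext) (use linD(2)[OF Lq] in \<open>auto simp: curry_map_def\<close>)
    show "curry_map \<phi> (scale Q c p) = scale R c (curry_map \<phi> p)"
      by (rule hom_ext) (use linD(3)[OF Lq] in \<open>auto simp: curry_map_def N0\<close>)
  qed
  note [simp] = lin_comp[OF L] mem
  have "coact R (curry_map \<phi> q) = tsum Q H (coact Q q) (\<lambda>q\<^sub>0 q\<^sub>1. tens R H (curry_map \<phi> q\<^sub>0) q\<^sub>1)"
    if q [simp]: "q \<in> carrier Q" for q
  proof (rule tprod_eqI[OF comodule_vspace[OF comodule_R] vspace_H])
    show "coact R (curry_map \<phi> q) \<in> carrier (tprod R H)" by (rule coact_mem) simp_all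
    show "tsum Q H (coact Q q) (\<lambda>q\<^sub>0 q\<^sub>1. tens R H (curry_map \<phi> q\<^sub>0) q\<^sub>1) \<in> carrier (tprod R H)" by simp
    fix f assume "Vector_Spaces.linear (scale H) (*) f"
    then have f [simp]: "lin H base f" by (simp add: lin_base_iff)
    note [simp] = lin_comp[OF f]
    have BR: "bilin R H R (\<lambda>v h. scale R (f h) v)"
      by (intro bilinI lin_scale) (simp_all del: R_simps(2))
    have BQ: "bilin Q H R (\<lambda>q h. scale R (f h) (curry_map \<phi> q))"
      by (intro bilinI lin_scale) (simp_all del: R_simps(2))
    have "tsum R H (coact R (curry_map \<phi> q)) (\<lambda>v h. scale R (f h) v) = hom_act H D M N f (curry_map \<phi> q)"
      using R_act[of f "curry_map \<phi> q"] by (simp add: comod_act_def dual_lin)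
    also have "\<dots> = tsum Q H (coact Q q) (\<lambda>q h. scale R (f h) (curry_map \<phi> q))"
    proof (rule hom_eqI)
      show "hom_act H D M N f (curry_map \<phi> q) \<in> carrier R" by (rule hom_act_closed_R) simp_all
      show "tsum Q H (coact Q q) (\<lambda>q h. scale R (f h) (curry_map \<phi> q)) \<in> carrier R"
        using tsum_mem[OF _ _ _ BQ coact_mem[OF Q q]] by simp
      fix X m assume X [simp]: "X \<in> objs D" and m [simp]: "m \<in> carrier (hcomod M X)"
      have B: "bilin (hcomod M X) Q (hcomod N X) (\<lambda>m q. \<phi> X (tens (hcomod M X) Q m q))"
        by (rule bilinI) (simp_all add: Lm Lq)
      have "hom_act H D M N f (curry_map \<phi> q) X m =
          hact (hcomod M X) (hcomod N X) f (curry_map \<phi> q X) m" by (simp add: hom_act_eq)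
      also have "\<dots> = hact (hcomod M X) (hcomod N X) f (\<lambda>m. \<phi> X (tens (hcomod M X) Q m q)) m"
        by (rule hact_cong) (simp add: curry_map_def)
      also have "\<dots> = tsum Q H (coact Q q) (\<lambda>q\<^sub>0 q\<^sub>1. scale (hcomod N X) (f q\<^sub>1) (\<phi> X (tens (hcomod M X) Q m q\<^sub>0)))"
        by (rule hact_pairing[OF _ _ _ _ B]) (use \<phi>D(3) in simp_all)
      also have "\<dots> = tsum Q H (coact Q q) (\<lambda>q h. scale R (f h) (curry_map \<phi> q) X m)"
        by (rule tsum_cong[OF refl]) (simp add: curry_map_def)
      also have "\<dots> = tsum Q H (coact Q q) (\<lambda>q h. scale R (f h) (curry_map \<phi> q)) X m"
        by (rule lin_into_tsum[OF _ _ _ _ lin_eval_R[OF X m] BQ, symmetric]) simp_all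
      finally show "hom_act H D M N f (curry_map \<phi> q) X m =
        tsum Q H (coact Q q) (\<lambda>q h. scale R (f h) (curry_map \<phi> q)) X m" .
    qed
    also have "\<dots> = tsum Q H (coact Q q) (\<lambda>q\<^sub>0 q\<^sub>1. tsum R H (tens R H (curry_map \<phi> q\<^sub>0) q\<^sub>1) (\<lambda>v h. scale R (f h) v))"
      by (rule tsum_cong[OF refl], rule tsum_tens[OF _ _ _ BR, symmetric]) simp_all
    also have "\<dots> = tsum R H (tsum Q H (coact Q q) (\<lambda>q\<^sub>0 q\<^sub>1. tens R H (curry_map \<phi> q\<^sub>0) q\<^sub>1)) (\<lambda>v h. scale R (f h) v)"
      by (rule tsum_tsum[OF _ _ _ _ _ _ BR, symmetric]) simp_all
    finally show "tsum R H (coact R (curry_map \<phi> q)) (\<lambda>v h. scale R (f h) v) = \<dots>" .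
  qed
  then show ?thesis
    using L by (auto simp: comod_hom_def curry_map_def fun_eq_iff)
qed

lemma bij_ev_map: "bij_betw ev_map (comod_hom H Q R) (hopf_hom H D (hopf_tensor H M Q) N)"
proof (rule bij_betw_byWitness[where f'=curry_map])
  show "ev_map ` comod_hom H Q R \<subseteq> hopf_hom H D (hopf_tensor H M Q) N" using ev_map_hopf_hom by blast
  show "curry_map ` hopf_hom H D (hopf_tensor H M Q) N \<subseteq> comod_hom H Q R" using curry_map_comod_hom by blast
  show "\<forall>\<psi>\<in>comod_hom H Q R. curry_map (ev_map \<psi>) = \<psi>"
  proof (intro ballI ext[of "curry_map _"])
    fix \<psi> q assume \<psi>: "\<psi> \<in> comod_hom H Q R"
    have off: "\<psi> q = 0" if "q \<notin> carrier Q" using \<psi> that by (simp add: comod_hom_def)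
    have on: "\<psi> q \<in> carrier R" if "q \<in> carrier Q"
      using \<psi> that linD(1)[of Q R \<psi>] by (simp add: comod_hom_def)
    show "curry_map (ev_map \<psi>) q = \<psi> q"
      by (rule hom_ext; cases "q \<in> carrier Q")
        (use off R_D(3)[OF on] in \<open>auto simp: curry_map_def ev_map_tens(2)[OF \<psi>]\<close>)
  qed
  show "\<forall>\<phi>\<in>hopf_hom H D (hopf_tensor H M Q) N. ev_map (curry_map \<phi>) = \<phi>"
  proof (intro ballI ext)
    fix \<phi> X t assume \<phi>: "\<phi> \<in> hopf_hom H D (hopf_tensor H M Q) N"
    note c = curry_map_comod_hom[OF \<phi>]
    show "ev_map (curry_map \<phi>) X t = \<phi> X t"
    proof (cases "X \<in> objs D \<and> t \<in> carrier (tprod (hcomod M X) Q)")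
      case True
      then have X: "X \<in> objs D" and t: "t \<in> carrier (tprod (hcomod M X) Q)" by auto
      show ?thesis
        by (rule tprod_ext[OF _ _ _ ev_map_tens(1)[OF c X] hopf_hom_tensorD(1)[OF Q \<phi> X] _ t])
          (use X in \<open>simp_all add: ev_map_tens(2)[OF c], simp add: curry_map_def\<close>)
    next
      case False
      then show ?thesis
        using hopf_hom_tensor_off[OF \<phi>] hopf_hom_tensor_off[OF ev_map_hopf_hom[OF c]] by simp
    qed
  qed
qed

end

lemma universal_hom: "universal_arrow TYPE('q::ab_group_add) H D M N R (hom_eval D M N)"
proof -
  have "bij_betw (\<lambda>\<psi> X. hom_eval D M N X \<circ> hopf_tensor_map D M Q R \<psi> X)
      (comod_hom H Q R) (hopf_hom H D (hopf_tensor H M Q) N)"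
    if Q: "comodule H Q" for Q :: "('k, 'h, 'q) comod"
    using bij_ev_map[OF Q] unfolding ev_map_def[OF Q, abs_def] .
  then show ?thesis
    unfolding universal_arrow_def using hom_eval_hopf_hom comodule_R by blast
qed

text \<open>The usual argument that two universal arrows are uniquely isomorphic. The assumption on
  \<open>A\<close> occurs at two test types because \<open>A\<close> is tested against
  \<open>R\<close>, to obtain \<open>\<theta>\<close>, and against itself, to identify
  \<open>\<theta> \<circ> g\<close>; universality of \<open>R\<close> is available at every test
  type.\<close>

lemma comod_iso_universal:
  fixes A :: "('k, 'h, 'r::ab_group_add) comod"
  assumes A1: "universal_arrow TYPE('r) H D M N A \<epsilon>'"
    and A2: "universal_arrow TYPE('o \<Rightarrow> 'm \<Rightarrow> 'n) H D M N A \<epsilon>'"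
  shows "\<exists>!\<theta>. \<theta> \<in> comod_iso H R A \<and> (\<lambda>X. \<epsilon>' X \<circ> hopf_tensor_map D M R A \<theta> X) = hom_eval D M N"
proof -
  note A = universal_arrowD(1,2)[OF A1]
  let ?J = "\<lambda>\<psi> X. \<epsilon>' X \<circ> hopf_tensor_map D M R A \<psi> X"
  have b1: "bij_betw ?J (comod_hom H R A) (hopf_hom H D (hopf_tensor H M R) N)"
    by (rule universal_arrowD(3)[OF A2 comodule_R])
  have "hom_eval D M N \<in> ?J ` comod_hom H R A"
    unfolding bij_betw_imp_surj_on[OF b1] by (rule hom_eval_hopf_hom)
  then obtain \<theta> where \<theta>: "?J \<theta> = hom_eval D M N" "\<theta> \<in> comod_hom H R A"
    by (rule imageE) (rule that[OF sym])
  \<comment> \<open>The map back comes from the universality of \<open>R\<close>, tested against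
    \<open>A\<close>.\<close>
  have "\<epsilon>' \<in> (\<lambda>\<psi> X. hom_eval D M N X \<circ> hopf_tensor_map D M A R \<psi> X) ` comod_hom H A R"
    unfolding bij_betw_imp_surj_on[OF universal_arrowD(3)[OF universal_hom A(1)]] by (rule A(2))
  then obtain g where g: "(\<lambda>X. hom_eval D M N X \<circ> hopf_tensor_map D M A R g X) = \<epsilon>'" "g \<in> comod_hom H A R"
    by (rule imageE) (rule that[OF sym])
  \<comment> \<open>An equality of total functions: off the carrier the induced map is
    \<open>0\<close>, and there \<open>\<phi>\<close> vanishes as well.\<close>
  have id_eq: "(\<lambda>X. \<phi> X \<circ> hopf_tensor_map D M Q Q (\<lambda>q. if q \<in> carrier Q then q else 0) X) = \<phi>"
    if Q: "comodule H Q" and \<phi>: "\<phi> \<in> hopf_hom H D (hopf_tensor H M Q) N"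
    for Q :: "('k, 'h, 'b::ab_group_add) comod" and \<phi>
  proof (intro ext)
    fix X t
    show "(\<phi> X \<circ> hopf_tensor_map D M Q Q (\<lambda>q. if q \<in> carrier Q then q else 0) X) t = \<phi> X t"
    proof (cases "X \<in> objs D \<and> t \<in> carrier (tprod (hcomod M X) Q)")
      case True
      then show ?thesis using hopf_tensor_map_id[OF Q] by simp
    next
      case False
      then show ?thesis
        by (simp only: o_apply hopf_tensor_map_off[OF False] hopf_hom_0[OF Q \<phi>] hopf_hom_tensor_off[OF \<phi> False])
    qed
  qed
  have e1: "\<epsilon>' X (hopf_tensor_map D M R A \<theta> X t) = hom_eval D M N X t" for X t
    by (rule fun_cong[OF fun_cong[OF \<theta>(1)], unfolded o_apply])
  have e2: "hom_eval D M N X (hopf_tensor_map D M A R g X t) = \<epsilon>' X t" for X t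
    by (rule fun_cong[OF fun_cong[OF g(1)], unfolded o_apply])
  \<comment> \<open>Both functions induce the evaluation under the correspondence of the universal
    property, which is injective.\<close>
  have "g \<circ> \<theta> = (\<lambda>q. if q \<in> carrier R then q else 0)"
  proof (rule inj_onD[OF bij_betw_imp_inj_on[OF universal_arrowD(3)[OF universal_hom comodule_R]]])
    show "(\<lambda>X. hom_eval D M N X \<circ> hopf_tensor_map D M R R (g \<circ> \<theta>) X) =
      (\<lambda>X. hom_eval D M N X \<circ> hopf_tensor_map D M R R (\<lambda>q. if q \<in> carrier R then q else 0) X)"
      unfolding id_eq[OF comodule_R hom_eval_hopf_hom]
      by (intro ext) (simp only: o_apply hopf_tensor_map_comp[OF comodule_R A(1) comodule_R \<theta>(2) g(2)] e1 e2)
    show "g \<circ> \<theta> \<in> comod_hom H R R" by (rule comod_hom_comp[OF comodule_R A(1) comodule_R \<theta>(2) g(2)])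
    show "(\<lambda>q. if q \<in> carrier R then q else 0) \<in> comod_hom H R R" by (rule comod_hom_id[OF comodule_R])
  qed
  from fun_cong[OF this] have gt: "g (\<theta> q) = q" if "q \<in> carrier R" for q
    using that by (simp add: o_def)
  have "\<theta> \<circ> g = (\<lambda>q. if q \<in> carrier A then q else 0)"
  proof (rule inj_onD[OF bij_betw_imp_inj_on[OF universal_arrowD(3)[OF A1 A(1)]]])
    show "(\<lambda>X. \<epsilon>' X \<circ> hopf_tensor_map D M A A (\<theta> \<circ> g) X) =
      (\<lambda>X. \<epsilon>' X \<circ> hopf_tensor_map D M A A (\<lambda>q. if q \<in> carrier A then q else 0) X)"
      unfolding id_eq[OF A]
      by (intro ext) (simp only: o_apply hopf_tensor_map_comp[OF A(1) comodule_R A(1) g(2) \<theta>(2)] e1 e2)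
    show "\<theta> \<circ> g \<in> comod_hom H A A" by (rule comod_hom_comp[OF A(1) comodule_R A(1) g(2) \<theta>(2)])
    show "(\<lambda>q. if q \<in> carrier A then q else 0) \<in> comod_hom H A A" by (rule comod_hom_id[OF A(1)])
  qed
  from fun_cong[OF this] have tg: "\<theta> (g q) = q" if "q \<in> carrier A" for q
    using that by (simp add: o_def)
  have iso: "\<theta> \<in> comod_iso H R A"
    unfolding comod_iso_def using \<theta>(2) g(2) gt tg by blast
  show ?thesis
  proof (rule ex1I[of _ \<theta>])
    show "\<theta> \<in> comod_iso H R A \<and> ?J \<theta> = hom_eval D M N" using iso \<theta>(1) by (rule conjI)
    fix \<theta>' assume \<theta>': "\<theta>' \<in> comod_iso H R A \<and> ?J \<theta>' = hom_eval D M N"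
    show "\<theta>' = \<theta>"
    proof (rule inj_onD[OF bij_betw_imp_inj_on[OF b1]])
      show "?J \<theta>' = ?J \<theta>" using \<theta>' \<theta>(1) by metis
      show "\<theta>' \<in> comod_hom H R A" using \<theta>' by (simp add: comod_iso_def)
    qed (rule \<theta>(2))
  qed
qed

end

text \<open>The canonical isomorphism is pinned down by compatibility with the counit and
  evaluation, which makes it unique. The adjunction is assumed at two test types, that of its own
  values and that of \<open>Hom(M, N)\<close>, since these are the comodules against which its
  universal arrow is tested.\<close>

theorem proposition5p13:
  fixes H :: "('k::field, 'h::ring_1) hopf"
    and D :: "('k, 'h, 'o, 'a::ab_group_add) cocat"
    and M :: "('k, 'h, 'o, 'a, 'm::ab_group_add) hopfmod"
    and N :: "('k, 'h, 'o, 'a, 'n::ab_group_add) hopfmod"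
  assumes "hopf_algebra H" and "bij (antipode H)"
    and "co_H_category H D"
    and "hopf_module H D M" and "hopf_module H D N"
    and "finitely_generated D M"
  shows "rational H (homspace D M N) (hom_act H D M N)
    \<and> comodule H (hom_comod H D M N)
    \<and> (\<forall>f\<in>dual H. \<forall>\<eta>\<in>dmod_hom D M N.
         comod_act H (hom_comod H D M N) f \<eta> = hom_act H D M N f \<eta>)
    \<and> universal_arrow TYPE('q::ab_group_add) H D M N (hom_comod H D M N) (hom_eval D M N)
    \<and> (\<forall>(R :: ('k, 'h, 'o, 'a, 'n) hopfmod \<Rightarrow> ('k, 'h, 'r::ab_group_add) comod) Rm \<epsilon>.
         right_adjoint TYPE('r) H D M R Rm \<epsilon> \<and>
         right_adjoint TYPE('o \<Rightarrow> 'm \<Rightarrow> 'n) H D M R Rm \<epsilon> \<longrightarrow>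
         (\<exists>!\<theta>. \<theta> \<in> comod_iso H (hom_comod H D M N) (R N) \<and>
            (\<lambda>X. \<epsilon> N X \<circ> hopf_tensor_map D M (hom_comod H D M N) (R N) \<theta> X) = hom_eval D M N))"
proof -
  interpret rational_hopf_modules H D M N
    using assms by unfold_locales
  have "\<exists>!\<theta>. \<theta> \<in> comod_iso H (hom_comod H D M N) (R' N) \<and>
      (\<lambda>X. \<epsilon>' N X \<circ> hopf_tensor_map D M (hom_comod H D M N) (R' N) \<theta> X) = hom_eval D M N"
    if "right_adjoint TYPE('r) H D M R' Rm \<epsilon>' \<and> right_adjoint TYPE('o \<Rightarrow> 'm \<Rightarrow> 'n) H D M R' Rm \<epsilon>'"
    for R' :: "('k, 'h, 'o, 'a, 'n) hopfmod \<Rightarrow> ('k, 'h, 'r) comod" and Rm \<epsilon>'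
    using that assms(5) by (intro comod_iso_universal) (simp_all add: right_adjoint_def)
  then show ?thesis
    using rational comodule_R R_act universal_hom by blast
qed

end
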